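(* Let $T>0$, $\alpha>\frac12$, $\omega\in C_\alpha([0,T];\mathbb{R}^m)$ and $x\in\mathbb{R}^n$. Suppose that $f$ and $\sigma$ satisfy conditions (i)–(v) listed in the context, and fix $\beta\in\left(1-\alpha,\frac12\right)$ such that $\rho\geq\frac1\beta$. Let $\mathcal{D}$ be a fixed index family and, for each $\delta\in\mathcal{D}$, let $G_\delta\in C_\alpha([0,T];\mathbb{R}^m)$. Let $u$ and, for $\delta\in\mathcal{D}$, $u_\delta$ denote the unique solutions in $C_{1-\beta}([0,T];\mathbb{R}^n)\subset W_{\beta,\infty}(0,T;\mathbb{R}^n)$ to $$u(t)-x=\int_0^t f(s,u(s))\,ds+\int_0^t\sigma(s,u(s))\,d\omega(s),\qquad t\in[0,T],$$ and $$u_\delta(t)-x=\int_0^t f(s,u_\delta(s))\,ds+\int_0^t\sigma(s,u_\delta(s))\,dG_\delta(s),\qquad t\in[0,T],$$ respectively. If $\sup_{\delta\in\mathcal{D}}\Vert G_\delta\Vert_{1,1-\beta}<\infty$, then there exists a constant $K$, independent of $\delta\in\mathcal{D}$, such that $$\Vert u_\delta-u\Vert_{\beta,\infty}\leq K\,\Vert G_\delta-\omega\Vert_{1,1-\beta}.$$ In particular, if $\Vert G_\delta-\omega\Vert_{1,1-\beta}\to 0$, then $\Vert u_\delta-u\Vert_{\beta,\infty}\to 0$.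
   Context: $|\cdot|$ denotes the Euclidean norm, and $C_\gamma$ denotes the space of $\gamma$-Hölder continuous functions on $[0,T]$. Norms. For $\beta\in(0,\frac12)$, $$\Vert g\Vert_{1,1-\beta}=\sup_{0<s<t<T}\left[\frac{|g(t)-g(s)|}{(t-s)^{1-\beta}}+\int_s^t\frac{|g(y)-g(s)|}{|y-s|^{2-\beta}}dy\right],\qquad \Vert h\Vert_{\beta,\infty}=\sup_{t\in[0,T]}\left[|h(t)|+\int_0^t\frac{|h(t)-h(s)|}{|t-s|^{\beta+1}}ds\right];$$ $W_{\beta,\infty}(0,T;\mathbb{R}^n)$ is the space of measurable $\mathbb{R}^n$-valued functions with $\Vert h\Vert_{\beta,\infty}<\infty$. Integral. Integrals against $\omega$ and $G_\delta$ are (componentwise) generalised Lebesgue–Stieltjes integrals: for real functions $h,g$ on $(a,b)$ such that $h(a+),g(a+),g(b-)$ exist and $h-h(a+)\in I^{\gamma}_{a+}(L_p)$, $g-g(b-)\in I^{1-\gamma}_{b-}(L_q)$ for some $\gamma\in[0,1]$, $p,q\in[1,\infty]$, $1/p+1/q=1$, $$\int_a^b h\,dg=(-1)^\gamma\int_a^b D^\gamma_{a+}(h-h(a+))(t)\,D^{1-\gamma}_{b-}(g-g(b-))(t)\,dt+h(a+)(g(b-)-g(a+)),$$ which does not depend on $\gamma$. Here $I^\gamma_{a+}h(t)=\frac{1}{\Gamma(\gamma)}\int_a^t\frac{h(s)}{(t-s)^{1-\gamma}}ds$ and $I^\gamma_{b-}h(t)=\frac{(-1)^{-\gamma}}{\Gamma(\gamma)}\int_t^b\frac{h(s)}{(s-t)^{1-\gamma}}ds$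 for $\gamma>0$ ($I^0$ is the identity), and $D^\gamma_{a+},D^\gamma_{b-}$ are their inverses, given for $\gamma\in(0,1)$ by $$D^\gamma_{a+}h(t)=\frac{1}{\Gamma(1-\gamma)}\left(\frac{h(t)}{(t-a)^\gamma}+\gamma\int_a^t\frac{h(t)-h(s)}{(t-s)^{\gamma+1}}ds\right),\quad D^\gamma_{b-}h(t)=\frac{(-1)^\gamma}{\Gamma(1-\gamma)}\left(\frac{h(t)}{(b-t)^\gamma}+\gamma\int_t^b\frac{h(t)-h(s)}{(s-t)^{\gamma+1}}ds\right),$$ with $(-1)^\gamma=e^{i\pi\gamma}$. Conditions on $f:[0,T]\times\mathbb{R}^n\to\mathbb{R}^n$ and $\sigma:[0,T]\times\mathbb{R}^n\to\mathbb{R}^{n\times m}$ (measurable, with $\sigma$ differentiable in the space variable): (i) There is $M>0$ such that for all $x,y\in\mathbb{R}^n$, $s,t\in[0,T]$ and all $i$: $|\sigma(t,x)-\sigma(t,y)|\le M|x-y|$ and $|\sigma(t,x)-\sigma(s,x)|+|\partial_{x_i}\sigma(t,x)-\partial_{x_i}\sigma(s,x)|\le M|t-s|$. (ii) For any $N>0$ there is $M_N>0$ such that for all $|x|,|y|\le N$, $t\in[0,T]$ and all $i$: $|\partial_{x_i}\sigma(t,x)-\partial_{y_i}\sigma(t,y)|\le M_N|x-y|$ (i.e. the $i$-th spatial partial derivative evaluated at $x$ and at $y$). (iii) There are $K_0>0$ and $\zeta\in[0,1]$ such that $|\sigma(t,x)|\le K_0(1+|x|^\zeta)$ for all $x\in\mathbb{R}^n$,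 $t\in[0,T]$. (iv) For any $N>0$ there is $L_N>0$ such that $|f(t,x)-f(t,y)|\le L_N|x-y|$ for all $|x|,|y|\le N$, $t\in[0,T]$. (v) There are $L_0>0$ and a function $b_0\in L^\rho(0,T)$, where $\rho>2$, such that $|f(t,x)|\le L_0|x|+b_0(t)$ for all $x\in\mathbb{R}^n$, $t\in[0,T]$. Under these conditions each of the two integral equations is known to have a unique solution in $C_{1-\beta}\subset W_{\beta,\infty}$. *)

theory Defs
  imports "HOL-Analysis.Analysis"
begin

text \<open>Functions on \<open>[0,T]\<close> are represented by total functions on \<^typ>\<open>real\<close> whose values outside
  the interval are never used.  Norms that may be infinite take values in \<^typ>\<open>ennreal\<close>.\<close>

definition holder_on :: "real \<Rightarrow> real set \<Rightarrow> (real \<Rightarrow> 'a::real_normed_vector) \<Rightarrow> bool" where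
  "holder_on \<gamma> S g \<longleftrightarrow>
     (\<exists>C\<ge>0. \<forall>s\<in>S. \<forall>t\<in>S. norm (g t - g s) \<le> C * \<bar>t - s\<bar> powr \<gamma>)"

definition lp_fun :: "ennreal \<Rightarrow> real \<Rightarrow> real \<Rightarrow> (real \<Rightarrow> 'a::euclidean_space) \<Rightarrow> bool" where
  "lp_fun p a b h \<longleftrightarrow> h \<in> borel_measurable (lebesgue_on {a<..<b}) \<and>
     (if p = \<infinity> then \<exists>C. AE t in lebesgue_on {a<..<b}. norm (h t) \<le> C
      else integrable (lebesgue_on {a<..<b}) (\<lambda>t. norm (h t) powr enn2real p))"


subsection \<open>Norms\<close>

definition norm_one :: "real \<Rightarrow> real \<Rightarrow> (real \<Rightarrow> 'a::euclidean_space) \<Rightarrow> ennreal" where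
  "norm_one T \<beta> g =
     (SUP (s, t) \<in> {(s, t). 0 < s \<and> s < t \<and> t < T}.
        ennreal (norm (g t - g s) / (t - s) powr (1 - \<beta>))
        + (\<integral>\<^sup>+ y \<in> {s..t}. ennreal (norm (g y - g s) / \<bar>y - s\<bar> powr (2 - \<beta>)) \<partial>lebesgue))"

definition norm_beta_inf :: "real \<Rightarrow> real \<Rightarrow> (real \<Rightarrow> 'a::euclidean_space) \<Rightarrow> ennreal" where
  "norm_beta_inf T \<beta> h =
     (SUP t \<in> {0..T}.
        ennreal (norm (h t))
        + (\<integral>\<^sup>+ s \<in> {0..t}. ennreal (norm (h t - h s) / \<bar>t - s\<bar> powr (\<beta> + 1)) \<partial>lebesgue))"


subsection \<open>Fractional integrals and derivatives\<close>

definition minus_one_pow :: "real \<Rightarrow> complex" where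
  "minus_one_pow \<gamma> = exp (\<i> * of_real (pi * \<gamma>))"

definition frac_int_left :: "real \<Rightarrow> real \<Rightarrow> (real \<Rightarrow> complex) \<Rightarrow> real \<Rightarrow> complex" where
  "frac_int_left \<gamma> a h t =
     (if \<gamma> = 0 then h t
      else 1 / of_real (Gamma \<gamma>)
        * (LINT s:{a<..<t}|lebesgue. h s / of_real ((t - s) powr (1 - \<gamma>))))"

definition frac_int_right :: "real \<Rightarrow> real \<Rightarrow> (real \<Rightarrow> complex) \<Rightarrow> real \<Rightarrow> complex" where
  "frac_int_right \<gamma> b h t =
     (if \<gamma> = 0 then h t
      else minus_one_pow (- \<gamma>) / of_real (Gamma \<gamma>)
        * (LINT s:{t<..<b}|lebesgue. h s / of_real ((s - t) powr (1 - \<gamma>))))"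

text \<open>The Weyl--Marchaud formulas, with the integral cut off at distance \<open>\<epsilon>\<close> from its
  singularity.\<close>

definition weyl_left :: "real \<Rightarrow> real \<Rightarrow> (real \<Rightarrow> complex) \<Rightarrow> real \<Rightarrow> real \<Rightarrow> complex" where
  "weyl_left \<gamma> a h \<epsilon> t =
     1 / of_real (Gamma (1 - \<gamma>))
       * (h t / of_real ((t - a) powr \<gamma>)
          + of_real \<gamma> * (LINT s:{a<..<t - \<epsilon>}|lebesgue. (h t - h s) / of_real ((t - s) powr (\<gamma> + 1))))"

definition weyl_right :: "real \<Rightarrow> real \<Rightarrow> (real \<Rightarrow> complex) \<Rightarrow> real \<Rightarrow> real \<Rightarrow> complex" where
  "weyl_right \<gamma> b h \<epsilon> t =
     minus_one_pow \<gamma> / of_real (Gamma (1 - \<gamma>))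
       * (h t / of_real ((b - t) powr \<gamma>)
          + of_real \<gamma> * (LINT s:{t + \<epsilon><..<b}|lebesgue. (h t - h s) / of_real ((s - t) powr (\<gamma> + 1))))"

text \<open>\<open>is_frac_deriv_left \<gamma> p a b h \<phi>\<close> says that \<open>h\<close> is in the image of \<open>L\<^sub>p(a,b)\<close> under the
  left-sided fractional integral of order \<open>\<gamma>\<close> and that \<open>\<phi>\<close> is its left-sided fractional derivative:
  the inverse image of \<open>h\<close>, given by the Weyl--Marchaud formula if \<open>0 < \<gamma> < 1\<close>.
  Elements of \<open>L\<^sub>p\<close> and of the image space are identified up to null sets.  For a general element
  of the image space the integral in the Weyl--Marchaud formula converges at its singularity only as
  an improper integral, for almost every \<open>t\<close>, whence the limit; if it converges absolutely, the limit is
  the Lebesgue integral.\<close>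

definition is_frac_deriv_left ::
  "real \<Rightarrow> ennreal \<Rightarrow> real \<Rightarrow> real \<Rightarrow> (real \<Rightarrow> complex) \<Rightarrow> (real \<Rightarrow> complex) \<Rightarrow> bool" where
  "is_frac_deriv_left \<gamma> p a b h \<phi> \<longleftrightarrow>
     lp_fun p a b \<phi> \<and>
     (AE t in lebesgue_on {a<..<b}. h t = frac_int_left \<gamma> a \<phi> t) \<and>
     (0 < \<gamma> \<and> \<gamma> < 1 \<longrightarrow>
        (AE t in lebesgue_on {a<..<b}. ((\<lambda>\<epsilon>. weyl_left \<gamma> a h \<epsilon> t) \<longlongrightarrow> \<phi> t) (at_right 0)))"

definition is_frac_deriv_right ::
  "real \<Rightarrow> ennreal \<Rightarrow> real \<Rightarrow> real \<Rightarrow> (real \<Rightarrow> complex) \<Rightarrow> (real \<Rightarrow> complex) \<Rightarrow> bool" where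
  "is_frac_deriv_right \<gamma> p a b h \<phi> \<longleftrightarrow>
     lp_fun p a b \<phi> \<and>
     (AE t in lebesgue_on {a<..<b}. h t = frac_int_right \<gamma> b \<phi> t) \<and>
     (0 < \<gamma> \<and> \<gamma> < 1 \<longrightarrow>
        (AE t in lebesgue_on {a<..<b}. ((\<lambda>\<epsilon>. weyl_right \<gamma> b h \<epsilon> t) \<longlongrightarrow> \<phi> t) (at_right 0)))"


subsection \<open>Generalised Lebesgue--Stieltjes integral\<close>

text \<open>Here \<open>ha\<close>, \<open>ga\<close>, \<open>gb\<close> are the one-sided limits \<open>h(a+)\<close>, \<open>g(a+)\<close>, \<open>g(b-)\<close>, and \<open>\<phi>\<close>, \<open>\<psi>\<close> are the
  fractional derivatives of \<open>h - h(a+)\<close> and \<open>g - g(b-)\<close> of orders \<open>\<gamma>\<close> and \<open>1 - \<gamma>\<close>.  In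
  \<^typ>\<open>ennreal\<close>, \<^prop>\<open>inverse (\<infinity> :: ennreal) = 0\<close>, so infinite exponents are included.  The integral
  over an empty interval is 0.\<close>

definition has_gls_integral ::
  "(real \<Rightarrow> real) \<Rightarrow> (real \<Rightarrow> real) \<Rightarrow> real \<Rightarrow> real \<Rightarrow> real \<Rightarrow> bool" where
  "has_gls_integral h g a b I \<longleftrightarrow>
     (a = b \<and> I = 0) \<or>
     (a < b \<and>
      (\<exists>\<gamma> p q ha ga gb \<phi> \<psi>.
         0 \<le> \<gamma> \<and> \<gamma> \<le> 1 \<and> 1 \<le> p \<and> 1 \<le> q \<and> inverse p + inverse q = 1 \<and>
         (h \<longlongrightarrow> ha) (at_right a) \<and> (g \<longlongrightarrow> ga) (at_right a) \<and> (g \<longlongrightarrow> gb) (at_left b) \<and>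
         is_frac_deriv_left \<gamma> p a b (\<lambda>t. of_real (h t - ha)) \<phi> \<and>
         is_frac_deriv_right (1 - \<gamma>) q a b (\<lambda>t. of_real (g t - gb)) \<psi> \<and>
         of_real I = minus_one_pow \<gamma> * (LINT t:{a<..<b}|lebesgue. \<phi> t * \<psi> t)
                     + of_real (ha * (gb - ga))))"

definition gls_integrable :: "(real \<Rightarrow> real) \<Rightarrow> (real \<Rightarrow> real) \<Rightarrow> real \<Rightarrow> real \<Rightarrow> bool" where
  "gls_integrable h g a b \<longleftrightarrow> (\<exists>I. has_gls_integral h g a b I)"

text \<open>The value of the integral does not depend on \<open>\<gamma>\<close>, which justifies the definite description.\<close>

definition gls_integral :: "(real \<Rightarrow> real) \<Rightarrow> (real \<Rightarrow> real) \<Rightarrow> real \<Rightarrow> real \<Rightarrow> real" where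
  "gls_integral h g a b = (THE I. has_gls_integral h g a b I)"

text \<open>Integrals of \<open>n \<times> m\<close> matrices against paths in \<open>m\<close> dimensions, componentwise.\<close>

definition gls_matrix_integrable ::
  "(real \<Rightarrow> real^'m^'n) \<Rightarrow> (real \<Rightarrow> real^'m) \<Rightarrow> real \<Rightarrow> real \<Rightarrow> bool" where
  "gls_matrix_integrable A g a b \<longleftrightarrow>
     (\<forall>i j. gls_integrable (\<lambda>s. A s $ i $ j) (\<lambda>s. g s $ j) a b)"

definition gls_matrix_integral ::
  "(real \<Rightarrow> real^'m^'n) \<Rightarrow> (real \<Rightarrow> real^'m) \<Rightarrow> real \<Rightarrow> real \<Rightarrow> real^'n" where
  "gls_matrix_integral A g a b =
     (\<chi> i. \<Sum>j\<in>UNIV. gls_integral (\<lambda>s. A s $ i $ j) (\<lambda>s. g s $ j) a b)"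


subsection \<open>Conditions on the coefficients\<close>

text \<open>The norm of \<^typ>\<open>real^'m^'n\<close> is the Euclidean norm of the matrix entries.\<close>

definition partial_deriv :: "'n \<Rightarrow> (real^'n \<Rightarrow> 'a::real_normed_vector) \<Rightarrow> real^'n \<Rightarrow> 'a" where
  "partial_deriv i F x = vector_derivative (\<lambda>r. F (x + r *\<^sub>R axis i 1)) (at 0)"

definition sigma_global_lipschitz :: "real \<Rightarrow> (real \<Rightarrow> real^'n \<Rightarrow> real^'m^'n) \<Rightarrow> bool" where
  "sigma_global_lipschitz T \<sigma> \<longleftrightarrow>
     (\<exists>M>0. \<forall>x y. \<forall>s\<in>{0..T}. \<forall>t\<in>{0..T}. \<forall>i.
        norm (\<sigma> t x - \<sigma> t y) \<le> M * norm (x - y) \<and>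
        norm (\<sigma> t x - \<sigma> s x) + norm (partial_deriv i (\<sigma> t) x - partial_deriv i (\<sigma> s) x)
          \<le> M * \<bar>t - s\<bar>)"

definition sigma_deriv_local_lipschitz :: "real \<Rightarrow> (real \<Rightarrow> real^'n \<Rightarrow> real^'m^'n) \<Rightarrow> bool" where
  "sigma_deriv_local_lipschitz T \<sigma> \<longleftrightarrow>
     (\<forall>N>0. \<exists>M>0. \<forall>x y. \<forall>t\<in>{0..T}. \<forall>i.
        norm x \<le> N \<and> norm y \<le> N \<longrightarrow>
        norm (partial_deriv i (\<sigma> t) x - partial_deriv i (\<sigma> t) y) \<le> M * norm (x - y))"

text \<open>The power uses \<^const>\<open>powr\<close>, for which \<^prop>\<open>0 powr 0 = (0::real)\<close>; this is immaterial as
  the constant may be enlarged.\<close>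

definition sigma_growth :: "real \<Rightarrow> (real \<Rightarrow> real^'n \<Rightarrow> real^'m^'n) \<Rightarrow> bool" where
  "sigma_growth T \<sigma> \<longleftrightarrow>
     (\<exists>K0>0. \<exists>\<zeta>\<in>{0..1}. \<forall>x. \<forall>t\<in>{0..T}. norm (\<sigma> t x) \<le> K0 * (1 + norm x powr \<zeta>))"

definition f_local_lipschitz :: "real \<Rightarrow> (real \<Rightarrow> real^'n \<Rightarrow> real^'n) \<Rightarrow> bool" where
  "f_local_lipschitz T f \<longleftrightarrow>
     (\<forall>N>0. \<exists>L>0. \<forall>x y. \<forall>t\<in>{0..T}.
        norm x \<le> N \<and> norm y \<le> N \<longrightarrow> norm (f t x - f t y) \<le> L * norm (x - y))"

definition f_growth :: "real \<Rightarrow> real \<Rightarrow> (real \<Rightarrow> real^'n \<Rightarrow> real^'n) \<Rightarrow> bool" where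
  "f_growth T \<rho> f \<longleftrightarrow>
     (\<exists>L0>0. \<exists>b0 :: real \<Rightarrow> real. lp_fun (ennreal \<rho>) 0 T b0 \<and>
        (\<forall>x. \<forall>t\<in>{0..T}. norm (f t x) \<le> L0 * norm x + b0 t))"


subsection \<open>The integral equation\<close>

definition is_solution ::
  "real \<Rightarrow> real \<Rightarrow> (real \<Rightarrow> real^'n \<Rightarrow> real^'n) \<Rightarrow> (real \<Rightarrow> real^'n \<Rightarrow> real^'m^'n) \<Rightarrow>
   (real \<Rightarrow> real^'m) \<Rightarrow> real^'n \<Rightarrow> (real \<Rightarrow> real^'n) \<Rightarrow> bool" where
  "is_solution T \<beta> f \<sigma> g x u \<longleftrightarrow>
     holder_on (1 - \<beta>) {0..T} u \<and>
     (\<forall>t\<in>{0..T}.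
        set_integrable lebesgue {0..t} (\<lambda>s. f s (u s)) \<and>
        gls_matrix_integrable (\<lambda>s. \<sigma> s (u s)) g 0 t \<and>
        u t - x = (LINT s:{0..t}|lebesgue. f s (u s))
                  + gls_matrix_integral (\<lambda>s. \<sigma> s (u s)) g 0 t)"

end

theory Submission
  imports Defs
begin

text \<open>Put \<open>\<kappa> = 1 - \<beta> > 1/2\<close>. Whatever the order \<open>\<gamma>\<close> and the exponents \<open>p, q\<close>, the generalised
  Lebesgue--Stieltjes integral of continuous functions is the forward limit
  \<open>1/\<epsilon> \<integral> h(t) (g(t + \<epsilon>) - g(t)) dt\<close> as \<open>\<epsilon> \<rightarrow> 0\<close>, with \<open>g\<close> frozen after the end point: by the Beta integral, for the
  fractional derivatives \<open>\<phi>, \<psi>\<close> of orders \<open>\<gamma>\<close> and \<open>1 - \<gamma>\<close> this quotient is the mean over \<open>0 < v \<le> \<epsilon>\<close> of \<open>\<integral> \<phi>(r) \<psi>(r + v) dr\<close>.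
  The forward quotients are bilinear and additive in the interval, so for \<open>\<kappa>\<close>-Hoelder functions they
  satisfy Young's estimate \<open>|\<integral>\<^sub>s\<^sup>t h dg| \<le> |h(s)| [g] (t-s)\<^sup>\<kappa> + C [h] [g] (t-s)\<^sup>2\<^sup>\<kappa>\<close> uniformly in \<open>\<epsilon>\<close>;
  passing to the limit bounds a difference \<open>\<integral> h\<^sub>1 dg\<^sub>1 - \<integral> h\<^sub>2 dg\<^sub>2\<close> without the mixed
  integrals having to exist. On short intervals Young's estimate improves any Hoelder constant \<open>w\<close> of \<open>u\<^sub>\<delta>\<close>
  or of \<open>u\<^sub>\<delta> - u\<close> to \<open>X + w/2\<close>, hence to \<open>2 X\<close>; chaining short intervals gives
  \<open>\<parallel>u\<^sub>\<delta> - u\<parallel> \<le> K [G\<^sub>\<delta> - \<omega>]\<close> in the \<open>\<kappa>\<close>-Hoelder norm, which dominates the norm of \<open>W\<^sub>\<beta>\<^sub>,\<^sub>\<infinity>\<close>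
  because \<open>2 \<beta> < 1\<close>, while \<open>[g] \<le> \<parallel>g\<parallel>\<^sub>1\<^sub>,\<^sub>1\<^sub>-\<^sub>\<beta>\<close>.\<close>

subsection \<open>Continuity of translations\<close>

text \<open>The order and the exponents may change with the end point and the matrix entry, and the
  equation provides integrals over \<open>[0,t]\<close> only, so neither additivity nor linearity
  can be read off from fractional derivatives. At a fixed \<epsilon> both are elementary, and
  uniqueness of limits also validates the definite description in \<open>gls_integral\<close>. Two
  further choices make the final constant uniform in \<delta>. First, the local Lipschitz constants
  depend on the size of the solutions, so a supremum bound common to all of them, drawn from the
  linear growth of the coefficients, precedes the comparison. Second, the driven terms are split as
  \<open>(h1 - h2) dg1 + h2 d(g1 - g2)\<close> with index 2 reserved for the solution driven by
  \<omega>. Then \<open>G \<delta>\<close> enters only through its uniform constant, and the Hoelder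
  constant of \<open>h1 - h2\<close> involves that of \<open>u\<close> and that of the difference of
  the solutions, but not that of the solution driven by \<open>G \<delta>\<close>. Hence one length
  of short intervals serves all \<delta>.\<close>

lemma lborel_translate:
  fixes f :: "real \<Rightarrow> 'a::{banach, second_countable_topology}"
  shows "integrable lborel (\<lambda>x. f (x + c)) \<longleftrightarrow> integrable lborel f"
    and "(\<integral>x. f (x + c) \<partial>lborel) = (\<integral>x. f x \<partial>lborel)"
  using lborel_integrable_real_affine_iff[of 1 f c] lborel_integral_real_affine[of 1 f c]
  by (simp_all add: add.commute)

lemmas bochner_cong = Bochner_Integration.integral_cong
  and bochner_bound = Bochner_Integration.integrable_bound
  and hk_combine = Henstock_Kurzweil_Integration.integral_combine
  and hk_diff = Henstock_Kurzweil_Integration.integral_diff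

text \<open>Only half of the continuity of an indicator is available: for a compact \<open>K\<close>
  the complement is open, so the positive part of \<open>1_K(x + v) - 1_K(x)\<close> tends to 0
  pointwise, while the negative part need not. The integral of the difference vanishes by
  translation invariance, so its L1 norm is twice the integral of the positive part. Inner
  regularity passes from \<open>A\<close> to \<open>K\<close>.\<close>

lemma L1_translation_indicator:
  fixes A :: "real set" and v :: "nat \<Rightarrow> real"
  assumes A: "A \<in> sets borel" and fin: "emeasure lborel A < \<infinity>" and v: "v \<longlonglongrightarrow> 0"
  shows "(\<lambda>n. \<integral>x. \<bar>indicator A (x + v n) - indicator A x\<bar> \<partial>lborel) \<longlonglongrightarrow> (0::real)"
proof -
  have shift: "integrable lborel (\<lambda>x. f (x + c)) \<and> (\<integral>x. f (x + c) \<partial>lborel) = (\<integral>x. f x \<partial>lborel)"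
    if "integrable lborel f" for f :: "real \<Rightarrow> real" and c
    using that by (simp add: lborel_translate)
  have indi: "integrable lborel (indicator B :: real \<Rightarrow> real)"
    if "B \<in> sets borel" "emeasure lborel B < \<infinity>" for B
    using that by simp
  show ?thesis
  proof (rule LIMSEQ_I)
    fix e :: real assume "e > 0"
    have Al: "A \<in> lmeasurable" using A fin by (simp add: fmeasurable_def)
    obtain C where C: "closed C" "C \<subseteq> A" "A - C \<in> lmeasurable" "emeasure lebesgue (A - C) < ennreal (e/8)"
      using sets_lebesgue_inner_closed[of A "e/8"] A \<open>e > 0\<close> by auto
    have Cl: "C \<in> lmeasurable"
      using C(1,2) Al by (intro fmeasurableI2[OF Al]) auto
    have mC: "measure lebesgue A < measure lebesgue C + e/8"
    proof -
      have "measure lebesgue (A - C) = measure lebesgue A - measure lebesgue C"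
        using Al Cl C(2) by (intro measurable_measure_Diff) auto
      moreover have "measure lebesgue (A - C) < e/8"
        using C(3,4) \<open>e > 0\<close> by (simp add: emeasure_eq_measure2 ennreal_less_iff)
      ultimately show ?thesis by simp
    qed
    have CU: "(\<Union>n. C \<inter> {-real n..real n}) = C"
    proof -
      have "\<exists>n. x \<in> {-real n..real n}" for x
      proof -
        obtain n where "\<bar>x\<bar> \<le> real n" using real_arch_simple by blast
        then have "x \<in> {-real n..real n}" by auto
        then show ?thesis ..
      qed
      then show ?thesis by blast
    qed
    have "(\<lambda>n. measure lebesgue (C \<inter> {-real n..real n})) \<longlonglongrightarrow> measure lebesgue (\<Union>n. C \<inter> {-real n..real n})"
      using Cl by (intro Lim_measure_incseq) (auto simp: incseq_def fmeasurable_def CU simp del: UN_simps Int_UN_distrib)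
    then have "(\<lambda>n. measure lebesgue (C \<inter> {-real n..real n})) \<longlonglongrightarrow> measure lebesgue C"
      unfolding CU .
    from LIMSEQ_D[OF this, of "e/8"] obtain n
      where "norm (measure lebesgue (C \<inter> {-real n..real n}) - measure lebesgue C) < e/8"
      using \<open>e > 0\<close> by auto
    then have n: "measure lebesgue C - measure lebesgue (C \<inter> {-real n..real n}) < e/8"
      unfolding real_norm_def abs_less_iff by linarith
    define K where "K = C \<inter> {-real n..real n}"
    have K: "compact K" "K \<subseteq> A" "measure lebesgue A < measure lebesgue K + e/4"
      using C(1,2) mC n unfolding K_def by (auto intro: closed_Int_compact)
    have Kb: "K \<in> sets borel" using K(1) by (simp add: borel_compact)
    have Kfin: "emeasure lborel K < \<infinity>" using K(1) emeasure_compact_finite by blast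
    obtain R where R: "\<And>x. x \<in> K \<Longrightarrow> \<bar>x\<bar> \<le> R"
      using compact_imp_bounded[OF K(1)] by (auto simp: bounded_iff)
    let ?k = "indicator K :: real \<Rightarrow> real" and ?a = "indicator A :: real \<Rightarrow> real"
    \<comment> \<open>Shifts shorter than 1 keep the translated set inside
      \<open>{-R-1..R+1}\<close>, whose indicator is the majorant.\<close>
    obtain m0 where m0: "\<And>n. n \<ge> m0 \<Longrightarrow> \<bar>v n\<bar> < 1"
      using LIMSEQ_D[OF v, of 1] by auto
    have lim: "(\<lambda>n. \<integral>x. max 0 (?k (x + v n) - ?k x) \<partial>lborel) \<longlonglongrightarrow> (\<integral>x. 0 \<partial>(lborel :: real measure))"
    proof (rule LIMSEQ_offset[where k = m0], rule integral_dominated_convergence)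
      show "integrable lborel (indicator {-R-1..R+1} :: real \<Rightarrow> real)"
        by (intro integrable_real_indicator) (auto simp: emeasure_lborel_Icc_eq)
      fix n
      show "AE x in lborel. norm (max 0 (?k (x + v (n+m0)) - ?k x)) \<le> indicator {-R-1..R+1} x"
        using R m0[of "n+m0"] by (intro AE_I2) (force simp: indicator_def)
    next
      show "AE x in lborel. (\<lambda>n. max 0 (?k (x + v (n+m0)) - ?k x)) \<longlonglongrightarrow> 0"
      proof (rule AE_I2)
        fix x
        show "(\<lambda>n. max 0 (?k (x + v (n+m0)) - ?k x)) \<longlonglongrightarrow> 0"
        proof (cases "x \<in> K")
          case True
          then have "(\<lambda>n. max 0 (?k (x + v (n+m0)) - ?k x)) = (\<lambda>n. 0)"
            by (auto simp: fun_eq_iff indicator_def)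
          then show ?thesis by simp
        next
          case False
          have "(\<lambda>n. x + v (n+m0)) \<longlonglongrightarrow> x + 0"
            by (intro tendsto_intros LIMSEQ_ignore_initial_segment v)
          moreover have "open (- K)" "x \<in> -K" using K(1) False by (auto simp: compact_imp_closed open_Compl)
          ultimately have "eventually (\<lambda>n. x + v (n+m0) \<in> -K) sequentially"
            using topological_tendstoD[of "\<lambda>n. x + v (n+m0)" x sequentially "-K"] by simp
          then have "eventually (\<lambda>n. max 0 (?k (x + v (n+m0)) - ?k x) = 0) sequentially"
            by eventually_elim (use False in auto)
          then show ?thesis by (rule tendsto_eventually)
        qed
      qed
    qed (use Kb in measurable)
    have kint: "integrable lborel ?k" "integrable lborel (\<lambda>x. ?k (x + c))"
      "(\<integral>x. ?k (x + c) \<partial>lborel) = (\<integral>x. ?k x \<partial>lborel)" for c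
      using indi[OF Kb Kfin] shift[OF indi[OF Kb Kfin]] by auto
    have aint: "integrable lborel ?a" "integrable lborel (\<lambda>x. ?a (x + c))"
      "(\<integral>x. ?a (x + c) \<partial>lborel) = (\<integral>x. ?a x \<partial>lborel)" for c
      using indi[OF A fin] shift[OF indi[OF A fin]] by auto
    have diff: "(\<integral>x. ?a x - ?k x \<partial>lborel) \<le> e/4"
    proof -
      have "(\<integral>x. ?a x - ?k x \<partial>lborel) = measure lborel A - measure lborel K"
        using aint(1) kint(1) by (simp add: Bochner_Integration.integral_diff)
      then show ?thesis using K(3) A Kb by simp
    qed
    obtain n0 where n0: "\<And>n. n \<ge> n0 \<Longrightarrow> (\<integral>x. max 0 (?k (x + v n) - ?k x) \<partial>lborel) < e/4"
      using LIMSEQ_D[OF lim, of "e/4"] \<open>e > 0\<close> by force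
    show "\<exists>no. \<forall>n\<ge>no. norm ((\<integral>x. \<bar>?a (x + v n) - ?a x\<bar> \<partial>lborel) - 0) < e"
    proof (intro exI allI impI)
      fix n assume n: "n0 \<le> n"
      have kmax: "integrable lborel (\<lambda>x. max 0 (?k (x + v n) - ?k x))"
        using kint by (intro integrable_max) auto
      \<comment> \<open>Pointwise \<open>\<bar>d\<bar> = 2 * max 0 d - d\<close> for the increment
        \<open>d\<close> of \<open>1_K\<close>; the two brackets before it pay for replacing
        \<open>A\<close> by \<open>K\<close> at \<open>x + v n\<close> and at
        \<open>x\<close>.\<close>
      have "(\<integral>x. \<bar>?a (x + v n) - ?a x\<bar> \<partial>lborel)
          \<le> (\<integral>x. (?a (x + v n) - ?k (x + v n)) + (?a x - ?k x)
               + (2 * max 0 (?k (x + v n) - ?k x) - (?k (x + v n) - ?k x)) \<partial>lborel)"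
        by (intro integral_mono integrable_abs Bochner_Integration.integrable_diff
              Bochner_Integration.integrable_add integrable_mult_right aint kint kmax)
           (use K(2) in \<open>auto simp: indicator_def\<close>)
      also have "\<dots> = 2 * (\<integral>x. ?a x - ?k x \<partial>lborel) + 2 * (\<integral>x. max 0 (?k (x + v n) - ?k x) \<partial>lborel)"
        using aint kint kmax
        by (simp add: Bochner_Integration.integral_diff Bochner_Integration.integral_add)
      also have "\<dots> < e" using diff n0[OF n] \<open>e > 0\<close> by simp
      finally show "norm ((\<integral>x. \<bar>?a (x + v n) - ?a x\<bar> \<partial>lborel) - 0) < e"
        by simp
    qed
  qed
qed

text \<open>A density argument along \<open>integrable_induct\<close>: the property holds for
  indicators, is stable under sums, and survives dominated limits because translation preserves the
  L1 distance between approximant and limit.\<close>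

lemma L1_translation:
  fixes f :: "real \<Rightarrow> 'a::{banach, second_countable_topology}" and v :: "nat \<Rightarrow> real"
  assumes "integrable lborel f" and v: "v \<longlonglongrightarrow> 0"
  shows "(\<lambda>n. \<integral>x. norm (f (x + v n) - f x) \<partial>lborel) \<longlonglongrightarrow> 0"
  using assms(1)
proof (induct rule: integrable_induct)
  case (base A c)
  have "(\<lambda>n. (\<integral>x. \<bar>indicator A (x + v n) - indicator A x\<bar> \<partial>lborel) * norm c) \<longlonglongrightarrow> 0 * norm c"
    by (intro tendsto_intros L1_translation_indicator v) (use base in auto)
  moreover have "norm (indicator A (x + w) *\<^sub>R c - indicator A x *\<^sub>R c)
      = \<bar>indicator A (x + w) - indicator A x\<bar> * norm c" for x w :: real
    by (metis norm_scaleR scaleR_left_diff_distrib)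
  ultimately show ?case by simp
next
  case (add f g)
  show ?case
  proof (rule tendsto_sandwich[OF _ _ tendsto_const])
    show "(\<lambda>n. (\<integral>x. norm (f (x + v n) - f x) \<partial>lborel) + (\<integral>x. norm (g (x + v n) - g x) \<partial>lborel)) \<longlonglongrightarrow> 0"
      using tendsto_add[OF add(2,4)] by simp
    have "(\<integral>x. norm (f (x + c) + g (x + c) - (f x + g x)) \<partial>lborel)
      \<le> (\<integral>x. norm (f (x + c) - f x) \<partial>lborel) + (\<integral>x. norm (g (x + c) - g x) \<partial>lborel)" for c
    proof -
      have i: "integrable lborel (\<lambda>x. f (x + c) - f x)" "integrable lborel (\<lambda>x. g (x + c) - g x)"
        using add(1,3) by (auto simp: lborel_translate)
      have "norm (f (x + c) + g (x + c) - (f x + g x)) \<le> norm (f (x + c) - f x) + norm (g (x + c) - g x)" for x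
        by (metis add_diff_add norm_triangle_ineq)
      then have "(\<integral>x. norm (f (x + c) + g (x + c) - (f x + g x)) \<partial>lborel)
        \<le> (\<integral>x. norm (f (x + c) - f x) + norm (g (x + c) - g x) \<partial>lborel)"
        using i Bochner_Integration.integrable_add[OF i]
        by (intro integral_mono) (auto simp: add_diff_add)
      then show ?thesis using i by simp
    qed
    then show "\<forall>\<^sub>F n in sequentially. (\<integral>x. norm (f (x + v n) + g (x + v n) - (f x + g x)) \<partial>lborel)
      \<le> (\<integral>x. norm (f (x + v n) - f x) \<partial>lborel) + (\<integral>x. norm (g (x + v n) - g x) \<partial>lborel)" by simp
  qed auto
next
  case (lim f s)
  have sf: "(\<lambda>i. \<integral>x. norm (s i x - f x) \<partial>lborel) \<longlonglongrightarrow> (\<integral>x. 0 \<partial>(lborel :: real measure))"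
  proof (rule integral_dominated_convergence)
    \<comment> \<open>The induction principle supplies
      \<open>norm (s i x) \<le> 2 * norm (f x)\<close>, whence the factor 3.\<close>
    show "integrable lborel (\<lambda>x. 3 * norm (f x))" using lim by auto
    show "AE x in lborel. norm (norm (s i x - f x)) \<le> 3 * norm (f x)" for i
    proof (rule AE_I2)
      fix x :: real
      have "norm (s i x - f x) \<le> norm (s i x) + norm (f x)" by (rule norm_triangle_ineq4)
      also have "\<dots> \<le> 3 * norm (f x)" using lim(4)[of x i] by simp
      finally show "norm (norm (s i x - f x)) \<le> 3 * norm (f x)" by simp
    qed
    show "AE x in lborel. (\<lambda>i. norm (s i x - f x)) \<longlonglongrightarrow> 0"
      using lim(3) by (auto intro!: tendsto_norm_zero simp: LIM_zero_iff)
    show "(\<lambda>x. norm (s i x - f x)) \<in> borel_measurable lborel" for i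
      using lim(1)[of i] lim(5) by measurable
  qed simp
  show ?case
  proof (rule LIMSEQ_I)
    fix e :: real assume "e > 0"
    obtain i where i: "(\<integral>x. norm (s i x - f x) \<partial>lborel) < e/4"
      using LIMSEQ_D[OF sf, of "e/4"] \<open>e > 0\<close> by force
    obtain n0 where n0: "\<And>n. n \<ge> n0 \<Longrightarrow> (\<integral>x. norm (s i (x + v n) - s i x) \<partial>lborel) < e/4"
      using LIMSEQ_D[OF lim(2)[of i], of "e/4"] \<open>e > 0\<close> by force
    show "\<exists>no. \<forall>n\<ge>no. norm ((\<integral>x. norm (f (x + v n) - f x) \<partial>lborel) - 0) < e"
    proof (intro exI allI impI)
      fix n assume n: "n0 \<le> n"
      define c where "c = v n"
      have d: "integrable lborel (\<lambda>x. norm (s i x - f x))" using lim by auto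
      have i1: "integrable lborel (\<lambda>x. norm (s i (x + c) - f (x + c)))"
        using d lborel_translate(1)[of "\<lambda>x. norm (s i x - f x)" c] by simp
      have i2: "integrable lborel (\<lambda>x. norm (s i (x + c) - s i x))"
        "integrable lborel (\<lambda>x. norm (f (x + c) - f x))"
        using lim(1)[of i] lim(5) by (auto simp: lborel_translate)
      have tri: "norm (f (x + c) - f x) \<le> norm (s i (x + c) - f (x + c)) + norm (s i x - f x) + norm (s i (x + c) - s i x)" for x
        by norm
      have "(\<integral>x. norm (f (x + c) - f x) \<partial>lborel)
        \<le> (\<integral>x. norm (s i (x + c) - f (x + c)) + norm (s i x - f x) + norm (s i (x + c) - s i x) \<partial>lborel)"
        by (intro integral_mono Bochner_Integration.integrable_add i1 i2 d tri)
      also have "\<dots> = 2 * (\<integral>x. norm (s i x - f x) \<partial>lborel) + (\<integral>x. norm (s i (x + c) - s i x) \<partial>lborel)"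
        using i1 i2 d lborel_translate(2)[of "\<lambda>x. norm (s i x - f x)" c] by simp
      also have "\<dots> < e" using i n0[OF n] \<open>e > 0\<close> by (simp add: c_def)
      finally show "norm ((\<integral>x. norm (f (x + v n) - f x) \<partial>lborel) - 0) < e"
        by (simp add: c_def)
    qed
  qed
qed

section \<open>Continuity of correlations at zero\<close>

text \<open>For Borel representatives of the two fractional derivatives, the value at
  \<open>v = 0\<close> is the integral that the generalised Lebesgue--Stieltjes definition
  multiplies by its phase; continuity there makes the forward limit exist.\<close>

definition correlation :: "(real \<Rightarrow> complex) \<Rightarrow> (real \<Rightarrow> complex) \<Rightarrow> real \<Rightarrow> complex" where
  "correlation \<phi> \<psi> v = (\<integral>r. \<phi> r * \<psi> (r + v) \<partial>lborel)"

text \<open>Moves the translation to the other factor, so that a bounded \<psi> can be treated like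
  a bounded \<phi>.\<close>

lemma correlation_swap: "correlation \<phi> \<psi> v = correlation \<psi> \<phi> (- v)"
  using lborel_translate(2)[of "\<lambda>x. \<psi> x * \<phi> (x - v)" v]
  by (simp add: correlation_def mult.commute)

text \<open>The increment is at most \<open>K\<close> times the L1 distance between \<psi> and its
  translate.\<close>

lemma correlation_tendsto_bounded:
  assumes \<psi>: "integrable lborel \<psi>" and [measurable]: "\<phi> \<in> borel_measurable borel"
    and K: "\<And>r. norm (\<phi> r) \<le> K" and v: "v \<longlonglongrightarrow> 0"
  shows "(\<lambda>n. correlation \<phi> \<psi> (v n)) \<longlonglongrightarrow> correlation \<phi> \<psi> 0"
proof -
  have [measurable]: "\<psi> \<in> borel_measurable borel" using \<psi> by auto
  have i\<psi>: "integrable lborel (\<lambda>r. \<psi> (r + c))" for c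
    using \<psi> by (simp add: lborel_translate)
  have i: "integrable lborel (\<lambda>r. \<phi> r * \<psi> (r + c))" for c
  proof (rule bochner_bound)
    show "integrable lborel (\<lambda>r. K *\<^sub>R \<psi> (r + c))" using i\<psi> by auto
    show "AE r in lborel. norm (\<phi> r * \<psi> (r + c)) \<le> norm (K *\<^sub>R \<psi> (r + c))"
      using K by (intro AE_I2) (auto simp: norm_mult intro!: mult_right_mono order_trans[OF K])
  qed measurable
  have "(\<lambda>n. correlation \<phi> \<psi> (v n) - correlation \<phi> \<psi> 0) \<longlonglongrightarrow> 0"
  proof (rule Lim_null_comparison)
    show "(\<lambda>n. K * (\<integral>x. norm (\<psi> (x + v n) - \<psi> x) \<partial>lborel)) \<longlonglongrightarrow> 0"
      using tendsto_mult_right_zero[OF L1_translation[OF \<psi> v]] .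
    have "norm (correlation \<phi> \<psi> c - correlation \<phi> \<psi> 0) \<le> K * (\<integral>x. norm (\<psi> (x + c) - \<psi> x) \<partial>lborel)" for c
    proof -
      have "correlation \<phi> \<psi> c - correlation \<phi> \<psi> 0 = (\<integral>x. \<phi> x * \<psi> (x + c) - \<phi> x * \<psi> x \<partial>lborel)"
        using i[of c] i[of 0] by (simp add: correlation_def)
      also have "norm \<dots> \<le> (\<integral>x. K * norm (\<psi> (x + c) - \<psi> x) \<partial>lborel)"
      proof (rule Bochner_Integration.integral_norm_bound_integral)
        show "integrable lborel (\<lambda>x. \<phi> x * \<psi> (x + c) - \<phi> x * \<psi> x)"
          using i[of c] i[of 0] by simp
        show "integrable lborel (\<lambda>x. K * norm (\<psi> (x + c) - \<psi> x))"
          using i\<psi>[of c] i\<psi>[of 0] by simp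
        show "norm (\<phi> x * \<psi> (x + c) - \<phi> x * \<psi> x) \<le> K * norm (\<psi> (x + c) - \<psi> x)" for x
          using K by (simp add: norm_mult right_diff_distrib[symmetric] mult_right_mono)
      qed
      finally show ?thesis by simp
    qed
    then show "\<forall>\<^sub>F n in sequentially. norm (correlation \<phi> \<psi> (v n) - correlation \<phi> \<psi> 0)
      \<le> K * (\<integral>x. norm (\<psi> (x + v n) - \<psi> x) \<partial>lborel)" by simp
  qed
  then show ?thesis by (simp add: LIM_zero_iff)
qed

text \<open>Young's inequality for \<open>a / \<eta>\<close> and \<open>\<eta> * b\<close>, with the
  factors \<open>1/p\<close> and \<open>1/q\<close> estimated by 1. The weight makes one term small
  at the cost of the other; this stands in for Hoelder's inequality below.\<close>

lemma Youngs_inequality_scaled: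
  fixes p q \<eta> a b :: real
  assumes "1 < p" "1 < q" "1/p + 1/q = 1" "0 < \<eta>" "0 \<le> a" "0 \<le> b"
  shows "a * b \<le> \<eta> powr (- p) * a powr p + \<eta> powr q * b powr q"
proof -
  have le: "X / c \<le> X" if "0 \<le> X" "1 < c" for X c :: real
    using that mult_left_mono[of 1 c X] by (simp add: divide_le_eq)
  have "a * b = (a / \<eta>) * (\<eta> * b)" using assms by simp
  also have "\<dots> \<le> (a / \<eta>) powr p / p + (\<eta> * b) powr q / q"
    using Youngs_inequality[of p q "a/\<eta>" "\<eta>*b"] assms by simp
  also have "\<dots> \<le> (a / \<eta>) powr p + (\<eta> * b) powr q"
    using assms by (intro add_mono le) auto
  finally show ?thesis using assms by (simp add: powr_divide powr_mult powr_minus divide_inverse inverse_powr mult.commute)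
qed

text \<open>Large values of \<phi> are cut off at a level \<open>K\<close>. What remains is bounded,
  hence covered by \<open>correlation_tendsto_bounded\<close>, and the part cut off contributes
  little, uniformly in the translation.\<close>

lemma correlation_tendsto_conjugate:
  assumes pq: "1 < p" "1 < q" "1/p + 1/q = 1"
    and \<phi>: "integrable lborel \<phi>" "integrable lborel (\<lambda>r. norm (\<phi> r) powr p)"
    and \<psi>: "integrable lborel \<psi>" "integrable lborel (\<lambda>r. norm (\<psi> r) powr q)"
    and v: "v \<longlonglongrightarrow> 0"
  shows "(\<lambda>n. correlation \<phi> \<psi> (v n)) \<longlonglongrightarrow> correlation \<phi> \<psi> 0"
proof (rule LIMSEQ_I)
  fix e :: real assume e: "e > 0"
  have [measurable]: "\<phi> \<in> borel_measurable borel" "\<psi> \<in> borel_measurable borel"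
    using \<phi> \<psi> by auto
  define B where "B = (\<integral>r. norm (\<psi> r) powr q \<partial>lborel)"
  have B: "B \<ge> 0" unfolding B_def by simp
  \<comment> \<open>The weight comes first and makes the \<psi> term at most \<open>e / 8\<close>;
    only then is \<open>K\<close> chosen, against the now fixed factor
    \<open>\<eta> powr (- p)\<close>.\<close>
  define \<eta> where "\<eta> = (e / (8 * (B + 1))) powr (1/q)"
  have \<eta>: "\<eta> > 0" using e B by (simp add: \<eta>_def)
  have "\<eta> powr q = e / (8 * (B + 1))" using e B pq by (simp add: \<eta>_def powr_powr)
  then have "\<eta> powr q * (B + 1) = e / 8" using B by (auto simp: divide_simps algebra_simps)
  then have \<eta>B: "\<eta> powr q * B \<le> e / 8"
    using mult_left_mono[of B "B + 1" "\<eta> powr q"] by simp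
  define hi where "hi K r = (if norm (\<phi> r) > real K then \<phi> r else 0)" for K r
  define lo where "lo K r = (if norm (\<phi> r) > real K then 0 else \<phi> r)" for K r
  have [measurable]: "hi K \<in> borel_measurable borel" "lo K \<in> borel_measurable borel" for K
    unfolding hi_def lo_def by measurable
  have hile: "norm (hi K r) powr p \<le> norm (\<phi> r) powr p" for K r
    by (auto simp: hi_def)
  have "(\<lambda>K. \<integral>r. norm (hi K r) powr p \<partial>lborel) \<longlonglongrightarrow> (\<integral>r. 0 \<partial>(lborel :: real measure))"
  proof (rule integral_dominated_convergence)
    show "AE r in lborel. norm (norm (hi K r) powr p) \<le> norm (\<phi> r) powr p" for K
      using hile by simp
    show "AE r in lborel. (\<lambda>K. norm (hi K r) powr p) \<longlonglongrightarrow> 0"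
    proof (rule AE_I2)
      fix r
      obtain K0 :: nat where K0: "norm (\<phi> r) \<le> K0" using real_arch_simple by blast
      then have "\<forall>K\<ge>K0. norm (hi K r) powr p = 0" by (auto simp: hi_def)
      then show "(\<lambda>K. norm (hi K r) powr p) \<longlonglongrightarrow> 0"
        by (intro tendsto_eventually) (auto simp: eventually_sequentially)
    qed
  qed (use \<phi> in auto)
  then obtain K where K: "(\<integral>r. norm (hi K r) powr p \<partial>lborel) < e / 8 / \<eta> powr (- p)"
    using LIMSEQ_D[of _ 0 "e / 8 / \<eta> powr (- p)"] e \<eta> by force
  have ihi: "integrable lborel (\<lambda>r. norm (hi K r) powr p)"
    by (rule bochner_bound[OF \<phi>(2)]) (use hile in auto)
  have i\<psi>: "integrable lborel (\<lambda>r. norm (\<psi> (r + c)) powr q)" "integrable lborel (\<lambda>r. \<psi> (r + c))" for c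
    using lborel_translate(1)[of "\<lambda>r. norm (\<psi> r) powr q" c] lborel_translate(1)[of \<psi> c] \<psi> by auto
  have bd: "norm (hi K r * \<psi> (r + c)) \<le> \<eta> powr (- p) * norm (hi K r) powr p + \<eta> powr q * norm (\<psi> (r + c)) powr q" for r c
    using Youngs_inequality_scaled[OF pq \<eta>, of "norm (hi K r)" "norm (\<psi> (r + c))"] by (simp add: norm_mult)
  have imaj: "integrable lborel (\<lambda>r. \<eta> powr (- p) * norm (hi K r) powr p + \<eta> powr q * norm (\<psi> (r + c)) powr q)" for c
    using ihi i\<psi>(1)[of c] by auto
  have i1: "integrable lborel (\<lambda>r. hi K r * \<psi> (r + c))" for c
    by (rule bochner_bound[OF imaj[of c]])
       (use bd in \<open>auto intro: order_trans[OF _ abs_ge_self]\<close>)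
  have lob: "norm (lo K r) \<le> real K" for r by (auto simp: lo_def)
  have i2: "integrable lborel (\<lambda>r. lo K r * \<psi> (r + c))" for c
  proof (rule bochner_bound)
    show "integrable lborel (\<lambda>r. real K *\<^sub>R \<psi> (r + c))" using i\<psi> by auto
    show "AE r in lborel. norm (lo K r * \<psi> (r + c)) \<le> norm (real K *\<^sub>R \<psi> (r + c))"
      using lob by (intro AE_I2) (auto simp: norm_mult intro!: mult_right_mono)
  qed measurable
  have split: "correlation \<phi> \<psi> c = correlation (lo K) \<psi> c + correlation (hi K) \<psi> c" for c
  proof -
    have "\<phi> r * \<psi> (r + c) = lo K r * \<psi> (r + c) + hi K r * \<psi> (r + c)" for r
      by (auto simp: lo_def hi_def)
    then show ?thesis using i1[of c] i2[of c] by (simp add: correlation_def)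
  qed
  have small: "norm (correlation (hi K) \<psi> c) \<le> e / 4" for c
  proof -
    have "norm (correlation (hi K) \<psi> c)
      \<le> (\<integral>r. \<eta> powr (- p) * norm (hi K r) powr p + \<eta> powr q * norm (\<psi> (r + c)) powr q \<partial>lborel)"
      unfolding correlation_def by (intro Bochner_Integration.integral_norm_bound_integral i1 imaj bd)
    also have "\<dots> = \<eta> powr (- p) * (\<integral>r. norm (hi K r) powr p \<partial>lborel) + \<eta> powr q * B"
      using ihi i\<psi>(1)[of c] lborel_translate(2)[of "\<lambda>r. norm (\<psi> r) powr q" c] by (simp add: B_def)
    also have "\<dots> \<le> e / 8 + e / 8"
      using K \<eta>B \<eta> by (intro add_mono) (auto simp: field_simps)
    finally show ?thesis by simp
  qed
  have "(\<lambda>n. correlation (lo K) \<psi> (v n)) \<longlonglongrightarrow> correlation (lo K) \<psi> 0"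
    by (rule correlation_tendsto_bounded[OF \<psi>(1) _ lob v]) measurable
  then obtain n0 where n0: "\<And>n. n \<ge> n0 \<Longrightarrow> norm (correlation (lo K) \<psi> (v n) - correlation (lo K) \<psi> 0) < e / 4"
    using LIMSEQ_D[of _ _ "e/4"] e by (metis divide_pos_pos zero_less_numeral)
  show "\<exists>no. \<forall>n\<ge>no. norm (correlation \<phi> \<psi> (v n) - correlation \<phi> \<psi> 0) < e"
  proof (intro exI allI impI)
    fix n assume "n0 \<le> n"
    have "norm (correlation \<phi> \<psi> (v n) - correlation \<phi> \<psi> 0)
      \<le> norm (correlation (lo K) \<psi> (v n) - correlation (lo K) \<psi> 0)
        + norm (correlation (hi K) \<psi> (v n)) + norm (correlation (hi K) \<psi> 0)"
      unfolding split by norm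
    also have "\<dots> < e"
      using n0[OF \<open>n0 \<le> n\<close>] small[of "v n"] small[of 0] e by linarith
    finally show "norm (correlation \<phi> \<psi> (v n) - correlation \<phi> \<psi> 0) < e" .
  qed
qed

subsection \<open>Riemann--Liouville kernels\<close>

text \<open>The kernel of the fractional integral of order \<gamma>. Being zero on the left
  half-line, it turns integrals over \<open>(a,t)\<close> or \<open>(t,b)\<close> of functions
  supported in \<open>(a,b)\<close> into integrals over the whole line.\<close>

definition rl_kernel :: "real \<Rightarrow> real \<Rightarrow> real" where
  "rl_kernel \<gamma> x = (if 0 < x then x powr (\<gamma> - 1) / Gamma \<gamma> else 0)"

lemma rl_kernel_measurable[measurable]: "rl_kernel \<gamma> \<in> borel_measurable borel"
  unfolding rl_kernel_def by measurable

lemma rl_kernel_nonneg: "0 < \<gamma> \<Longrightarrow> 0 \<le> rl_kernel \<gamma> x"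
  by (simp add: rl_kernel_def Gamma_real_pos less_imp_le)

text \<open>The semigroup law for the orders \<gamma> and \<open>1 - \<gamma>\<close>: the
  convolution has order 1, so it is the indicator of a half-line. Rescaling \<open>(r,s)\<close> to
  \<open>(0,1)\<close> cancels all powers of the length and leaves
  \<open>Beta \<gamma> (1 - \<gamma>)\<close>, the product of the two Gamma values.\<close>

lemma rl_kernel_convolution:
  assumes \<gamma>: "0 < \<gamma>" "\<gamma> < 1"
  shows "(\<integral>\<^sup>+t. ennreal (rl_kernel \<gamma> (t - r) * rl_kernel (1 - \<gamma>) (s - t)) \<partial>lborel) = indicator {r<..} s"
proof (cases "r < s")
  case False
  then have "(\<lambda>t. ennreal (rl_kernel \<gamma> (t - r) * rl_kernel (1 - \<gamma>) (s - t))) = (\<lambda>_. 0)"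
    by (auto simp: rl_kernel_def fun_eq_iff)
  then show ?thesis using False by simp
next
  case True
  define d where "d = s - r"
  have d: "d > 0" using True by (simp add: d_def)
  have G: "Gamma \<gamma> > 0" "Gamma (1 - \<gamma>) > 0" using \<gamma> by (auto intro: Gamma_real_pos)
  have "(\<integral>\<^sup>+t. ennreal (rl_kernel \<gamma> (t - r) * rl_kernel (1 - \<gamma>) (s - t)) \<partial>lborel)
    = ennreal d * (\<integral>\<^sup>+x. ennreal (rl_kernel \<gamma> (r + d * x - r) * rl_kernel (1 - \<gamma>) (s - (r + d * x))) \<partial>lborel)"
    using d by (subst nn_integral_real_affine[of _ d r]) auto
  also have "(\<integral>\<^sup>+x. ennreal (rl_kernel \<gamma> (r + d * x - r) * rl_kernel (1 - \<gamma>) (s - (r + d * x))) \<partial>lborel)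
    = (\<integral>\<^sup>+x. ennreal (1 / (d * Gamma \<gamma> * Gamma (1 - \<gamma>))) * ennreal (x powr (\<gamma> - 1) * (1 - x) powr ((1 - \<gamma>) - 1) * indicator {0..1} x) \<partial>lborel)"
  proof (intro nn_integral_cong)
    fix x :: real
    have eq: "rl_kernel \<gamma> (d * x) * rl_kernel (1 - \<gamma>) (d * (1 - x))
      = 1 / (d * Gamma \<gamma> * Gamma (1 - \<gamma>)) * (x powr (\<gamma> - 1) * (1 - x) powr ((1 - \<gamma>) - 1) * indicator {0..1} x)"
    proof (cases "0 < x \<and> x < 1")
      case True
      have "d powr (\<gamma> - 1) * d powr (- \<gamma>) = 1 / d"
        using d by (simp only: powr_add[symmetric]) (simp add: powr_minus_divide)
      moreover have "rl_kernel \<gamma> (d * x) * rl_kernel (1 - \<gamma>) (d * (1 - x))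
        = (d powr (\<gamma> - 1) * d powr (- \<gamma>)) * (x powr (\<gamma> - 1) * (1 - x) powr (- \<gamma>)) / (Gamma \<gamma> * Gamma (1 - \<gamma>))"
        using True d by (simp add: rl_kernel_def powr_mult)
      ultimately show ?thesis
        using True by simp
    next
      case False
      then show ?thesis using d by (auto simp: rl_kernel_def indicator_def zero_less_mult_iff)
    qed
    have "s - (r + d * x) = d * (1 - x)" by (simp add: d_def algebra_simps)
    then show "ennreal (rl_kernel \<gamma> (r + d * x - r) * rl_kernel (1 - \<gamma>) (s - (r + d * x)))
      = ennreal (1 / (d * Gamma \<gamma> * Gamma (1 - \<gamma>))) * ennreal (x powr (\<gamma> - 1) * (1 - x) powr ((1 - \<gamma>) - 1) * indicator {0..1} x)"
      using d G by (simp add: eq ennreal_mult'[symmetric] del: ennreal_mult')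
  qed
  also have "\<dots> = ennreal (1 / (d * Gamma \<gamma> * Gamma (1 - \<gamma>))) * ennreal (Beta \<gamma> (1 - \<gamma>))"
    by (subst nn_integral_cmult)
       (use nn_integral_has_integral_lebesgue[OF _ has_integral_Beta_real[of \<gamma> "1 - \<gamma>"]] \<gamma> in \<open>auto simp: mult.commute\<close>)
  also have "ennreal d * \<dots> = ennreal 1"
    using d G by (simp add: ennreal_mult'[symmetric] Beta_def)
  finally show ?thesis using True by simp
qed

lemma lborel_pair_integrable_mult:
  fixes \<phi> \<psi> :: "real \<Rightarrow> complex"
  assumes "integrable lborel \<phi>" "integrable lborel \<psi>"
  shows "integrable (lborel \<Otimes>\<^sub>M lborel) (\<lambda>z. \<phi> (fst z) * \<psi> (snd z))"
proof -
  have [measurable]: "\<phi> \<in> borel_measurable borel" "\<psi> \<in> borel_measurable borel"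
    using assms by auto
  show ?thesis
    by (rule lborel_pair.Fubini_integrable) (use assms in \<open>auto simp: norm_mult\<close>)
qed

text \<open>The integral of \<open>\<phi>(r) \<psi>(s)\<close> over the half-plane
  \<open>s > r + \<epsilon>\<close>, a quantity from which the order \<gamma> has
  disappeared.\<close>

definition upper_pairing :: "(real \<Rightarrow> complex) \<Rightarrow> (real \<Rightarrow> complex) \<Rightarrow> real \<Rightarrow> complex" where
  "upper_pairing \<phi> \<psi> \<epsilon> = (\<integral>r. \<phi> r * (\<integral>s. \<psi> s * indicator {r + \<epsilon><..} s \<partial>lborel) \<partial>lborel)"

text \<open>With \<open>H\<close> and \<open>P\<close> written as integrals over \<open>r\<close>
  and \<open>s\<close>, integrating over \<open>t\<close> first leaves the convolution of the two
  kernels, the indicator of \<open>s > r + \<epsilon>\<close>. As the kernels are nonnegative, the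
  same computation with absolute values gives integrability on the product space.\<close>

lemma rl_Fubini:
  fixes \<phi> \<psi> :: "real \<Rightarrow> complex"
  assumes \<phi>: "integrable lborel \<phi>" and \<psi>: "integrable lborel \<psi>" and \<gamma>: "0 < \<gamma>" "\<gamma> < 1"
  defines "H \<equiv> \<lambda>t. \<integral>r. \<phi> r * of_real (rl_kernel \<gamma> (t - r)) \<partial>lborel"
    and "P \<equiv> \<lambda>t. \<integral>s. \<psi> s * of_real (rl_kernel (1 - \<gamma>) (s - t)) \<partial>lborel"
  shows "integrable lborel (\<lambda>t. H t * P (t + \<epsilon>))"
    and "(\<integral>t. H t * P (t + \<epsilon>) \<partial>lborel) = upper_pairing \<phi> \<psi> \<epsilon>"
proof -
  let ?L = "lborel :: real measure"
  have sf: "sigma_finite_measure (?L \<Otimes>\<^sub>M ?L)"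
    by (intro sigma_finite_pair_measure) (auto intro: lborel.sigma_finite_measure_axioms)
  interpret LLL: pair_sigma_finite "?L \<Otimes>\<^sub>M ?L" ?L
    by (intro pair_sigma_finite.intro sf lborel.sigma_finite_measure_axioms)
  have [measurable]: "\<phi> \<in> borel_measurable borel" "\<psi> \<in> borel_measurable borel"
    using \<phi> \<psi> by auto
  \<comment> \<open>The translation by \<epsilon> in \<open>P\<close> is moved onto
    \<open>s\<close>, which is where the threshold \<open>r + \<epsilon>\<close> comes from.\<close>
  define k where "k z t = rl_kernel \<gamma> (t - fst z) * rl_kernel (1 - \<gamma>) (snd z - \<epsilon> - t)" for z t
  have k0: "k z t \<ge> 0" for z t using \<gamma> by (simp add: k_def rl_kernel_nonneg)
  have [measurable]: "(\<lambda>(z, t). k z t) \<in> borel_measurable ((?L \<Otimes>\<^sub>M ?L) \<Otimes>\<^sub>M ?L)"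
    unfolding k_def by measurable
  have nnk: "(\<integral>\<^sup>+t. ennreal (k z t) \<partial>lborel) = indicator {fst z + \<epsilon><..} (snd z)" for z
    using rl_kernel_convolution[OF \<gamma>, of "fst z" "snd z - \<epsilon>"]
    by (auto simp: k_def indicator_def)
  have ik: "integrable lborel (k z)" for z
    using nnk[of z] k0 unfolding k_def
    by (intro integrableI_nonneg) (auto simp: indicator_def)
  have Ik: "(\<integral>t. k z t \<partial>lborel) = indicator {fst z + \<epsilon><..} (snd z)" for z
    using nnk[of z] k0 ik[of z]
    by (subst integral_eq_nn_integral) (auto simp: indicator_def)
  define F where "F z t = \<phi> (fst z) * \<psi> (snd z) * of_real (k z t)" for z t
  have [measurable]: "(\<lambda>(z, t). F z t) \<in> borel_measurable ((?L \<Otimes>\<^sub>M ?L) \<Otimes>\<^sub>M ?L)"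
    unfolding F_def by measurable
  have iF: "integrable lborel (F z)" for z
    unfolding F_def using ik[of z] by auto
  have IF: "(\<integral>t. F z t \<partial>lborel) = \<phi> (fst z) * \<psi> (snd z) * indicator {fst z + \<epsilon><..} (snd z)" for z
    unfolding F_def using Ik[of z] by (auto simp: indicator_def)
  have nF: "(\<integral>t. norm (F z t) \<partial>lborel) = norm (\<phi> (fst z) * \<psi> (snd z)) * indicator {fst z + \<epsilon><..} (snd z)" for z
    unfolding F_def using Ik[of z] k0 by (auto simp: norm_mult indicator_def)
  have im: "integrable (?L \<Otimes>\<^sub>M ?L) (\<lambda>z. \<phi> (fst z) * \<psi> (snd z) * indicator {fst z + \<epsilon><..} (snd z))"
    by (rule bochner_bound[OF lborel_pair_integrable_mult[OF \<phi> \<psi>]])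
       (auto simp: indicator_def)
  have int: "integrable ((?L \<Otimes>\<^sub>M ?L) \<Otimes>\<^sub>M ?L) (case_prod F)"
  proof (rule LLL.Fubini_integrable)
    have "integrable (?L \<Otimes>\<^sub>M ?L) (\<lambda>z. norm (\<phi> (fst z) * \<psi> (snd z) * indicator {fst z + \<epsilon><..} (snd z)))"
      using im by (rule integrable_norm)
    then show "integrable (?L \<Otimes>\<^sub>M ?L) (\<lambda>z. \<integral>t. norm (case_prod F (z, t)) \<partial>lborel)"
      by (simp add: nF norm_mult indicator_def of_bool_def if_distrib cong: if_cong)
  qed (use iF in auto)
  \<comment> \<open>The section at a fixed \<open>t\<close> separates into a product; its
    integrability is available for almost every \<open>t\<close>.\<close>
  have inner: "(\<integral>z. F z t \<partial>(?L \<Otimes>\<^sub>M ?L)) = H t * P (t + \<epsilon>)"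
    if "integrable (?L \<Otimes>\<^sub>M ?L) (\<lambda>z. F z t)" for t
  proof -
    have "(\<integral>z. F z t \<partial>(?L \<Otimes>\<^sub>M ?L)) = (\<integral>r. (\<integral>s. F (r, s) t \<partial>lborel) \<partial>lborel)"
      using lborel_pair.integral_fst'[OF that] by simp
    also have "\<dots> = (\<integral>r. (\<phi> r * of_real (rl_kernel \<gamma> (t - r))) * P (t + \<epsilon>) \<partial>lborel)"
    proof (intro bochner_cong refl)
      fix r
      have "F (r, s) t = (\<phi> r * of_real (rl_kernel \<gamma> (t - r))) * (\<psi> s * of_real (rl_kernel (1 - \<gamma>) (s - (t + \<epsilon>))))" for s
        by (simp add: F_def k_def algebra_simps)
      then show "(\<integral>s. F (r, s) t \<partial>lborel) = (\<phi> r * of_real (rl_kernel \<gamma> (t - r))) * P (t + \<epsilon>)"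
        by (simp add: P_def)
    qed
    also have "\<dots> = H t * P (t + \<epsilon>)"
      unfolding H_def by (rule integral_mult_left_zero)
    finally show ?thesis .
  qed
  have [measurable]: "H \<in> borel_measurable borel" "P \<in> borel_measurable borel"
    unfolding H_def P_def by measurable
  have ae: "AE t in lborel. (\<integral>z. F z t \<partial>(?L \<Otimes>\<^sub>M ?L)) = H t * P (t + \<epsilon>)"
    using LLL.AE_integrable_snd[OF int] by eventually_elim (rule inner)
  have [measurable]: "(\<lambda>t. \<integral>z. F z t \<partial>(?L \<Otimes>\<^sub>M ?L)) \<in> borel_measurable lborel"
    using LLL.integrable_snd[OF int] by (rule borel_measurable_integrable)
  show "integrable lborel (\<lambda>t. H t * P (t + \<epsilon>))"
    using LLL.integrable_snd[OF int] by (rule integrable_cong_AE_imp) (use ae in auto)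
  have "(\<integral>t. H t * P (t + \<epsilon>) \<partial>lborel) = (\<integral>t. (\<integral>z. F z t \<partial>(?L \<Otimes>\<^sub>M ?L)) \<partial>lborel)"
    using ae by (intro integral_cong_AE) auto
  also have "\<dots> = (\<integral>z. (\<integral>t. F z t \<partial>lborel) \<partial>(?L \<Otimes>\<^sub>M ?L))"
    by (rule LLL.Fubini_integral[OF int])
  also have "\<dots> = (\<integral>r. (\<integral>s. \<phi> r * (\<psi> s * indicator {r + \<epsilon><..} s) \<partial>lborel) \<partial>lborel)"
    using lborel_pair.integral_fst'[OF im] by (simp add: IF mult.assoc)
  finally show "(\<integral>t. H t * P (t + \<epsilon>) \<partial>lborel) = upper_pairing \<phi> \<psi> \<epsilon>"
    by (simp add: upper_pairing_def)
qed

lemma tail_integral_bounded: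
  fixes \<psi> :: "real \<Rightarrow> complex"
  assumes \<psi>: "integrable lborel \<psi>" and [measurable]: "A \<in> sets borel"
  shows "norm (\<integral>s. \<psi> s * indicator A s \<partial>lborel) \<le> (\<integral>s. norm (\<psi> s) \<partial>lborel)"
    and "integrable lborel (\<lambda>s. \<psi> s * indicator A s)"
proof -
  have [measurable]: "\<psi> \<in> borel_measurable borel" using \<psi> by auto
  show i: "integrable lborel (\<lambda>s. \<psi> s * indicator A s)"
    by (rule bochner_bound[OF \<psi>]) (auto simp: indicator_def)
  show "norm (\<integral>s. \<psi> s * indicator A s \<partial>lborel) \<le> (\<integral>s. norm (\<psi> s) \<partial>lborel)"
    by (intro Bochner_Integration.integral_norm_bound_integral i)
       (use \<psi> in \<open>auto simp: indicator_def\<close>)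
qed

text \<open>The end point \<open>\<gamma> = 0\<close>: the left kernel degenerates to the identity
  and the right one to the indicator of a half-line. The pairing identity then holds by definition,
  and integrability follows from the boundedness of \<open>P\<close>.\<close>

lemma rl_Fubini_0:
  fixes \<phi> \<psi> :: "real \<Rightarrow> complex"
  assumes \<phi>: "integrable lborel \<phi>" and \<psi>: "integrable lborel \<psi>"
  defines "P \<equiv> \<lambda>t. \<integral>s. \<psi> s * indicator {t<..} s \<partial>lborel"
  shows "integrable lborel (\<lambda>t. \<phi> t * P (t + \<epsilon>))"
proof -
  have [measurable]: "\<phi> \<in> borel_measurable borel" "\<psi> \<in> borel_measurable borel"
    using \<phi> \<psi> by auto
  have P: "P = (\<lambda>t. \<integral>s. \<psi> s * (if t < s then 1 else 0) \<partial>lborel)"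
    unfolding P_def by (intro ext bochner_cong) (auto simp: indicator_def)
  have [measurable]: "P \<in> borel_measurable borel"
    unfolding P by measurable
  show ?thesis
  proof (rule bochner_bound)
    show "integrable lborel (\<lambda>t. (\<integral>s. norm (\<psi> s) \<partial>lborel) *\<^sub>R \<phi> t)" using \<phi> by auto
    show "AE t in lborel. norm (\<phi> t * P (t + \<epsilon>)) \<le> norm ((\<integral>s. norm (\<psi> s) \<partial>lborel) *\<^sub>R \<phi> t)"
      using tail_integral_bounded(1)[OF \<psi>] unfolding P_def
      by (intro AE_I2) (auto simp: norm_mult mult.commute[of "norm (\<phi> _)"] intro!: mult_right_mono)
  qed measurable
qed

text \<open>The end point \<open>\<gamma> = 1\<close> with the roles exchanged: \<open>H\<close> is
  a primitive of \<phi> and the right kernel is the identity. Interchanging the integrations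
  recovers the pairing.\<close>

lemma rl_Fubini_1:
  fixes \<phi> \<psi> :: "real \<Rightarrow> complex"
  assumes \<phi>: "integrable lborel \<phi>" and \<psi>: "integrable lborel \<psi>"
  defines "H \<equiv> \<lambda>t. \<integral>r. \<phi> r * indicator {r<..} t \<partial>lborel"
  shows "integrable lborel (\<lambda>t. H t * \<psi> (t + \<epsilon>))"
    and "(\<integral>t. H t * \<psi> (t + \<epsilon>) \<partial>lborel) = upper_pairing \<phi> \<psi> \<epsilon>"
proof -
  let ?L = "lborel :: real measure"
  have [measurable]: "\<phi> \<in> borel_measurable borel" "\<psi> \<in> borel_measurable borel"
    using \<phi> \<psi> by auto
  have i\<psi>: "integrable lborel (\<lambda>t. \<psi> (t + \<epsilon>))" using \<psi> by (simp add: lborel_translate)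
  have im: "integrable (?L \<Otimes>\<^sub>M ?L) (\<lambda>(r, t). \<phi> r * \<psi> (t + \<epsilon>) * indicator {r<..} t)"
    by (rule bochner_bound[OF lborel_pair_integrable_mult[OF \<phi> i\<psi>]])
       (auto simp: indicator_def)
  have eq: "(\<integral>r. \<phi> r * \<psi> (t + \<epsilon>) * indicator {r<..} t \<partial>lborel) = H t * \<psi> (t + \<epsilon>)" for t
    unfolding H_def integral_mult_left_zero[symmetric]
    by (intro bochner_cong) auto
  show "integrable lborel (\<lambda>t. H t * \<psi> (t + \<epsilon>))"
    using lborel_pair.integrable_snd[OF im] by (simp add: eq)
  have "(\<integral>t. H t * \<psi> (t + \<epsilon>) \<partial>lborel) = (\<integral>r. (\<integral>t. \<phi> r * \<psi> (t + \<epsilon>) * indicator {r<..} t \<partial>lborel) \<partial>lborel)"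
    using lborel_pair.Fubini_integral[OF im] by (simp add: eq)
  also have "\<dots> = upper_pairing \<phi> \<psi> \<epsilon>"
    unfolding upper_pairing_def
  proof (intro bochner_cong refl)
    fix r
    have "(\<integral>t. \<phi> r * \<psi> (t + \<epsilon>) * indicator {r<..} t \<partial>lborel)
      = \<phi> r * (\<integral>t. \<psi> (t + \<epsilon>) * indicator {r + \<epsilon><..} (t + \<epsilon>) \<partial>lborel)"
      unfolding integral_mult_right_zero[symmetric]
      by (intro bochner_cong) (auto simp: indicator_def)
    then show "(\<integral>t. \<phi> r * \<psi> (t + \<epsilon>) * indicator {r<..} t \<partial>lborel) = \<phi> r * (\<integral>s. \<psi> s * indicator {r + \<epsilon><..} s \<partial>lborel)"
      using lborel_translate(2)[of "\<lambda>s. \<psi> s * indicator {r + \<epsilon><..} s" \<epsilon>] by simp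
  qed
  finally show "(\<integral>t. H t * \<psi> (t + \<epsilon>) \<partial>lborel) = upper_pairing \<phi> \<psi> \<epsilon>" .
qed

text \<open>The two half-planes differ by the strip \<open>r < s \<le> r + \<epsilon>\<close>. In
  the coordinate \<open>v = s - r\<close> its section at a fixed \<open>v\<close> contributes the
  correlation at \<open>v\<close>.\<close>

lemma correlation_average:
  fixes \<phi> \<psi> :: "real \<Rightarrow> complex"
  assumes \<phi>: "integrable lborel \<phi>" and \<psi>: "integrable lborel \<psi>" and "0 \<le> \<epsilon>"
  shows "upper_pairing \<phi> \<psi> 0
      - upper_pairing \<phi> \<psi> \<epsilon>
    = (\<integral>v. correlation \<phi> \<psi> v * indicator {0<..\<epsilon>} v \<partial>lborel)"
    and "integrable lborel (\<lambda>v. correlation \<phi> \<psi> v * indicator {0<..\<epsilon>} v)"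
proof -
  let ?L = "lborel :: real measure"
  have [measurable]: "\<phi> \<in> borel_measurable borel" "\<psi> \<in> borel_measurable borel"
    using \<phi> \<psi> by auto
  have i\<psi>: "integrable lborel (\<lambda>v. \<psi> (r + v))" for r
    using \<psi> lborel_translate(1)[of \<psi> r] by (simp add: add.commute)
  have im0: "integrable (?L \<Otimes>\<^sub>M ?L) (\<lambda>(r, v). \<phi> r * \<psi> (r + v))"
  proof (rule lborel_pair.Fubini_integrable)
    have "(\<integral>v. norm (\<psi> (r + v)) \<partial>lborel) = (\<integral>v. norm (\<psi> v) \<partial>lborel)" for r
      using lborel_translate(2)[of "\<lambda>v. norm (\<psi> v)" r] by (simp add: add.commute)
    then show "integrable ?L (\<lambda>r. \<integral>v. norm (case (r, v) of (r, v) \<Rightarrow> \<phi> r * \<psi> (r + v)) \<partial>lborel)"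
      using \<phi> by (simp add: norm_mult)
  qed (use i\<psi> in auto)
  have im: "integrable (?L \<Otimes>\<^sub>M ?L) (\<lambda>(r, v). \<phi> r * \<psi> (r + v) * indicator {0<..\<epsilon>} v)"
    by (rule bochner_bound[OF im0]) (auto simp: indicator_def)
  have eq: "(\<integral>r. \<phi> r * \<psi> (r + v) * indicator {0<..\<epsilon>} v \<partial>lborel) = correlation \<phi> \<psi> v * indicator {0<..\<epsilon>} v" for v
    unfolding correlation_def by simp
  show "integrable lborel (\<lambda>v. correlation \<phi> \<psi> v * indicator {0<..\<epsilon>} v)"
    using lborel_pair.integrable_snd[OF im] by (simp only: eq)
  have "(\<integral>v. correlation \<phi> \<psi> v * indicator {0<..\<epsilon>} v \<partial>lborel)
    = (\<integral>r. (\<integral>v. \<phi> r * \<psi> (r + v) * indicator {0<..\<epsilon>} v \<partial>lborel) \<partial>lborel)"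
    using lborel_pair.Fubini_integral[OF im] by (simp only: eq)
  also have "\<dots> = (\<integral>r. \<phi> r * (\<integral>s. \<psi> s * indicator {r<..} s \<partial>lborel) - \<phi> r * (\<integral>s. \<psi> s * indicator {r + \<epsilon><..} s \<partial>lborel) \<partial>lborel)"
  proof (intro bochner_cong refl)
    fix r
    have "(\<integral>v. \<phi> r * \<psi> (r + v) * indicator {0<..\<epsilon>} v \<partial>lborel)
      = \<phi> r * (\<integral>v. \<psi> (v + r) * indicator {r<..r + \<epsilon>} (v + r) \<partial>lborel)"
      unfolding integral_mult_right_zero[symmetric]
      by (intro bochner_cong) (auto simp: indicator_def add.commute)
    also have "(\<integral>v. \<psi> (v + r) * indicator {r<..r + \<epsilon>} (v + r) \<partial>lborel) = (\<integral>s. \<psi> s * indicator {r<..r + \<epsilon>} s \<partial>lborel)"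
      by (rule lborel_translate(2))
    also have "\<dots> = (\<integral>s. \<psi> s * indicator {r<..} s - \<psi> s * indicator {r + \<epsilon><..} s \<partial>lborel)"
      using \<open>0 \<le> \<epsilon>\<close> by (intro bochner_cong) (auto simp: indicator_def)
    also have "\<dots> = (\<integral>s. \<psi> s * indicator {r<..} s \<partial>lborel) - (\<integral>s. \<psi> s * indicator {r + \<epsilon><..} s \<partial>lborel)"
      by (intro Bochner_Integration.integral_diff tail_integral_bounded \<psi>) auto
    finally show "(\<integral>v. \<phi> r * \<psi> (r + v) * indicator {0<..\<epsilon>} v \<partial>lborel)
      = \<phi> r * (\<integral>s. \<psi> s * indicator {r<..} s \<partial>lborel) - \<phi> r * (\<integral>s. \<psi> s * indicator {r + \<epsilon><..} s \<partial>lborel)"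
      by (simp add: right_diff_distrib)
  qed
  also have "\<dots> = upper_pairing \<phi> \<psi> 0
      - upper_pairing \<phi> \<psi> \<epsilon>"
    using rl_Fubini_0[OF \<phi> \<psi>, of 0] rl_Fubini_0[OF \<phi> \<psi>, of \<epsilon>] unfolding upper_pairing_def
    by (subst Bochner_Integration.integral_diff[symmetric]) auto
  finally show "upper_pairing \<phi> \<psi> 0
      - upper_pairing \<phi> \<psi> \<epsilon>
    = (\<integral>v. correlation \<phi> \<psi> v * indicator {0<..\<epsilon>} v \<partial>lborel)" by simp
qed

lemma average_tendsto:
  fixes c :: "real \<Rightarrow> complex"
  assumes int: "\<And>\<epsilon>. 0 < \<epsilon> \<Longrightarrow> integrable lborel (\<lambda>v. c v * indicator {0<..\<epsilon>} v)"
    and lim: "(c \<longlongrightarrow> l) (at_right 0)"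
  shows "((\<lambda>\<epsilon>. (\<integral>v. c v * indicator {0<..\<epsilon>} v \<partial>lborel) / of_real \<epsilon>) \<longlongrightarrow> l) (at_right 0)"
proof (rule tendstoI)
  let ?I = "\<lambda>\<epsilon>. \<integral>v. c v * indicator {0<..\<epsilon>} v \<partial>lborel"
  fix e :: real assume "e > 0"
  then obtain b where b: "b > 0" "\<And>v. 0 < v \<Longrightarrow> v < b \<Longrightarrow> dist (c v) l < e / 2"
    using tendstoD[OF lim, of "e/2"] unfolding eventually_at_right_field by auto
  show "\<forall>\<^sub>F \<epsilon> in at_right 0. dist (?I \<epsilon> / of_real \<epsilon>) l < e"
    unfolding eventually_at_right_field
  proof (intro exI[of _ b] conjI allI impI b(1))
    fix \<epsilon> assume \<epsilon>: "0 < \<epsilon>" "\<epsilon> < b"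
    have ii: "integrable lborel (indicator {0<..\<epsilon>} :: real \<Rightarrow> complex)"
      "integrable lborel (indicator {0<..\<epsilon>} :: real \<Rightarrow> real)"
      using \<epsilon> integrable_of_real[of lborel "indicator {0<..\<epsilon>}", where ?'a = complex]
      by (auto simp: emeasure_lborel_Ioc of_real_indicator)
    have mi: "(\<integral>v. indicator {0<..\<epsilon>} v \<partial>lborel) = \<epsilon>"
      using \<epsilon> by (simp add: measure_def)
    have "(\<integral>v. l * indicator {0<..\<epsilon>} v \<partial>lborel) = (\<integral>v. indicator {0<..\<epsilon>} v *\<^sub>R l \<partial>lborel)"
      by (intro bochner_cong) (auto simp: indicator_def)
    also have "\<dots> = (\<integral>v. indicator {0<..\<epsilon>} v \<partial>lborel) *\<^sub>R l"
      by (rule integral_scaleR_left) (rule ii(2))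
    finally have mi': "(\<integral>v. l * indicator {0<..\<epsilon>} v \<partial>lborel) = l * of_real \<epsilon>"
      by (simp only: mi scaleR_conv_of_real mult.commute)
    have "norm (?I \<epsilon> - l * of_real \<epsilon>)
      = norm (\<integral>v. c v * indicator {0<..\<epsilon>} v - l * indicator {0<..\<epsilon>} v \<partial>lborel)"
      using int[OF \<epsilon>(1)] integrable_mult_right[OF ii(1), of l]
      by (subst Bochner_Integration.integral_diff) (auto simp only: mi')
    also have "\<dots> \<le> (\<integral>v. e / 2 * indicator {0<..\<epsilon>} v \<partial>lborel)"
    proof (rule Bochner_Integration.integral_norm_bound_integral)
      show "norm (c v * indicator {0<..\<epsilon>} v - l * indicator {0<..\<epsilon>} v) \<le> e / 2 * indicator {0<..\<epsilon>} v" for v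
        using b(2)[of v] \<epsilon> by (auto simp: indicator_def dist_norm)
    qed (use int[OF \<epsilon>(1)] ii in auto)
    also have "\<dots> = e / 2 * \<epsilon>" using mi by simp
    finally have "norm (?I \<epsilon> - l * of_real \<epsilon>) \<le> e / 2 * \<epsilon>" .
    moreover have "?I \<epsilon> / of_real \<epsilon> - l
       = (?I \<epsilon> - l * of_real \<epsilon>) / of_real \<epsilon>"
      using \<epsilon> by (simp add: diff_divide_distrib)
    ultimately have "dist (?I \<epsilon> / of_real \<epsilon>) l \<le> e / 2"
      using \<epsilon> by (simp add: dist_norm norm_divide divide_le_eq)
    then show "dist (?I \<epsilon> / of_real \<epsilon>) l < e"
      using \<open>e > 0\<close> by linarith
  qed
qed

section \<open>Borel representatives and fractional integrals as convolutions\<close>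

text \<open>Elements of \<open>L_p\<close> are Lebesgue measurable functions on
  \<open>(a,b)\<close>, whereas translations and product measures are handled on
  \<open>lborel\<close>. The representative is Borel, extended by zero, and for
  \<open>p = \<infinity>\<close> bounded everywhere rather than almost everywhere.\<close>

lemma lp_fun_borel_representative:
  fixes \<phi> :: "real \<Rightarrow> complex"
  assumes lp: "lp_fun p a b \<phi>" and p: "1 \<le> p" and "a < b"
  obtains \<phi>' where "\<phi>' \<in> borel_measurable borel" "\<And>x. x \<notin> {a<..<b} \<Longrightarrow> \<phi>' x = 0"
    "AE x in lborel. x \<in> {a<..<b} \<longrightarrow> \<phi>' x = \<phi> x" "integrable lborel \<phi>'"
    "if p = \<infinity> then \<exists>K. \<forall>x. norm (\<phi>' x) \<le> K else integrable lborel (\<lambda>x. norm (\<phi>' x) powr enn2real p)"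
    "(\<lambda>x. indicator {a<..<b} x *\<^sub>R \<phi> x) \<in> borel_measurable lebesgue"
proof -
  let ?S = "{a<..<b}"
  define z where "z = (\<lambda>x. indicator ?S x *\<^sub>R \<phi> x)"
  have zm: "z \<in> borel_measurable lebesgue"
    using lp unfolding lp_fun_def z_def by (simp add: borel_measurable_restrict_space_iff)
  have "(\<lambda>x. Re (z x)) \<in> borel_measurable (completion lborel)" "(\<lambda>x. Im (z x)) \<in> borel_measurable (completion lborel)"
    using zm by (auto intro: measurable_compose borel_measurable_Re borel_measurable_Im)
  then obtain fr fi where fr: "fr \<in> borel_measurable borel" "AE x in lborel. Re (z x) = fr x"
    and fi: "fi \<in> borel_measurable borel" "AE x in lborel. Im (z x) = fi x"
    by (metis completion_ex_borel_measurable_real measurable_lborel2)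
  obtain C0 where C0: "p = \<infinity> \<Longrightarrow> AE t in lebesgue_on ?S. norm (\<phi> t) \<le> C0"
    using lp unfolding lp_fun_def by (auto split: if_splits)
  define g where "g x = of_real (fr x) + \<i> * of_real (fi x)" for x
  have [measurable]: "g \<in> borel_measurable borel"
    unfolding g_def using fr(1) fi(1) by measurable
  have gz: "AE x in lborel. g x = z x"
    using fr(2) fi(2) by eventually_elim (simp add: g_def complex_eq_iff)
  \<comment> \<open>For \<open>p = \<infinity>\<close> values above the essential bound are replaced
    by 0, which affects a null set only.\<close>
  define \<phi>' where "\<phi>' x = (if x \<in> ?S \<and> (p = \<infinity> \<longrightarrow> norm (g x) \<le> C0) then g x else 0)" for x
  have m[measurable]: "\<phi>' \<in> borel_measurable borel"
    unfolding \<phi>'_def by measurable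
  have out: "\<phi>' x = 0" if "x \<notin> ?S" for x using that by (auto simp: \<phi>'_def)
  have ae: "AE x in lborel. x \<in> ?S \<longrightarrow> \<phi>' x = \<phi> x"
  proof -
    have "AE x in lborel. x \<in> ?S \<longrightarrow> (p = \<infinity> \<longrightarrow> norm (\<phi> x) \<le> C0)"
    proof (cases "p = \<infinity>")
      case True
      have "AE x in lebesgue. x \<in> ?S \<longrightarrow> norm (\<phi> x) \<le> C0"
        using C0[OF True] by (subst (asm) AE_restrict_space_iff) auto
      then show ?thesis by (simp add: AE_completion_iff True)
    qed auto
    with gz show ?thesis
      by eventually_elim (auto simp: \<phi>'_def z_def)
  qed
  have iS: "integrable lborel (indicator ?S :: real \<Rightarrow> real)"
    using \<open>a < b\<close> by (intro integrable_real_indicator) auto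
  have bd: "if p = \<infinity> then \<exists>K. \<forall>x. norm (\<phi>' x) \<le> K else integrable lborel (\<lambda>x. norm (\<phi>' x) powr enn2real p)"
  proof (cases "p = \<infinity>")
    case True
    then have "norm (\<phi>' x) \<le> \<bar>C0\<bar>" for x by (auto simp: \<phi>'_def)
    then show ?thesis using True by auto
  next
    case False
    have "integrable lebesgue (\<lambda>x. norm (\<phi>' x) powr enn2real p)"
    proof (rule integrable_cong_AE_imp)
      show "integrable lebesgue (\<lambda>x. indicator ?S x *\<^sub>R (norm (\<phi> x) powr enn2real p))"
        using lp False unfolding lp_fun_def by (simp add: integrable_restrict_space)
      show "AE x in lebesgue. indicator ?S x *\<^sub>R (norm (\<phi> x) powr enn2real p) = norm (\<phi>' x) powr enn2real p"
        using AE_completion[OF ae] by eventually_elim (use out in \<open>auto simp: indicator_def\<close>)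
      show "(\<lambda>x. norm (\<phi>' x) powr enn2real p) \<in> borel_measurable lebesgue"
        by (rule measurable_completion) measurable
    qed
    then show ?thesis using False by (simp add: integrable_completion)
  qed
  have int: "integrable lborel \<phi>'"
  proof (cases "p = \<infinity>")
    case True
    then obtain K where K: "\<And>x. norm (\<phi>' x) \<le> K" using bd by auto
    show ?thesis
    proof (rule bochner_bound)
      show "integrable lborel (\<lambda>x. K * indicator ?S x)" by (rule integrable_mult_right[OF iS])
      show "AE x in lborel. norm (\<phi>' x) \<le> norm (K * indicator ?S x)"
        using K out by (intro AE_I2) (auto simp: indicator_def intro: order_trans[OF _ abs_ge_self])
    qed measurable
  next
    case False
    have p1: "1 \<le> enn2real p"
      using p False by (metis enn2real_1 enn2real_mono ennreal_one_less_top infinity_ennreal_def less_top)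
    show ?thesis
    proof (rule bochner_bound)
      show "integrable lborel (\<lambda>x. indicator ?S x + norm (\<phi>' x) powr enn2real p)"
        using iS bd False by auto
      \<comment> \<open>On a bounded interval this elementary bound embeds \<open>L_p\<close> into
        \<open>L_1\<close>.\<close>
      have "y \<le> 1 + y powr enn2real p" if "0 \<le> y" for y :: real
      proof (cases "y \<le> 1")
        case False
        then have "y powr 1 \<le> y powr enn2real p" using p1 by (intro powr_mono) auto
        then show ?thesis using False by simp
      qed (auto intro: add_increasing2)
      then show "AE x in lborel. norm (\<phi>' x) \<le> norm (indicator ?S x + norm (\<phi>' x) powr enn2real p)"
        using out by (intro AE_I2) (auto simp: indicator_def intro: order_trans[OF _ abs_ge_self])
    qed measurable
  qed
  show ?thesis
    using that[OF m out ae int bd] zm unfolding z_def by blast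
qed

lemma set_lebesgue_integral_representative:
  fixes \<phi> \<phi>' :: "real \<Rightarrow> complex" and k :: "real \<Rightarrow> real"
  assumes [measurable]: "\<phi>' \<in> borel_measurable borel" "k \<in> borel_measurable borel" "A \<in> sets borel"
    and ae: "AE x in lborel. x \<in> S \<longrightarrow> \<phi>' x = \<phi> x"
    and z: "(\<lambda>x. indicator S x *\<^sub>R \<phi> x) \<in> borel_measurable lebesgue" and AS: "A \<subseteq> S"
  shows "(LINT s:A|lebesgue. \<phi> s / of_real (k s)) = (\<integral>s. \<phi>' s * of_real (indicator A s / k s) \<partial>lborel)"
proof -
  have m: "(\<lambda>s. complex_of_real (indicator A s / k s)) \<in> borel_measurable lebesgue"
    by (rule measurable_completion) measurable
  have "(LINT s:A|lebesgue. \<phi> s / of_real (k s))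
    = (\<integral>s. (indicator S s *\<^sub>R \<phi> s) * of_real (indicator A s / k s) \<partial>lebesgue)"
    unfolding set_lebesgue_integral_def
    using AS by (intro bochner_cong refl) (auto simp: indicator_def)
  also have "\<dots> = (\<integral>s. \<phi>' s * of_real (indicator A s / k s) \<partial>lebesgue)"
  proof (rule integral_cong_AE)
    show "(\<lambda>s. (indicator S s *\<^sub>R \<phi> s) * of_real (indicator A s / k s)) \<in> borel_measurable lebesgue"
      by (rule borel_measurable_times[OF z m])
    show "(\<lambda>s. \<phi>' s * of_real (indicator A s / k s)) \<in> borel_measurable lebesgue"
      by (rule measurable_completion) measurable
    show "AE s in lebesgue. (indicator S s *\<^sub>R \<phi> s) * of_real (indicator A s / k s) = \<phi>' s * of_real (indicator A s / k s)"
      using AE_completion[OF ae] by eventually_elim (use AS in \<open>auto simp: indicator_def\<close>)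
  qed
  also have "\<dots> = (\<integral>s. \<phi>' s * of_real (indicator A s / k s) \<partial>lborel)"
    by (rule integral_completion) measurable
  finally show ?thesis .
qed

text \<open>Because \<open>\<phi>'\<close> vanishes outside \<open>(a,b)\<close> and the kernel on a
  half-line, the limits of integration disappear. The power of -1 stays in front, so that the
  convolutions themselves carry no phase.\<close>

lemma
  fixes \<phi> \<phi>' :: "real \<Rightarrow> complex"
  assumes \<gamma>: "0 < \<gamma>" and [measurable]: "\<phi>' \<in> borel_measurable borel"
    and out: "\<And>x. x \<notin> {a<..<b} \<Longrightarrow> \<phi>' x = 0"
    and ae: "AE x in lborel. x \<in> {a<..<b} \<longrightarrow> \<phi>' x = \<phi> x"
    and z: "(\<lambda>x. indicator {a<..<b} x *\<^sub>R \<phi> x) \<in> borel_measurable lebesgue"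
    and t: "t \<in> {a<..<b}"
  shows frac_int_left_eq: "frac_int_left \<gamma> a \<phi> t = (\<integral>r. \<phi>' r * of_real (rl_kernel \<gamma> (t - r)) \<partial>lborel)"
    and frac_int_right_eq: "frac_int_right \<gamma> b \<phi> t
      = minus_one_pow (- \<gamma>) * (\<integral>s. \<phi>' s * of_real (rl_kernel \<gamma> (s - t)) \<partial>lborel)"
proof -
  have powr: "y powr (\<gamma> - 1) = 1 / y powr (1 - \<gamma>)" for y :: real
    using powr_minus_divide[of y "1 - \<gamma>"] by simp
  have "1 / of_real (Gamma \<gamma>) * (LINT s:{a<..<t}|lebesgue. \<phi> s / of_real ((t - s) powr (1 - \<gamma>)))
    = (\<integral>s. 1 / of_real (Gamma \<gamma>) * (\<phi>' s * of_real (indicator {a<..<t} s / (t - s) powr (1 - \<gamma>))) \<partial>lborel)"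
    unfolding integral_mult_right_zero using t by (subst set_lebesgue_integral_representative[OF _ _ _ ae z]) auto
  also have "\<dots> = (\<integral>r. \<phi>' r * of_real (rl_kernel \<gamma> (t - r)) \<partial>lborel)"
    using t out by (intro bochner_cong refl) (auto simp: rl_kernel_def indicator_def powr)
  finally show "frac_int_left \<gamma> a \<phi> t = (\<integral>r. \<phi>' r * of_real (rl_kernel \<gamma> (t - r)) \<partial>lborel)"
    using \<gamma> by (simp add: frac_int_left_def)
  have "1 / of_real (Gamma \<gamma>) * (LINT s:{t<..<b}|lebesgue. \<phi> s / of_real ((s - t) powr (1 - \<gamma>)))
    = (\<integral>s. 1 / of_real (Gamma \<gamma>) * (\<phi>' s * of_real (indicator {t<..<b} s / (s - t) powr (1 - \<gamma>))) \<partial>lborel)"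
    unfolding integral_mult_right_zero using t by (subst set_lebesgue_integral_representative[OF _ _ _ ae z]) auto
  also have "\<dots> = (\<integral>s. \<phi>' s * of_real (rl_kernel \<gamma> (s - t)) \<partial>lborel)"
    using t out by (intro bochner_cong refl) (auto simp: rl_kernel_def indicator_def powr)
  finally have right: "1 / of_real (Gamma \<gamma>) * (LINT s:{t<..<b}|lebesgue. \<phi> s / of_real ((s - t) powr (1 - \<gamma>)))
    = (\<integral>s. \<phi>' s * of_real (rl_kernel \<gamma> (s - t)) \<partial>lborel)" .
  show "frac_int_right \<gamma> b \<phi> t = minus_one_pow (- \<gamma>) * (\<integral>s. \<phi>' s * of_real (rl_kernel \<gamma> (s - t)) \<partial>lborel)"
    unfolding right[symmetric] using \<gamma> by (simp add: frac_int_right_def)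
qed

lemma AE_lebesgue_on_imp_lborel:
  assumes "AE x in lebesgue_on S. P x" "S \<in> sets lebesgue"
  shows "AE x in lborel. x \<in> S \<longrightarrow> P x"
  using assms by (simp add: AE_restrict_space_iff AE_completion_iff)

text \<open>\<open>p = 1\<close> forces \<open>q = \<infinity>\<close> and conversely, so outside
  the infinite cases both exponents are real and larger than 1.\<close>

lemma inverse_add_eq_1_cases:
  fixes p q :: ennreal
  assumes "1 \<le> p" "1 \<le> q" "inverse p + inverse q = 1"
  obtains "p = \<infinity>" | "q = \<infinity>"
    | "p \<noteq> \<infinity>" "q \<noteq> \<infinity>" "1 < enn2real p" "1 < enn2real q" "1 / enn2real p + 1 / enn2real q = 1"
proof (cases "p = \<infinity> \<or> q = \<infinity>")
  case False
  then obtain x y where x: "p = ennreal x" "0 \<le> x" and y: "q = ennreal y" "0 \<le> y"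
    by (metis ennreal_cases infinity_ennreal_def)
  have x1: "1 \<le> x" "1 \<le> y" using assms(1,2) x y by (auto simp: ennreal_ge_1)
  have "ennreal (inverse x) + ennreal (inverse y) = ennreal 1"
    using assms(3) x y x1 by (simp add: inverse_ennreal)
  then have e: "inverse x + inverse y = 1"
    using x1 by (simp add: ennreal_plus[symmetric] del: ennreal_plus)
  have "x \<noteq> 1" "y \<noteq> 1" using e x1 by auto
  then show ?thesis using that(3) False x y x1 e by (simp add: inverse_eq_divide)
qed (use that in blast)

lemma AE_lborel_translate:
  fixes c :: real
  assumes "AE x in lborel. P x"
  shows "AE x in lborel. P (x + c)"
proof -
  obtain N where N: "N \<in> null_sets lborel" "{x. \<not> P x} \<subseteq> N"
    using assms unfolding eventually_ae_filter by auto
  have "{x. x - (- c) \<in> N} \<in> null_sets lborel" by (rule null_sets_translation[OF N(1)])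
  moreover have "{x. \<not> P (x + c)} \<subseteq> {x. x - (- c) \<in> N}" using N(2) by auto
  ultimately show ?thesis unfolding eventually_ae_filter by auto
qed

section \<open>The generalised integral as a forward limit\<close>

text \<open>After subtraction of \<open>h a\<close> and \<open>g b\<close> both functions are
  convolutions almost everywhere on \<open>(a,b)\<close>: \<open>H\<close>, which vanishes left of
  \<open>a\<close>, and a phase times \<open>P\<close>, which vanishes right of \<open>b\<close>.
  The vanishing of \<open>P\<close> is exactly the freezing of \<open>g\<close> after
  \<open>b\<close>, so the quotient is an integral over the whole line and the pairing identities
  apply, whatever \<gamma> is.\<close>

lemma has_gls_integral_forward_aux:
  assumes ab: "a < b" and h: "continuous_on {a..b} h" and g: "continuous_on {a..b} g"
    and I: "has_gls_integral h g a b I"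
  shows "((\<lambda>\<epsilon>. integral {a..b} (\<lambda>t. (h t - h a) * (g (min b (t + \<epsilon>)) - g t)) / \<epsilon>)
           \<longlongrightarrow> I - h a * (g b - g a)) (at_right 0)"
proof -
  obtain \<gamma> p q ha ga gb \<phi> \<psi> where
    \<gamma>: "0 \<le> \<gamma>" "\<gamma> \<le> 1" and pq: "1 \<le> p" "1 \<le> q" "inverse p + inverse q = 1"
    and lims: "(h \<longlongrightarrow> ha) (at_right a)" "(g \<longlongrightarrow> ga) (at_right a)" "(g \<longlongrightarrow> gb) (at_left b)"
    and fl: "is_frac_deriv_left \<gamma> p a b (\<lambda>t. of_real (h t - ha)) \<phi>"
    and fr: "is_frac_deriv_right (1 - \<gamma>) q a b (\<lambda>t. of_real (g t - gb)) \<psi>"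
    and Ieq: "of_real I = minus_one_pow \<gamma> * (LINT t:{a<..<b}|lebesgue. \<phi> t * \<psi> t) + of_real (ha * (gb - ga))"
    using I ab unfolding has_gls_integral_def by auto
  have ha: "ha = h a" and ga: "ga = g a" and gb: "gb = g b"
    using tendsto_unique[OF _ lims(1) continuous_on_Icc_at_rightD[OF h ab]]
      tendsto_unique[OF _ lims(2) continuous_on_Icc_at_rightD[OF g ab]]
      tendsto_unique[OF _ lims(3) continuous_on_Icc_at_leftD[OF g ab]] by auto
  let ?S = "{a<..<b}"
  have "lp_fun p a b \<phi>" using fl by (simp add: is_frac_deriv_left_def)
  from lp_fun_borel_representative[OF this pq(1) ab]
  obtain F where Fm[measurable]: "F \<in> borel_measurable borel" and F0: "\<And>x. x \<notin> ?S \<Longrightarrow> F x = 0"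
    and Fae: "AE x in lborel. x \<in> ?S \<longrightarrow> F x = \<phi> x" and Fi: "integrable lborel F"
    and Fb: "if p = \<infinity> then \<exists>K. \<forall>x. norm (F x) \<le> K else integrable lborel (\<lambda>x. norm (F x) powr enn2real p)"
    and \<phi>m: "(\<lambda>x. indicator ?S x *\<^sub>R \<phi> x) \<in> borel_measurable lebesgue"
    by blast
  have "lp_fun q a b \<psi>" using fr by (simp add: is_frac_deriv_right_def)
  from lp_fun_borel_representative[OF this pq(2) ab]
  obtain W where Wm[measurable]: "W \<in> borel_measurable borel" and W0: "\<And>x. x \<notin> ?S \<Longrightarrow> W x = 0"
    and Wae: "AE x in lborel. x \<in> ?S \<longrightarrow> W x = \<psi> x" and Wi: "integrable lborel W"
    and Wb: "if q = \<infinity> then \<exists>K. \<forall>x. norm (W x) \<le> K else integrable lborel (\<lambda>x. norm (W x) powr enn2real q)"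
    and \<psi>m: "(\<lambda>x. indicator ?S x *\<^sub>R \<psi> x) \<in> borel_measurable lebesgue"
    by blast
  \<comment> \<open>At the orders 0 and 1 one of the two fractional integrals is the identity, which
    \<open>rl_kernel\<close> does not represent; hence the case distinctions.\<close>
  define H where "H t = (if \<gamma> = 0 then F t else \<integral>r. F r * of_real (rl_kernel \<gamma> (t - r)) \<partial>lborel)" for t
  define P where "P t = (if \<gamma> = 1 then W t else \<integral>s. W s * of_real (rl_kernel (1 - \<gamma>) (s - t)) \<partial>lborel)" for t
  define c where "c = minus_one_pow (- (1 - \<gamma>))"
  \<comment> \<open>\<open>c\<close> is the phase of the right-sided integral of order
    \<open>1 - \<gamma>\<close>. The minus sign arises because the pairing at \<epsilon> minus the
    one at 0 is minus the integrated correlation.\<close>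
  have cneg: "- c = minus_one_pow \<gamma>"
  proof -
    have "\<i> * of_real (pi * - (1 - \<gamma>)) = \<i> * of_real (pi * \<gamma>) - \<i> * of_real pi"
      by (simp add: algebra_simps)
    then show ?thesis unfolding c_def minus_one_pow_def by (simp add: exp_diff)
  qed
  have rl1: "complex_of_real (rl_kernel 1 (y - x)) = indicator {x<..} y" for x y
    by (auto simp: rl_kernel_def indicator_def)
  have kern: "integrable lborel (\<lambda>t. H t * P (t + \<epsilon>)) \<and>
      (\<integral>t. H t * P (t + \<epsilon>) \<partial>lborel) = upper_pairing F W \<epsilon>" for \<epsilon>
  proof -
    consider "\<gamma> = 0" | "\<gamma> = 1" | "0 < \<gamma>" "\<gamma> < 1" using \<gamma> by linarith
    then show ?thesis
    proof cases
      case 1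
      then show ?thesis using rl_Fubini_0[OF Fi Wi, of \<epsilon>] by (simp add: H_def P_def rl1 upper_pairing_def)
    next
      case 2
      then show ?thesis using rl_Fubini_1[OF Fi Wi, of \<epsilon>] by (simp add: H_def P_def rl1)
    next
      case 3
      then show ?thesis using rl_Fubini[OF Fi Wi 3, of \<epsilon>] by (simp add: H_def P_def)
    qed
  qed
  have H0: "H t = 0" if "t \<le> a" for t
  proof (cases "\<gamma> = 0")
    case False
    have "F r * of_real (rl_kernel \<gamma> (t - r)) = 0" for r
      using F0[of r] that by (cases "r \<le> a") (auto simp: rl_kernel_def)
    then show ?thesis using False unfolding H_def by (subst bochner_cong[where g = "\<lambda>_. 0"]) auto
  qed (use F0[of t] that in \<open>auto simp: H_def\<close>)
  have P0: "P t = 0" if "b \<le> t" for t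
  proof (cases "\<gamma> = 1")
    case False
    have "W s * of_real (rl_kernel (1 - \<gamma>) (s - t)) = 0" for s
      using W0[of s] that by (cases "b \<le> s") (auto simp: rl_kernel_def)
    then show ?thesis using False unfolding P_def by (subst bochner_cong[where g = "\<lambda>_. 0"]) auto
  qed (use W0[of t] that in \<open>auto simp: P_def\<close>)
  have hH: "AE t in lborel. t \<in> ?S \<longrightarrow> of_real (h t - h a) = H t"
  proof -
    have "AE t in lebesgue_on ?S. of_real (h t - h a) = frac_int_left \<gamma> a \<phi> t"
      using fl by (simp add: is_frac_deriv_left_def ha)
    then have ae: "AE t in lborel. t \<in> ?S \<longrightarrow> of_real (h t - h a) = frac_int_left \<gamma> a \<phi> t"
      by (rule AE_lebesgue_on_imp_lborel) simp
    have hf: "frac_int_left \<gamma> a \<phi> t = H t" if "t \<in> ?S" "F t = \<phi> t" for t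
      using frac_int_left_eq[OF _ Fm F0 Fae \<phi>m that(1), of \<gamma>] \<gamma> that(2)
      by (cases "\<gamma> = 0") (auto simp: H_def frac_int_left_def)
    from ae Fae show ?thesis by eventually_elim (use hf in auto)
  qed
  have gP: "AE t in lborel. t \<in> ?S \<longrightarrow> of_real (g t - g b) = c * P t"
  proof -
    have "AE t in lebesgue_on ?S. of_real (g t - g b) = frac_int_right (1 - \<gamma>) b \<psi> t"
      using fr by (simp add: is_frac_deriv_right_def gb)
    then have ae: "AE t in lborel. t \<in> ?S \<longrightarrow> of_real (g t - g b) = frac_int_right (1 - \<gamma>) b \<psi> t"
      by (rule AE_lebesgue_on_imp_lborel) simp
    have gf: "frac_int_right (1 - \<gamma>) b \<psi> t = c * P t" if "t \<in> ?S" "W t = \<psi> t" for t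
      using frac_int_right_eq[OF _ Wm W0 Wae \<psi>m that(1), of "1 - \<gamma>"] \<gamma> that(2)
      by (cases "\<gamma> = 1") (auto simp: P_def c_def frac_int_right_def minus_one_pow_def)
    from ae Wae show ?thesis by eventually_elim (use gf in auto)
  qed
  let ?I = "\<lambda>\<epsilon>. \<integral>v. correlation F W v * indicator {0<..\<epsilon>} v \<partial>lborel"
  have eq: "complex_of_real (integral {a..b} (\<lambda>t. (h t - h a) * (g (min b (t + \<epsilon>)) - g t)) / \<epsilon>)
    = - c * (?I \<epsilon> / of_real \<epsilon>)" if \<epsilon>: "0 < \<epsilon>" for \<epsilon>
  proof -
    define f where "f t = (h t - h a) * (g (min b (t + \<epsilon>)) - g t)" for t
    have "continuous_on {a..b} (\<lambda>t. g (min b (t + \<epsilon>)))"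
      by (rule continuous_on_compose2[OF g]) (use \<epsilon> in \<open>auto intro!: continuous_intros\<close>)
    then have fc: "continuous_on {a..b} f"
      unfolding f_def by (intro continuous_intros h g)
    have fi: "integrable lborel (\<lambda>t. indicator {a..b} t *\<^sub>R f t)"
      using borel_integrable_atLeastAtMost'[OF fc] by (simp add: set_integrable_def)
    have "complex_of_real (integral {a..b} f) = of_real (\<integral>t. indicator {a..b} t *\<^sub>R f t \<partial>lborel)"
      using set_borel_integral_eq_integral(2)[OF borel_integrable_atLeastAtMost'[OF fc]]
      by (simp add: set_lebesgue_integral_def)
    also have "\<dots> = (\<integral>t. of_real (indicator {a..b} t *\<^sub>R f t) \<partial>lborel)"
      by (rule integral_of_real[OF fi, symmetric])
    also have "\<dots> = (\<integral>t. c * (H t * P (t + \<epsilon>)) - c * (H t * P (t + 0)) \<partial>lborel)"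
    proof (rule integral_cong_AE)
      show "(\<lambda>t. complex_of_real (indicator {a..b} t *\<^sub>R f t)) \<in> borel_measurable lborel"
        using fi by measurable
      show "(\<lambda>t. c * (H t * P (t + \<epsilon>)) - c * (H t * P (t + 0))) \<in> borel_measurable lborel"
        using kern[of \<epsilon>] kern[of 0]
        by (intro borel_measurable_integrable Bochner_Integration.integrable_diff integrable_mult_right) auto
      \<comment> \<open>\<open>H\<close> and \<open>P\<close> are identified with \<open>h\<close>
        and \<open>g\<close> in the open interval, so the two end points are removed from the closed
        one.\<close>
      have "AE t in lborel. t \<noteq> a \<and> t \<noteq> b"
        using AE_lborel_singleton[of a] AE_lborel_singleton[of b] by eventually_elim simp
      with hH gP AE_lborel_translate[OF gP, of \<epsilon>]
      show "AE t in lborel. of_real (indicator {a..b} t *\<^sub>R f t) = c * (H t * P (t + \<epsilon>)) - c * (H t * P (t + 0))"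
      proof eventually_elim
        fix t assume 1: "t \<in> ?S \<longrightarrow> of_real (h t - h a) = H t"
          and 2: "t \<in> ?S \<longrightarrow> of_real (g t - g b) = c * P t"
          and 3: "t + \<epsilon> \<in> ?S \<longrightarrow> of_real (g (t + \<epsilon>) - g b) = c * P (t + \<epsilon>)"
          and 4: "t \<noteq> a \<and> t \<noteq> b"
        show "of_real (indicator {a..b} t *\<^sub>R f t) = c * (H t * P (t + \<epsilon>)) - c * (H t * P (t + 0))"
        proof (cases "t \<in> ?S")
          case True
          \<comment> \<open>Past \<open>b\<close> both sides are 0: the left one because of the
            minimum, the right one because \<open>P\<close> vanishes there.\<close>
          have "complex_of_real (g (min b (t + \<epsilon>)) - g b) = c * P (t + \<epsilon>)"
            using 3 P0[of "t + \<epsilon>"] True \<epsilon> by (cases "t + \<epsilon> < b") auto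
          then have "complex_of_real (g (min b (t + \<epsilon>)) - g t) = c * P (t + \<epsilon>) - c * P t"
            using 2 True by (simp add: algebra_simps)
          moreover have "complex_of_real (f t) = of_real (h t - h a) * of_real (g (min b (t + \<epsilon>)) - g t)"
            by (simp add: f_def)
          ultimately have "complex_of_real (f t) = H t * (c * P (t + \<epsilon>) - c * P t)"
            using 1 True by simp
          then show ?thesis using True by (simp add: indicator_def algebra_simps)
        next
          case False
          then consider "t < a" | "b < t" using 4 by force
          then show ?thesis
            by cases (use H0[of t] P0[of t] P0[of "t + \<epsilon>"] \<epsilon> in auto)
        qed
      qed
    qed
    also have "\<dots> = c * (\<integral>t. H t * P (t + \<epsilon>) \<partial>lborel) - c * (\<integral>t. H t * P (t + 0) \<partial>lborel)"
      using kern[of \<epsilon>] kern[of 0] by (subst Bochner_Integration.integral_diff) auto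
    also have "\<dots> = - c * ?I \<epsilon>"
      using kern[of \<epsilon>] kern[of 0] correlation_average(1)[OF Fi Wi, of \<epsilon>] \<epsilon>
      by (simp add: algebra_simps)
    finally show ?thesis by (simp add: f_def[abs_def])
  qed
  have lim0: "(correlation F W \<longlongrightarrow> correlation F W 0) (at_right 0)"
    unfolding tendsto_at_iff_sequentially comp_def
  proof (intro allI impI)
    fix v :: "nat \<Rightarrow> real" assume v: "v \<longlonglongrightarrow> 0"
    show "(\<lambda>n. correlation F W (v n)) \<longlonglongrightarrow> correlation F W 0"
    proof (rule inverse_add_eq_1_cases[OF pq])
      assume "p = \<infinity>"
      then obtain K where K: "\<And>x. norm (F x) \<le> K" using Fb by auto
      show ?thesis by (rule correlation_tendsto_bounded[OF Wi Fm K v])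
    next
      assume "q = \<infinity>"
      then obtain K where K: "\<And>x. norm (W x) \<le> K" using Wb by auto
      \<comment> \<open>Exchanging the factors turns \<open>v\<close> into \<open>- v\<close>; the
        bounded case admits sequences of either sign.\<close>
      have "(\<lambda>n. - v n) \<longlonglongrightarrow> 0" using tendsto_minus[OF v] by simp
      from correlation_tendsto_bounded[OF Fi Wm K this] show ?thesis
        by (simp add: correlation_swap[of F W])
    next
      assume "p \<noteq> \<infinity>" "q \<noteq> \<infinity>" "1 < enn2real p" "1 < enn2real q" "1 / enn2real p + 1 / enn2real q = 1"
      then show ?thesis using correlation_tendsto_conjugate[OF _ _ _ Fi _ Wi _ v] Fb Wb by auto
    qed
  qed
  have corr0: "correlation F W 0 = (LINT t:{a<..<b}|lebesgue. \<phi> t * \<psi> t)"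
  proof -
    have m: "(\<lambda>r. F r * W (r + 0)) \<in> borel_measurable lborel" by measurable
    have "correlation F W 0 = (\<integral>r. F r * W (r + 0) \<partial>lebesgue)"
      unfolding correlation_def by (rule integral_completion[OF m, symmetric])
    also have "\<dots> = (\<integral>t. (indicator ?S t *\<^sub>R \<phi> t) * (indicator ?S t *\<^sub>R \<psi> t) \<partial>lebesgue)"
    proof (rule integral_cong_AE)
      show "(\<lambda>r. F r * W (r + 0)) \<in> borel_measurable lebesgue" by (rule measurable_completion[OF m])
      show "(\<lambda>t. (indicator ?S t *\<^sub>R \<phi> t) * (indicator ?S t *\<^sub>R \<psi> t)) \<in> borel_measurable lebesgue"
        by (rule borel_measurable_times[OF \<phi>m \<psi>m])
      show "AE r in lebesgue. F r * W (r + 0) = (indicator ?S r *\<^sub>R \<phi> r) * (indicator ?S r *\<^sub>R \<psi> r)"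
        using AE_completion[OF Fae] AE_completion[OF Wae]
        by eventually_elim (use F0 in \<open>auto simp: indicator_def\<close>)
    qed
    also have "\<dots> = (LINT t:{a<..<b}|lebesgue. \<phi> t * \<psi> t)"
      unfolding set_lebesgue_integral_def by (intro bochner_cong) (auto simp: indicator_def)
    finally show ?thesis .
  qed
  have "((\<lambda>\<epsilon>. - c * (?I \<epsilon> / of_real \<epsilon>)) \<longlongrightarrow> - c * correlation F W 0) (at_right 0)"
    by (intro tendsto_intros average_tendsto lim0 correlation_average(2)[OF Fi Wi]) auto
  moreover have "- c * correlation F W 0 = of_real (I - h a * (g b - g a))"
    using Ieq by (simp add: cneg corr0 ha ga gb)
  ultimately have "((\<lambda>\<epsilon>. complex_of_real (integral {a..b} (\<lambda>t. (h t - h a) * (g (min b (t + \<epsilon>)) - g t)) / \<epsilon>))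
       \<longlongrightarrow> of_real (I - h a * (g b - g a))) (at_right 0)"
    using eq by (subst tendsto_cong[where g = "\<lambda>\<epsilon>. - c * (?I \<epsilon> / of_real \<epsilon>)"])
      (auto simp: eventually_at_right_field intro: exI[of _ 1])
  then show ?thesis by (simp only: tendsto_of_real_iff)
qed

subsection \<open>Forward integrals and Young estimates\<close>

text \<open>Iterating \<open>w \<mapsto> X + q w\<close> drives any valid constant to the fixed point \<open>X / (1 - q)\<close>. This serves
  both as sewing lemma (bisecting the interval) and to absorb a Hoelder constant on short intervals.\<close>

lemma affine_bootstrap:
  fixes A B :: "'a \<Rightarrow> real"
  assumes q: "0 \<le> q" "q < 1" and w0: "0 \<le> w0" "\<And>x. x \<in> S \<Longrightarrow> A x \<le> w0 * B x" and X: "0 \<le> X"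
    and B: "\<And>x. x \<in> S \<Longrightarrow> 0 \<le> B x"
    and step: "\<And>w. 0 \<le> w \<Longrightarrow> (\<And>x. x \<in> S \<Longrightarrow> A x \<le> w * B x) \<Longrightarrow> (\<And>x. x \<in> S \<Longrightarrow> A x \<le> (X + q * w) * B x)"
    and x: "x \<in> S"
  shows "A x \<le> X / (1 - q) * B x"
proof -
  have it: "\<forall>x\<in>S. A x \<le> (X / (1 - q) + q ^ n * w0) * B x" for n
  proof (induction n)
    case 0
    have nonneg: "0 \<le> X / (1 - q)" using X q by simp
    show ?case
      using w0(2) B mult_nonneg_nonneg[OF nonneg B] by (force simp: distrib_right)
  next
    case (Suc n)
    have "X + q * (X / (1 - q) + q ^ n * w0) = X / (1 - q) + q ^ Suc n * w0"
      using q by (simp add: field_simps)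
    moreover have "0 \<le> X / (1 - q) + q ^ n * w0" using X q w0 by simp
    ultimately show ?case using step[of "X / (1 - q) + q ^ n * w0"] Suc by auto
  qed
  have "(\<lambda>n. (X / (1 - q) + q ^ n * w0) * B x) \<longlonglongrightarrow> (X / (1 - q) + 0 * w0) * B x"
    using q by (intro tendsto_intros LIMSEQ_realpow_zero) auto
  then show ?thesis
    using it x by (intro LIMSEQ_le_const[of _ "X / (1 - q) * B x"]) auto
qed

text \<open>The constant is a parameter, in contrast to \<open>holder_on\<close>, because the
  estimates compare constants on varying intervals. Its sign is part of the notion, which spares a
  side condition in monotonicity arguments.\<close>

definition holder_bound :: "real \<Rightarrow> real \<Rightarrow> real \<Rightarrow> real \<Rightarrow> (real \<Rightarrow> 'a::real_normed_vector) \<Rightarrow> bool" where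
  "holder_bound \<kappa> C a b f \<longleftrightarrow>
     0 \<le> C \<and> (\<forall>x y. a \<le> x \<longrightarrow> x \<le> y \<longrightarrow> y \<le> b \<longrightarrow> norm (f y - f x) \<le> C * (y - x) powr \<kappa>)"

lemma holder_boundD:
  assumes "holder_bound \<kappa> C a b f" "a \<le> x" "x \<le> y" "y \<le> b"
  shows "norm (f y - f x) \<le> C * (y - x) powr \<kappa>"
  using assms by (auto simp: holder_bound_def)

lemma holder_bound_abs:
  assumes "holder_bound \<kappa> C a b f" "x \<in> {a..b}" "y \<in> {a..b}"
  shows "norm (f y - f x) \<le> C * \<bar>y - x\<bar> powr \<kappa>"
proof (cases "x \<le> y")
  case True
  then show ?thesis using holder_boundD[OF assms(1), of x y] assms(2,3) by auto
next
  case False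
  then show ?thesis using holder_boundD[OF assms(1), of y x] assms(2,3)
    by (auto simp: norm_minus_commute)
qed

lemma holder_bound_nonneg: "holder_bound \<kappa> C a b f \<Longrightarrow> 0 \<le> C"
  by (simp add: holder_bound_def)

lemma holder_bound_subinterval:
  "holder_bound \<kappa> C a b f \<Longrightarrow> a \<le> a' \<Longrightarrow> b' \<le> b \<Longrightarrow> holder_bound \<kappa> C a' b' f"
  unfolding holder_bound_def by (meson order_trans)

lemma holder_bound_continuous:
  assumes "holder_bound \<kappa> C a b f" and "0 < \<kappa>"
  shows "continuous_on {a..b} f"
  unfolding continuous_on_def
proof
  fix x assume x: "x \<in> {a..b}"
  have "((\<lambda>y. f y - f x) \<longlongrightarrow> 0) (at x within {a..b})"
  proof (rule Lim_null_comparison)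
    show "\<forall>\<^sub>F y in at x within {a..b}. norm (f y - f x) \<le> C * \<bar>y - x\<bar> powr \<kappa>"
      using holder_bound_abs[OF assms(1) x] by (auto simp: eventually_at_filter)
    have "((\<lambda>y. C * \<bar>y - x\<bar> powr \<kappa>) \<longlongrightarrow> C * \<bar>x - x\<bar> powr \<kappa>) (at x within {a..b})"
      using assms(2) by (intro tendsto_intros tendsto_powr') auto
    then show "((\<lambda>y. C * \<bar>y - x\<bar> powr \<kappa>) \<longlongrightarrow> 0) (at x within {a..b})" by simp
  qed
  then show "(f \<longlongrightarrow> f x) (at x within {a..b})" by (simp add: LIM_zero_iff)
qed

lemma holder_bound_diff:
  assumes "holder_bound \<kappa> C a b g" "holder_bound \<kappa> C' a b g'"
  shows "holder_bound \<kappa> (C + C') a b (\<lambda>t. g t - g' t)"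
  unfolding holder_bound_def
proof (intro conjI allI impI)
  show "0 \<le> C + C'" using assms by (auto simp: holder_bound_def)
  fix x y assume xy: "a \<le> x" "x \<le> y" "y \<le> b"
  have "norm ((g y - g' y) - (g x - g' x)) \<le> norm (g y - g x) + norm (g' y - g' x)" by norm
  then show "norm ((g y - g' y) - (g x - g' x)) \<le> (C + C') * (y - x) powr \<kappa>"
    using holder_boundD[OF assms(1) xy] holder_boundD[OF assms(2) xy] by (simp add: algebra_simps)
qed

text \<open>Its limit is the forward integral in the sense of Russo and Vallois. The minimum keeps
  all arguments of \<open>g\<close> in \<open>[a,b]\<close>.\<close>

definition fwd_approx :: "(real \<Rightarrow> real) \<Rightarrow> (real \<Rightarrow> real) \<Rightarrow> real \<Rightarrow> real \<Rightarrow> real \<Rightarrow> real" where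
  "fwd_approx h g a b \<epsilon> = integral {a..b} (\<lambda>t. h t * (g (min b (t + \<epsilon>)) - g t)) / \<epsilon>"

definition has_fwd_integral :: "(real \<Rightarrow> real) \<Rightarrow> (real \<Rightarrow> real) \<Rightarrow> real \<Rightarrow> real \<Rightarrow> real \<Rightarrow> bool" where
  "has_fwd_integral h g a b I \<longleftrightarrow> (fwd_approx h g a b \<longlongrightarrow> I) (at_right 0)"

text \<open>Both sides are the integral of \<open>G\<close> over \<open>{v..v + \<epsilon>}\<close>
  minus that over \<open>{u..u + \<epsilon>}\<close>. An average of increments of length \<epsilon>
  thus becomes an average of increments of length \<open>v - u\<close>, which is bounded
  independently of \<epsilon>.\<close>

lemma integral_shift_difference:
  fixes G :: "real \<Rightarrow> real"
  assumes G: "continuous_on UNIV G" and "u \<le> v" "0 \<le> \<epsilon>"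
  shows "integral {u..v} (\<lambda>t. G (t + \<epsilon>) - G t) = integral {0..\<epsilon>} (\<lambda>w. G (v + w) - G (u + w))"
proof -
  have c: "continuous_on S G" for S using G continuous_on_subset by blast
  have i: "G integrable_on {x..y}" for x y by (intro integrable_continuous_real c)
  have sh: "(\<lambda>t. G (t + d)) integrable_on {x..y}" "(\<lambda>t. G (d + t)) integrable_on {x..y}" for d x y
    by (intro integrable_continuous_real continuous_on_compose2[OF G] continuous_intros subset_UNIV)+
  have shift: "integral {x..y} (\<lambda>t. G (t + d)) = integral {x + d..y + d} G" for x y d
    using integral_shift_real_ivl[of "x + d" d "y + d" G] by simp
  have "integral {u..v} (\<lambda>t. G (t + \<epsilon>) - G t) = integral {u + \<epsilon>..v + \<epsilon>} G - integral {u..v} G"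
    by (subst hk_diff) (auto simp: sh i shift)
  also have "\<dots> = integral {v..v + \<epsilon>} G - integral {u..u + \<epsilon>} G"
  proof -
    have "integral {u..v} G + integral {v..v + \<epsilon>} G = integral {u..v + \<epsilon>} G"
      "integral {u..u + \<epsilon>} G + integral {u + \<epsilon>..v + \<epsilon>} G = integral {u..v + \<epsilon>} G"
      using assms(2,3) by (auto intro!: hk_combine i)
    then show ?thesis by linarith
  qed
  also have "\<dots> = integral {0..\<epsilon>} (\<lambda>w. G (w + v)) - integral {0..\<epsilon>} (\<lambda>w. G (w + u))"
    by (simp add: shift add.commute)
  also have "\<dots> = integral {0..\<epsilon>} (\<lambda>w. G (v + w) - G (u + w))"
    by (subst hk_diff) (auto simp: sh add.commute)
  finally show ?thesis .
qed

lemma integral_abs_le_const: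
  fixes f :: "real \<Rightarrow> real"
  assumes "continuous_on {a..b} f" "a \<le> b" "\<And>x. x \<in> {a..b} \<Longrightarrow> \<bar>f x\<bar> \<le> C"
  shows "\<bar>integral {a..b} f\<bar> \<le> C * (b - a)"
  using integral_bound[OF assms(2,1)] assms(3) by (auto simp: real_norm_def)

text \<open>Constant extension beyond both ends. Projection onto \<open>[a,b]\<close> does not
  increase distances, so the Hoelder constant is kept while translations become possible on the
  whole line.\<close>

definition stop_path :: "real \<Rightarrow> real \<Rightarrow> (real \<Rightarrow> real) \<Rightarrow> real \<Rightarrow> real" where
  "stop_path a b g r = g (max a (min b r))"

lemma stop_path_holder:
  assumes "holder_bound \<kappa> C a b g" "a \<le> b" "0 < \<kappa>"
  shows "\<bar>stop_path a b g y - stop_path a b g x\<bar> \<le> C * \<bar>y - x\<bar> powr \<kappa>"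
proof -
  have "\<bar>stop_path a b g y - stop_path a b g x\<bar> \<le> C * \<bar>max a (min b y) - max a (min b x)\<bar> powr \<kappa>"
    using holder_bound_abs[OF assms(1), of "max a (min b x)" "max a (min b y)"] assms(2)
    by (auto simp: stop_path_def)
  also have "\<dots> \<le> C * \<bar>y - x\<bar> powr \<kappa>"
    using assms by (intro mult_left_mono powr_mono2) (auto simp: holder_bound_def)
  finally show ?thesis .
qed

lemma stop_path_continuous:
  assumes "holder_bound \<kappa> C a b g" "a \<le> b" "0 < \<kappa>"
  shows "continuous_on UNIV (stop_path a b g)"
  unfolding stop_path_def
  by (rule continuous_on_compose2[OF holder_bound_continuous[OF assms(1,3)]])
     (use assms(2) in \<open>auto intro!: continuous_intros\<close>)

text \<open>The sum of the geometric series with ratio \<open>2 powr (1 - 2 * \<kappa>)\<close>, the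
  factor by which one bisection reduces the error; the ratio is below 1 exactly for
  \<open>\<kappa> > 1/2\<close>.\<close>

definition young_const :: "real \<Rightarrow> real" where
  "young_const \<kappa> = 1 / (1 - 2 powr (1 - 2 * \<kappa>))"

lemma young_const_nonneg: "1/2 < \<kappa> \<Longrightarrow> 0 \<le> young_const \<kappa>"
  using powr_le_one_le[of 2] powr_mono[of "1 - 2 * \<kappa>" 0 2]
  by (simp add: young_const_def)

text \<open>A sewing argument for the approximation \<open>h u * p u v\<close> of
  \<open>F u v\<close>, where \<open>p\<close> is the averaged increment of \<open>g\<close>. Both
  \<open>F\<close> and \<open>p\<close> are additive, so bisection at \<open>m\<close> creates only
  the defect \<open>(h m - h u) * p m v\<close>, of order \<open>2 * \<kappa> > 1\<close>. By
  \<open>integral_shift_difference\<close> the bound on \<open>p\<close> has the constant of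
  \<open>g\<close> for every \<epsilon>.\<close>

lemma fwd_approx_bound:
  assumes \<kappa>: "1/2 < \<kappa>" "\<kappa> \<le> 1" and ab: "a \<le> b"
    and h: "holder_bound \<kappa> Hh a b h" and g: "holder_bound \<kappa> Hg a b g" and \<epsilon>: "0 < \<epsilon>"
  shows "\<bar>fwd_approx h g a b \<epsilon>\<bar> \<le> \<bar>h a\<bar> * Hg * (b - a) powr \<kappa> + young_const \<kappa> * Hh * Hg * (b - a) powr (2 * \<kappa>)"
proof -
  have k0: "0 < \<kappa>" using \<kappa> by simp
  have Hh: "0 \<le> Hh" and Hg: "0 \<le> Hg" using h g by (auto simp: holder_bound_def)
  define G where "G = stop_path a b g"
  have Gc: "continuous_on UNIV G" unfolding G_def by (rule stop_path_continuous[OF g ab k0])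
  have GH: "\<bar>G y - G x\<bar> \<le> Hg * \<bar>y - x\<bar> powr \<kappa>" for x y
    unfolding G_def by (rule stop_path_holder[OF g ab k0])
  let ?dG = "\<lambda>t. G (t + \<epsilon>) - G t"
  have dGc: "continuous_on S ?dG" for S
    by (intro continuous_intros continuous_on_compose2[OF Gc] subset_UNIV)
  have hc: "continuous_on {a..b} h" by (rule holder_bound_continuous[OF h k0])
  define p where "p u v = integral {u..v} ?dG / \<epsilon>" for u v
  define F where "F u v = integral {u..v} (\<lambda>t. h t * ?dG t) / \<epsilon>" for u v
  define A where "A = (\<lambda>(u, v). \<bar>F u v - h u * p u v\<bar>)"
  define S where "S = {(u, v). a \<le> u \<and> u \<le> v \<and> v \<le> b}"
  have ip: "?dG integrable_on {u..v}" for u v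
    by (intro integrable_continuous_real dGc)
  have cF: "continuous_on {u..v} (\<lambda>t. h t * ?dG t)" if "a \<le> u" "v \<le> b" for u v
    using that by (intro continuous_intros dGc continuous_on_subset[OF hc]) auto
  have iF: "(\<lambda>t. h t * ?dG t) integrable_on {u..v}" if "a \<le> u" "v \<le> b" for u v
    using cF[OF that] by (rule integrable_continuous_real)
  have pb: "\<bar>p u v\<bar> \<le> Hg * (v - u) powr \<kappa>" if "u \<le> v" for u v
  proof -
    have "\<bar>integral {0..\<epsilon>} (\<lambda>w. G (v + w) - G (u + w))\<bar> \<le> Hg * (v - u) powr \<kappa> * (\<epsilon> - 0)"
    proof (rule integral_abs_le_const)
      show "continuous_on {0..\<epsilon>} (\<lambda>w. G (v + w) - G (u + w))"
        by (intro continuous_intros continuous_on_compose2[OF Gc] subset_UNIV)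
      show "\<bar>G (v + w) - G (u + w)\<bar> \<le> Hg * (v - u) powr \<kappa>" for w
        using GH[of "v + w" "u + w"] that by simp
    qed (use \<epsilon> in auto)
    then show ?thesis
      using \<epsilon> integral_shift_difference[OF Gc that, of \<epsilon>] by (simp add: p_def divide_le_eq)
  qed
  \<comment> \<open>This bound deteriorates as \<epsilon> tends to 0, but it only starts the
    bootstrap, whose conclusion is free of the starting constant. The surplus
    \<open>(v - u) powr (1 - \<kappa>)\<close> is bounded over \<open>[a,b]\<close>.\<close>
  have crude: "A x \<le> (Hh * Hg * \<epsilon> powr \<kappa> / \<epsilon> * (b - a) powr (1 - \<kappa>)) * (snd x - fst x) powr (2 * \<kappa>)"
    if xS: "x \<in> S" for x
  proof -
    obtain u v where x: "x = (u, v)" and uv: "a \<le> u" "u \<le> v" "v \<le> b" using xS by (cases x) (auto simp: S_def)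
    have "F u v - h u * p u v = integral {u..v} (\<lambda>t. (h t - h u) * ?dG t) / \<epsilon>"
    proof -
      have "integral {u..v} (\<lambda>t. (h t - h u) * ?dG t)
        = integral {u..v} (\<lambda>t. h t * ?dG t) - integral {u..v} (\<lambda>t. h u * ?dG t)"
        unfolding left_diff_distrib
        by (intro hk_diff iF integrable_on_mult_right ip uv)
      then show ?thesis by (simp add: F_def p_def diff_divide_distrib)
    qed
    moreover have "\<bar>integral {u..v} (\<lambda>t. (h t - h u) * ?dG t)\<bar> \<le> (Hh * (v - u) powr \<kappa>) * (Hg * \<epsilon> powr \<kappa>) * (v - u)"
    proof (rule integral_abs_le_const)
      show "continuous_on {u..v} (\<lambda>t. (h t - h u) * ?dG t)"
        using uv by (intro continuous_intros dGc continuous_on_subset[OF hc]) auto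
      fix t assume t: "t \<in> {u..v}"
      have "\<bar>h t - h u\<bar> \<le> Hh * (t - u) powr \<kappa>"
        using holder_boundD[OF h, of u t] t uv by auto
      also have "\<dots> \<le> Hh * (v - u) powr \<kappa>"
        using t Hh k0 by (intro mult_left_mono powr_mono2) auto
      finally show "\<bar>(h t - h u) * ?dG t\<bar> \<le> (Hh * (v - u) powr \<kappa>) * (Hg * \<epsilon> powr \<kappa>)"
        using GH[of "t + \<epsilon>" t] \<epsilon> Hh Hg by (auto simp: abs_mult intro!: mult_mono)
    qed (use uv in auto)
    ultimately have "A x \<le> (Hh * (v - u) powr \<kappa>) * (Hg * \<epsilon> powr \<kappa>) * (v - u) / \<epsilon>"
      using \<epsilon> by (simp add: A_def x divide_right_mono)
    also have "\<dots> = Hh * Hg * \<epsilon> powr \<kappa> / \<epsilon> * ((v - u) powr \<kappa> * (v - u))"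
      by (simp add: field_simps)
    also have "\<dots> \<le> Hh * Hg * \<epsilon> powr \<kappa> / \<epsilon> * ((b - a) powr (1 - \<kappa>) * (v - u) powr (2 * \<kappa>))"
    proof (rule mult_left_mono)
      show "(v - u) powr \<kappa> * (v - u) \<le> (b - a) powr (1 - \<kappa>) * (v - u) powr (2 * \<kappa>)"
    proof (cases "u = v")
      case False
      then have "(v - u) powr \<kappa> * (v - u) = (v - u) powr (1 - \<kappa>) * (v - u) powr (2 * \<kappa>)"
        using uv by (simp add: powr_add[symmetric] powr_mult_base mult.commute add.commute)
      also have "\<dots> \<le> (b - a) powr (1 - \<kappa>) * (v - u) powr (2 * \<kappa>)"
        using uv \<kappa> by (intro mult_right_mono powr_mono2) auto
      finally show ?thesis .
    qed simp
    qed (use Hh Hg \<epsilon> in simp)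
    finally show ?thesis by (simp add: x mult.assoc)
  qed
  have q: "2 powr (1 - 2 * \<kappa>) < 1" using \<kappa> powr_less_mono[of "1 - 2 * \<kappa>" 0 2] by simp
  have main: "A x \<le> (Hh * Hg) / (1 - 2 powr (1 - 2 * \<kappa>)) * (snd x - fst x) powr (2 * \<kappa>)" if "x \<in> S" for x
  proof (rule affine_bootstrap[where S = S and A = A, OF _ q _ crude _ _ _ that])
    show "0 \<le> Hh * Hg * \<epsilon> powr \<kappa> / \<epsilon> * (b - a) powr (1 - \<kappa>)" using Hh Hg \<epsilon> by simp
    show "0 \<le> Hh * Hg" using Hh Hg by simp
    fix w x assume w: "0 \<le> w" and wS: "\<And>x. x \<in> S \<Longrightarrow> A x \<le> w * (snd x - fst x) powr (2 * \<kappa>)" and xS: "x \<in> S"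
    obtain u v where x: "x = (u, v)" and uv: "a \<le> u" "u \<le> v" "v \<le> b" using xS by (cases x) (auto simp: S_def)
    define m where "m = (u + v) / 2"
    define d where "d = (v - u) / 2"
    have m: "u \<le> m" "m \<le> v" "m - u = d" "v - m = d" "0 \<le> d" using uv by (auto simp: m_def d_def field_simps)
    have Fadd: "F u v = F u m + F m v"
      using hk_combine[OF m(1,2) iF[OF uv(1,3)]]
      by (simp add: F_def add_divide_distrib[symmetric])
    have padd: "p u v = p u m + p m v"
      using hk_combine[OF m(1,2) ip]
      by (simp add: p_def add_divide_distrib[symmetric])
    have hm: "\<bar>h m - h u\<bar> \<le> Hh * d powr \<kappa>" using holder_boundD[OF h, of u m] m uv by simp
    have "F u v - h u * p u v = (F u m - h u * p u m) + (F m v - h m * p m v) + (h m - h u) * p m v"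
      unfolding Fadd padd by (simp add: algebra_simps)
    then have "A x \<le> A (u, m) + A (m, v) + \<bar>h m - h u\<bar> * \<bar>p m v\<bar>"
      unfolding A_def x by (simp add: abs_mult[symmetric])
    also have "\<dots> \<le> w * d powr (2 * \<kappa>) + w * d powr (2 * \<kappa>) + (Hh * d powr \<kappa>) * (Hg * d powr \<kappa>)"
      using wS[of "(u, m)"] wS[of "(m, v)"] m uv hm pb[of m v] Hh Hg
      by (intro add_mono mult_mono) (auto simp: S_def)
    also have "\<dots> = (Hh * Hg + 2 * w) * d powr (2 * \<kappa>)"
    proof -
      have "d powr (2 * \<kappa>) = d powr \<kappa> * d powr \<kappa>" by (simp only: mult_2 powr_add)
      then show ?thesis by (simp add: algebra_simps)
    qed
    \<comment> \<open>Two halves, each smaller by \<open>(1/2) powr (2 * \<kappa>)\<close>, produce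
      the ratio \<open>2 powr (1 - 2 * \<kappa>)\<close>.\<close>
    also have "\<dots> = (Hh * Hg + 2 * w) * ((1/2) powr (2 * \<kappa>) * (v - u) powr (2 * \<kappa>))"
      using uv by (simp add: d_def powr_divide powr_one_eq_one)
    also have "\<dots> \<le> (Hh * Hg + 2 powr (1 - 2 * \<kappa>) * w) * (v - u) powr (2 * \<kappa>)"
    proof -
      have "(1/2::real) powr (2 * \<kappa>) \<le> 1" using \<kappa> by (simp add: powr_le1)
      then have "Hh * Hg * (1/2) powr (2 * \<kappa>) \<le> Hh * Hg" using Hh Hg by (simp add: mult_left_le)
      moreover have "2 * (1/2::real) powr (2 * \<kappa>) = 2 powr (1 - 2 * \<kappa>)"
        by (simp add: powr_diff powr_divide)
      ultimately have "(Hh * Hg + 2 * w) * (1/2) powr (2 * \<kappa>) \<le> Hh * Hg + 2 powr (1 - 2 * \<kappa>) * w"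
        by (simp add: algebra_simps)
      then show ?thesis by (simp add: mult.assoc[symmetric] mult_right_mono)
    qed
    finally show "A x \<le> (Hh * Hg + 2 powr (1 - 2 * \<kappa>) * w) * (snd x - fst x) powr (2 * \<kappa>)"
      by (simp add: x)
  qed auto
  \<comment> \<open>The lower truncation in \<open>stop_path\<close> is inactive, as
    \<open>t \<ge> a\<close> and \<open>\<epsilon> > 0\<close>.\<close>
  have "fwd_approx h g a b \<epsilon> = F a b"
    unfolding fwd_approx_def F_def
    by (intro arg_cong[where f = "\<lambda>x. x / \<epsilon>"] Henstock_Kurzweil_Integration.integral_cong)
       (use \<epsilon> in \<open>auto simp: G_def stop_path_def max_def min_def\<close>)
  then have "\<bar>fwd_approx h g a b \<epsilon>\<bar> \<le> A (a, b) + \<bar>h a\<bar> * \<bar>p a b\<bar>"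
    unfolding A_def by (simp add: abs_mult[symmetric])
  also have "\<dots> \<le> (Hh * Hg) / (1 - 2 powr (1 - 2 * \<kappa>)) * (b - a) powr (2 * \<kappa>) + \<bar>h a\<bar> * (Hg * (b - a) powr \<kappa>)"
    using main[of "(a, b)"] pb[OF ab] ab by (intro add_mono mult_left_mono) (auto simp: S_def)
  finally show ?thesis by (simp add: young_const_def algebra_simps)
qed

text \<open>The integrand 1. The quotient is the mean of \<open>G(b + w) - G(a + w)\<close> over
  \<open>0 \<le> w \<le> \<epsilon>\<close>; the stopped path is constant after \<open>b\<close>,
  and from \<open>a\<close> it moves by at most \<open>C * \<epsilon> powr \<kappa>\<close>.\<close>

lemma fwd_increment_tendsto:
  assumes \<kappa>: "0 < \<kappa>" and ab: "a \<le> b" and g: "holder_bound \<kappa> C a b g"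
  shows "((\<lambda>\<epsilon>. integral {a..b} (\<lambda>t. g (min b (t + \<epsilon>)) - g t) / \<epsilon>) \<longlongrightarrow> g b - g a) (at_right 0)"
proof -
  let ?L = "\<lambda>\<epsilon>. integral {a..b} (\<lambda>t. g (min b (t + \<epsilon>)) - g t)"
  define G where "G = stop_path a b g"
  let ?S = "\<lambda>\<epsilon>. integral {0..\<epsilon>} (\<lambda>w. G (b + w) - G (a + w))"
  have Gc: "continuous_on UNIV G" unfolding G_def by (rule stop_path_continuous[OF g ab \<kappa>])
  have GH: "\<bar>G y - G x\<bar> \<le> C * \<bar>y - x\<bar> powr \<kappa>" for x y
    unfolding G_def by (rule stop_path_holder[OF g ab \<kappa>])
  have C: "0 \<le> C" using g by (simp add: holder_bound_def)
  have "((\<lambda>\<epsilon>. ?L \<epsilon> / \<epsilon> - (g b - g a)) \<longlongrightarrow> 0) (at_right 0)"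
  proof (rule Lim_null_comparison)
    have "((\<lambda>\<epsilon>. C * \<epsilon> powr \<kappa>) \<longlongrightarrow> C * 0 powr \<kappa>) (at_right 0)"
      using \<kappa> by (intro tendsto_intros tendsto_powr') (auto simp: eventually_at_right_field intro: exI[of _ 1])
    then show "((\<lambda>\<epsilon>. C * \<epsilon> powr \<kappa>) \<longlongrightarrow> 0) (at_right 0)" by simp
    have bd: "norm (?L \<epsilon> / \<epsilon> - (g b - g a)) \<le> C * \<epsilon> powr \<kappa>"
      if \<epsilon>: "0 < \<epsilon>" for \<epsilon>
    proof -
      have cc: "continuous_on {0..\<epsilon>} (\<lambda>w. G (b + w) - G (a + w))"
        by (intro continuous_intros continuous_on_compose2[OF Gc] subset_UNIV)
      have "?L \<epsilon> = integral {a..b} (\<lambda>t. G (t + \<epsilon>) - G t)"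
        by (intro Henstock_Kurzweil_Integration.integral_cong)
           (use \<epsilon> in \<open>auto simp: G_def stop_path_def max_def min_def\<close>)
      also have "\<dots> = ?S \<epsilon>"
        using \<epsilon> by (intro integral_shift_difference Gc ab) auto
      finally have eq: "?L \<epsilon> = ?S \<epsilon>" .
      have "?S \<epsilon> - (g b - g a) * \<epsilon>
        = integral {0..\<epsilon>} (\<lambda>w. (G (b + w) - G (a + w)) - (g b - g a))"
        using \<epsilon> integrable_continuous_real[OF cc]
        by (subst hk_diff) auto
      also have "\<bar>\<dots>\<bar> \<le> C * \<epsilon> powr \<kappa> * (\<epsilon> - 0)"
      proof (rule integral_abs_le_const)
        show "continuous_on {0..\<epsilon>} (\<lambda>w. (G (b + w) - G (a + w)) - (g b - g a))"
          by (intro continuous_intros cc)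
        fix w assume w: "w \<in> {0..\<epsilon>}"
        have "G (b + w) = g b" "G a = g a" using w ab by (auto simp: G_def stop_path_def)
        then have "\<bar>(G (b + w) - G (a + w)) - (g b - g a)\<bar> \<le> C * w powr \<kappa>"
          using GH[of "a + w" a] w by (simp add: abs_minus_commute)
        also have "\<dots> \<le> C * \<epsilon> powr \<kappa>" using w C \<kappa> by (intro mult_left_mono powr_mono2) auto
        finally show "\<bar>(G (b + w) - G (a + w)) - (g b - g a)\<bar> \<le> C * \<epsilon> powr \<kappa>" .
      qed (use \<epsilon> in auto)
      finally have "\<bar>?S \<epsilon> - (g b - g a) * \<epsilon>\<bar> \<le> C * \<epsilon> powr \<kappa> * \<epsilon>"
        by simp
      moreover have "?S \<epsilon> / \<epsilon> - (g b - g a)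
        = (?S \<epsilon> - (g b - g a) * \<epsilon>) / \<epsilon>"
        using \<epsilon> by (simp add: field_simps)
      ultimately show ?thesis using \<epsilon> by (simp add: eq divide_le_eq abs_divide)
    qed
    show "\<forall>\<^sub>F \<epsilon> in at_right 0. norm (?L \<epsilon> / \<epsilon> - (g b - g a)) \<le> C * \<epsilon> powr \<kappa>"
      unfolding eventually_at_right_field using bd by (intro exI[of _ 1]) auto
  qed
  then show ?thesis by (simp add: LIM_zero_iff)
qed

lemma fwd_integrand_continuous:
  fixes h g :: "real \<Rightarrow> real"
  assumes "0 < \<kappa>" "a \<le> b" "holder_bound \<kappa> C a b g" "continuous_on {a..b} h" "0 \<le> \<epsilon>"
  shows "continuous_on {a..b} (\<lambda>t. h t * (g (min b (t + \<epsilon>)) - g t))"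
proof -
  have gc: "continuous_on {a..b} g" by (rule holder_bound_continuous[OF assms(3,1)])
  have "continuous_on {a..b} (\<lambda>t. g (min b (t + \<epsilon>)))"
    by (rule continuous_on_compose2[OF gc]) (use assms in \<open>auto intro!: continuous_intros\<close>)
  then show ?thesis by (intro continuous_on_mult[OF assms(4)] continuous_on_diff gc)
qed

text \<open>Additivity as a subtraction, so that existence over \<open>[b,c]\<close> is a
  conclusion. The approximations over \<open>[a,b]\<close> and \<open>[a,c]\<close> freeze
  \<open>g\<close> at different points, which matters only for \<open>t\<close> within \<epsilon> of
  \<open>b\<close>. There the integrands differ by a multiple of
  \<open>\<epsilon> powr \<kappa>\<close>, and the length \<epsilon> cancels the division.\<close>

lemma has_fwd_integral_subinterval:
  assumes \<kappa>: "0 < \<kappa>" and abc: "a \<le> b" "b \<le> c" and h: "continuous_on {a..c} h"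
    and g: "holder_bound \<kappa> C a c g"
    and I: "has_fwd_integral h g a b I" and J: "has_fwd_integral h g a c J"
  shows "has_fwd_integral h g b c (J - I)"
proof -
  have C: "0 \<le> C" using g by (simp add: holder_bound_def)
  obtain K where K: "\<And>t. t \<in> {a..c} \<Longrightarrow> \<bar>h t\<bar> \<le> K" "0 \<le> K"
  proof -
    have "bounded (h ` {a..c})" by (intro compact_imp_bounded compact_continuous_image h) auto
    then obtain K where "\<forall>t\<in>{a..c}. \<bar>h t\<bar> \<le> K" by (auto simp: bounded_iff)
    then show thesis using that[of "\<bar>K\<bar>"] by (meson abs_ge_self abs_ge_zero order_trans)
  qed
  have gb: "holder_bound \<kappa> C a b g" using g abc by (auto intro: holder_bound_subinterval)
  have hb: "continuous_on {a..b} h" using h abc by (auto intro: continuous_on_subset)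
  define R where "R \<epsilon> = fwd_approx h g a c \<epsilon> - fwd_approx h g a b \<epsilon> - fwd_approx h g b c \<epsilon>" for \<epsilon>
  have bd: "norm (R \<epsilon>) \<le> K * C * \<epsilon> powr \<kappa>" if \<epsilon>: "0 < \<epsilon>" for \<epsilon>
  proof -
    let ?f = "\<lambda>t. h t * (g (min c (t + \<epsilon>)) - g t)"
    let ?e = "\<lambda>t. h t * (g (min b (t + \<epsilon>)) - g t)"
    let ?d = "\<lambda>t. ?f t - ?e t"
    have cf: "continuous_on {a..c} ?f" and ce: "continuous_on {a..b} ?e"
      using fwd_integrand_continuous[OF \<kappa> _ g h, of \<epsilon>] fwd_integrand_continuous[OF \<kappa> _ gb hb, of \<epsilon>] abc \<epsilon> by auto
    have cfb: "continuous_on {a..b} ?f" using cf abc by (auto intro: continuous_on_subset)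
    have cd: "continuous_on {a..b} ?d" by (intro continuous_on_diff cfb ce)
    have "integral {a..c} ?f = integral {a..b} ?f + integral {b..c} ?f"
      using hk_combine[OF abc integrable_continuous_real[OF cf]] by simp
    then have Req: "R \<epsilon> = integral {a..b} ?d / \<epsilon>"
      using integrable_continuous_real[OF cfb] integrable_continuous_real[OF ce]
      by (subst hk_diff)
         (auto simp: R_def fwd_approx_def diff_divide_distrib add_divide_distrib)
    \<comment> \<open>Up to \<open>m\<close> both minima equal \<open>t + \<epsilon>\<close>; the
      maximum covers the case of \<epsilon> exceeding \<open>b - a\<close>.\<close>
    define m where "m = max a (b - \<epsilon>)"
    have m: "a \<le> m" "m \<le> b" "b - m \<le> \<epsilon>" using abc \<epsilon> by (auto simp: m_def)
    have "integral {a..b} ?d = integral {a..m} ?d + integral {m..b} ?d"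
      using hk_combine[OF m(1,2) integrable_continuous_real[OF cd]] by simp
    also have "integral {a..m} ?d = 0"
    proof (cases "m = a")
      case False
      have "integral {a..m} ?d = integral {a..m} (\<lambda>_. 0)"
      proof (rule Henstock_Kurzweil_Integration.integral_cong)
        fix t assume "t \<in> {a..m}"
        then have "t + \<epsilon> \<le> b" using False by (auto simp: m_def split: if_splits)
        then show "?d t = 0" using abc by auto
      qed
      then show ?thesis by simp
    qed simp
    finally have "integral {a..b} ?d = integral {m..b} ?d" by simp
    also have "\<bar>\<dots>\<bar> \<le> K * (C * \<epsilon> powr \<kappa>) * (b - m)"
    proof (rule integral_abs_le_const)
      show "continuous_on {m..b} ?d" using cd m by (auto intro: continuous_on_subset)
      fix t assume t: "t \<in> {m..b}"
      have tr: "t \<in> {a..c}" "min b (t + \<epsilon>) \<in> {a..c}" "min c (t + \<epsilon>) \<in> {a..c}" using t m abc \<epsilon> by auto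
      have "\<bar>g (min c (t + \<epsilon>)) - g (min b (t + \<epsilon>))\<bar> \<le> C * \<bar>min c (t + \<epsilon>) - min b (t + \<epsilon>)\<bar> powr \<kappa>"
        using holder_bound_abs[OF g tr(2,3)] by simp
      also have "\<dots> \<le> C * \<epsilon> powr \<kappa>"
        using t abc C \<epsilon> \<kappa> by (intro mult_left_mono powr_mono2) auto
      finally have "\<bar>h t\<bar> * \<bar>g (min c (t + \<epsilon>)) - g (min b (t + \<epsilon>))\<bar> \<le> K * (C * \<epsilon> powr \<kappa>)"
        using K tr by (intro mult_mono) auto
      moreover have "?d t = h t * (g (min c (t + \<epsilon>)) - g (min b (t + \<epsilon>)))" by (simp add: algebra_simps)
      ultimately show "\<bar>?d t\<bar> \<le> K * (C * \<epsilon> powr \<kappa>)" by (simp add: abs_mult)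
    qed (use m in auto)
    also have "\<dots> \<le> K * (C * \<epsilon> powr \<kappa>) * \<epsilon>" using m K C by (intro mult_left_mono) auto
    finally show ?thesis using \<epsilon> by (simp add: Req divide_le_eq abs_divide mult.assoc)
  qed
  have "(R \<longlongrightarrow> 0) (at_right 0)"
  proof (rule Lim_null_comparison)
    have "((\<lambda>\<epsilon>. K * C * \<epsilon> powr \<kappa>) \<longlongrightarrow> K * C * 0 powr \<kappa>) (at_right 0)"
      using \<kappa> by (intro tendsto_intros tendsto_powr') (auto simp: eventually_at_right_field intro: exI[of _ 1])
    then show "((\<lambda>\<epsilon>. K * C * \<epsilon> powr \<kappa>) \<longlongrightarrow> 0) (at_right 0)" by simp
    show "\<forall>\<^sub>F \<epsilon> in at_right 0. norm (R \<epsilon>) \<le> K * C * \<epsilon> powr \<kappa>"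
      unfolding eventually_at_right_field using bd by (intro exI[of _ 1]) auto
  qed
  with I J have "((\<lambda>\<epsilon>. fwd_approx h g a c \<epsilon> - fwd_approx h g a b \<epsilon> - R \<epsilon>) \<longlongrightarrow> J - I - 0) (at_right 0)"
    unfolding has_fwd_integral_def by (intro tendsto_diff)
  then show ?thesis unfolding has_fwd_integral_def by (simp add: R_def)
qed

text \<open>The splitting is performed at a fixed \<epsilon>, where the mixed terms are ordinary
  integrals of continuous functions; \<open>?C\<close> is the integrand of \<open>h2 dg1\<close>,
  which is added and subtracted.\<close>

lemma has_fwd_integral_diff_bound:
  assumes \<kappa>: "1/2 < \<kappa>" "\<kappa> \<le> 1" and ab: "a \<le> b"
    and I1: "has_fwd_integral h1 g1 a b I1" and I2: "has_fwd_integral h2 g2 a b I2"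
    and h: "holder_bound \<kappa> Dh a b (\<lambda>t. h1 t - h2 t)" and h2: "holder_bound \<kappa> Hh a b h2"
    and g: "holder_bound \<kappa> Dg a b (\<lambda>t. g1 t - g2 t)" and g1: "holder_bound \<kappa> Hg a b g1"
  shows "\<bar>I1 - I2\<bar> \<le> \<bar>h1 a - h2 a\<bar> * Hg * (b - a) powr \<kappa> + young_const \<kappa> * Dh * Hg * (b - a) powr (2 * \<kappa>)
     + (\<bar>h2 a\<bar> * Dg * (b - a) powr \<kappa> + young_const \<kappa> * Hh * Dg * (b - a) powr (2 * \<kappa>))" (is "_ \<le> ?bound")
proof (rule tendsto_le[OF _ tendsto_const])
  show "((\<lambda>\<epsilon>. \<bar>fwd_approx h1 g1 a b \<epsilon> - fwd_approx h2 g2 a b \<epsilon>\<bar>) \<longlongrightarrow> \<bar>I1 - I2\<bar>) (at_right 0)"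
    using I1 I2 unfolding has_fwd_integral_def by (intro tendsto_intros)
  have k0: "0 < \<kappa>" using \<kappa> by simp
  have eq: "fwd_approx h1 g1 a b \<epsilon> - fwd_approx h2 g2 a b \<epsilon>
      = fwd_approx (\<lambda>t. h1 t - h2 t) g1 a b \<epsilon> + fwd_approx h2 (\<lambda>t. g1 t - g2 t) a b \<epsilon>" if \<epsilon>: "0 < \<epsilon>" for \<epsilon>
  proof -
    let ?A = "\<lambda>t. (h1 t - h2 t) * (g1 (min b (t + \<epsilon>)) - g1 t)"
    let ?B = "\<lambda>t. h2 t * ((g1 (min b (t + \<epsilon>)) - g2 (min b (t + \<epsilon>))) - (g1 t - g2 t))"
    let ?C = "\<lambda>t. h2 t * (g1 (min b (t + \<epsilon>)) - g1 t)"
    have A: "?A integrable_on {a..b}" and B: "?B integrable_on {a..b}" and C: "?C integrable_on {a..b}"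
      using fwd_integrand_continuous[OF k0 ab g1 holder_bound_continuous[OF h k0], of \<epsilon>]
        fwd_integrand_continuous[OF k0 ab g holder_bound_continuous[OF h2 k0], of \<epsilon>]
        fwd_integrand_continuous[OF k0 ab g1 holder_bound_continuous[OF h2 k0], of \<epsilon>] \<epsilon>
      by (auto intro: integrable_continuous_real)
    have "integral {a..b} (\<lambda>t. h1 t * (g1 (min b (t + \<epsilon>)) - g1 t)) = integral {a..b} ?A + integral {a..b} ?C"
      using Henstock_Kurzweil_Integration.integral_add[OF A C] by (simp add: algebra_simps)
    moreover have "integral {a..b} (\<lambda>t. h2 t * (g2 (min b (t + \<epsilon>)) - g2 t)) = integral {a..b} ?C - integral {a..b} ?B"
      using hk_diff[OF C B] by (simp add: algebra_simps)
    ultimately show ?thesis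
      by (simp add: fwd_approx_def add_divide_distrib diff_divide_distrib)
  qed
  have "\<bar>fwd_approx h1 g1 a b \<epsilon> - fwd_approx h2 g2 a b \<epsilon>\<bar> \<le> ?bound" if \<epsilon>: "0 < \<epsilon>" for \<epsilon>
    using fwd_approx_bound[OF \<kappa> ab h g1 \<epsilon>] fwd_approx_bound[OF \<kappa> ab h2 g \<epsilon>]
    unfolding eq[OF \<epsilon>] by linarith
  then show "\<forall>\<^sub>F \<epsilon> in at_right 0. \<bar>fwd_approx h1 g1 a b \<epsilon> - fwd_approx h2 g2 a b \<epsilon>\<bar> \<le> ?bound"
    unfolding eventually_at_right_field by (intro exI[of _ 1]) auto
qed auto

text \<open>Restores the constant \<open>h a\<close> subtracted in
  \<open>has_gls_integral_forward_aux\<close>: its forward limit is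
  \<open>h a * (g b - g a)\<close>, the boundary term of the definition. For \<open>a = b\<close>
  both notions give 0.\<close>

lemma has_gls_integral_forward:
  assumes \<kappa>: "0 < \<kappa>" and ab: "a \<le> b" and h: "continuous_on {a..b} h" and g: "holder_bound \<kappa> C a b g"
    and I: "has_gls_integral h g a b I"
  shows "has_fwd_integral h g a b I"
proof (cases "a = b")
  case True
  then have "I = 0" using I by (simp add: has_gls_integral_def)
  moreover have "fwd_approx h g a b = (\<lambda>_. 0)" using True by (simp add: fwd_approx_def[abs_def])
  ultimately show ?thesis by (simp add: has_fwd_integral_def)
next
  case False
  then have ab': "a < b" using ab by simp
  have gc: "continuous_on {a..b} g" by (rule holder_bound_continuous[OF g \<kappa>])
  have "((\<lambda>\<epsilon>. integral {a..b} (\<lambda>t. (h t - h a) * (g (min b (t + \<epsilon>)) - g t)) / \<epsilon>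
      + h a * (integral {a..b} (\<lambda>t. g (min b (t + \<epsilon>)) - g t) / \<epsilon>))
    \<longlongrightarrow> (I - h a * (g b - g a)) + h a * (g b - g a)) (at_right 0)"
    by (intro tendsto_intros has_gls_integral_forward_aux[OF ab' h gc I] fwd_increment_tendsto[OF \<kappa> ab g])
  then have lim: "((\<lambda>\<epsilon>. integral {a..b} (\<lambda>t. (h t - h a) * (g (min b (t + \<epsilon>)) - g t)) / \<epsilon>
      + h a * (integral {a..b} (\<lambda>t. g (min b (t + \<epsilon>)) - g t) / \<epsilon>)) \<longlongrightarrow> I) (at_right 0)" by simp
  have "integral {a..b} (\<lambda>t. (h t - h a) * (g (min b (t + \<epsilon>)) - g t)) / \<epsilon>
      + h a * (integral {a..b} (\<lambda>t. g (min b (t + \<epsilon>)) - g t) / \<epsilon>) = fwd_approx h g a b \<epsilon>" if "0 < \<epsilon>" for \<epsilon>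
  proof -
    have "(\<lambda>t. (h t - h a) * (g (min b (t + \<epsilon>)) - g t)) integrable_on {a..b}"
      "(\<lambda>t. h a * (g (min b (t + \<epsilon>)) - g t)) integrable_on {a..b}"
      using that by (intro integrable_continuous_real fwd_integrand_continuous[OF \<kappa> ab g] continuous_intros h; simp)+
    from Henstock_Kurzweil_Integration.integral_add[OF this]
    have "integral {a..b} (\<lambda>t. h t * (g (min b (t + \<epsilon>)) - g t))
      = integral {a..b} (\<lambda>t. (h t - h a) * (g (min b (t + \<epsilon>)) - g t)) + h a * integral {a..b} (\<lambda>t. g (min b (t + \<epsilon>)) - g t)"
      by (simp add: left_diff_distrib)
    then show ?thesis by (simp add: fwd_approx_def add_divide_distrib)
  qed
  then have "\<forall>\<^sub>F \<epsilon> in at_right 0. integral {a..b} (\<lambda>t. (h t - h a) * (g (min b (t + \<epsilon>)) - g t)) / \<epsilon>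
      + h a * (integral {a..b} (\<lambda>t. g (min b (t + \<epsilon>)) - g t) / \<epsilon>) = fwd_approx h g a b \<epsilon>"
    unfolding eventually_at_right_field by (intro exI[of _ 1]) auto
  from Lim_transform_eventually[OF lim this] show ?thesis by (simp add: has_fwd_integral_def)
qed

lemma has_fwd_integral_unique:
  "has_fwd_integral h g a b I \<Longrightarrow> has_fwd_integral h g a b J \<Longrightarrow> I = J"
  unfolding has_fwd_integral_def by (rule tendsto_unique[rotated]) auto

text \<open>Any two admissible values are limits of the same quotients, hence equal, so the definite
  description denotes the given value.\<close>

lemma gls_integral_forward:
  assumes "0 < \<kappa>" "a \<le> b" "continuous_on {a..b} h" "holder_bound \<kappa> C a b g" "gls_integrable h g a b"
  shows "has_fwd_integral h g a b (gls_integral h g a b)"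
proof -
  obtain I where I: "has_gls_integral h g a b I" using assms(5) by (auto simp: gls_integrable_def)
  have "gls_integral h g a b = I"
    unfolding gls_integral_def
    by (rule the_equality[where P = "has_gls_integral h g a b", OF I])
       (metis assms(1-4) I has_gls_integral_forward has_fwd_integral_unique)
  then show ?thesis using has_gls_integral_forward[OF assms(1-4) I] by simp
qed

subsection \<open>Hoelder bounds from short intervals\<close>

text \<open>A discrete Gronwall inequality. On an interval of length at most \<tau> the bootstrap
  with ratio \<open>1/2\<close> yields the Hoelder constant \<open>2 * A * (norm (z s) + N)\<close>,
  so each such step multiplies \<open>norm z + N\<close> by at most
  \<open>1 + 2 * A * \<tau> powr \<kappa>\<close>. \<open>N\<close> is an inhomogeneity: 1 for the a
  priori bound, the Hoelder constant of the difference of the drivers for the comparison.\<close>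

lemma holder_gronwall:
  fixes z :: "real \<Rightarrow> 'a::real_normed_vector"
  assumes \<kappa>: "0 < \<kappa>" and \<tau>: "0 < \<tau>" and A: "0 \<le> A" and N: "0 \<le> N"
    and z: "holder_bound \<kappa> C 0 T z"
    and step: "\<And>s e w. 0 \<le> s \<Longrightarrow> s \<le> e \<Longrightarrow> e \<le> T \<Longrightarrow> e - s \<le> \<tau> \<Longrightarrow> holder_bound \<kappa> w s e z
      \<Longrightarrow> holder_bound \<kappa> (A * (norm (z s) + N) + w / 2) s e z"
  defines "Q \<equiv> (1 + 2 * A * \<tau> powr \<kappa>) ^ nat \<lceil>T / \<tau>\<rceil>"
  shows holder_gronwall_sup: "\<And>t. 0 \<le> t \<Longrightarrow> t \<le> T \<Longrightarrow> norm (z t) + N \<le> Q * (norm (z 0) + N)"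
    and holder_gronwall_local: "\<And>s t. 0 \<le> s \<Longrightarrow> s \<le> t \<Longrightarrow> t \<le> T \<Longrightarrow> t - s \<le> \<tau> \<Longrightarrow>
      norm (z t - z s) \<le> 2 * A * Q * (norm (z 0) + N) * (t - s) powr \<kappa>"
proof -
  have C: "0 \<le> C" using z by (simp add: holder_bound_def)
  have loc: "norm (z e - z s) \<le> 2 * A * (norm (z s) + N) * (e - s) powr \<kappa>"
    if se: "0 \<le> s" "s \<le> e" "e \<le> T" "e - s \<le> \<tau>" for s e
  proof -
    \<comment> \<open>Indexed by ordered pairs, a Hoelder bound is a family of inequalities to which
      \<open>affine_bootstrap\<close> applies.\<close>
    define S where "S = {(x, y). s \<le> x \<and> x \<le> y \<and> y \<le> e}"
    have hb: "holder_bound \<kappa> w s e z \<longleftrightarrow> 0 \<le> w \<and> (\<forall>p\<in>S. norm (z (snd p) - z (fst p)) \<le> w * (snd p - fst p) powr \<kappa>)" for w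
      by (auto simp: holder_bound_def S_def)
    have zC: "holder_bound \<kappa> C s e z" using z se by (auto intro: holder_bound_subinterval)
    have "norm (z (snd (s, e)) - z (fst (s, e))) \<le> A * (norm (z s) + N) / (1 - 1/2) * (snd (s, e) - fst (s, e)) powr \<kappa>"
    proof (rule affine_bootstrap[where S = S and A = "\<lambda>p. norm (z (snd p) - z (fst p))" and ?w0.0 = C])
      fix w and p :: "real \<times> real"
      assume w: "0 \<le> w" and "\<And>p. p \<in> S \<Longrightarrow> norm (z (snd p) - z (fst p)) \<le> w * (snd p - fst p) powr \<kappa>" and p: "p \<in> S"
      then have "holder_bound \<kappa> w s e z" by (simp add: hb)
      from step[OF se this] p show "norm (z (snd p) - z (fst p)) \<le> (A * (norm (z s) + N) + 1/2 * w) * (snd p - fst p) powr \<kappa>"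
        by (simp add: hb)
    qed (use A N C zC se in \<open>auto simp: hb\<close>, auto simp: S_def)
    then show ?thesis by simp
  qed
  define c where "c = 1 + 2 * A * \<tau> powr \<kappa>"
  have c1: "1 \<le> c" using A by (simp add: c_def)
  have it: "\<forall>t. 0 \<le> t \<longrightarrow> t \<le> T \<longrightarrow> t \<le> real k * \<tau> \<longrightarrow> norm (z t) + N \<le> c ^ k * (norm (z 0) + N)" for k
  proof (induction k)
    case (Suc k)
    show ?case
    proof (intro allI impI)
      fix t assume t: "0 \<le> t" "t \<le> T" "t \<le> real (Suc k) * \<tau>"
      \<comment> \<open>One step back of length \<tau>, stopped at 0, reaches the range of the
        induction hypothesis.\<close>
      define s where "s = max 0 (t - \<tau>)"
      have s: "0 \<le> s" "s \<le> t" "t - s \<le> \<tau>" "s \<le> real k * \<tau>" "s \<le> T"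
        using t \<tau> by (auto simp: s_def algebra_simps)
      have "(t - s) powr \<kappa> \<le> \<tau> powr \<kappa>" using s \<kappa> by (intro powr_mono2) auto
      then have "norm (z t - z s) \<le> 2 * A * (norm (z s) + N) * \<tau> powr \<kappa>"
        using loc[of s t] s t A N
        by (meson add_nonneg_nonneg mult_left_mono mult_nonneg_nonneg norm_ge_zero order_trans zero_le_numeral)
      moreover have "norm (z t) \<le> norm (z s) + norm (z t - z s)" by norm
      ultimately have "norm (z t) + N \<le> c * (norm (z s) + N)"
        by (simp add: c_def algebra_simps)
      also have "\<dots> \<le> c * (c ^ k * (norm (z 0) + N))"
        using Suc s c1 by (intro mult_left_mono) auto
      finally show "norm (z t) + N \<le> c ^ Suc k * (norm (z 0) + N)" by (simp add: mult.assoc)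
    qed
  qed (auto simp: order.antisym)
  have sup: "norm (z t) + N \<le> Q * (norm (z 0) + N)" if "0 \<le> t" "t \<le> T" for t
  proof -
    have "T / \<tau> \<le> real (nat \<lceil>T / \<tau>\<rceil>)" by linarith
    then have "T \<le> real (nat \<lceil>T / \<tau>\<rceil>) * \<tau>" by (simp only: pos_divide_le_eq[OF \<tau>])
    then have "t \<le> real (nat \<lceil>T / \<tau>\<rceil>) * \<tau>" using that by linarith
    then show ?thesis using it[of "nat \<lceil>T / \<tau>\<rceil>"] that by (simp add: Q_def c_def)
  qed
  then show "\<And>t. 0 \<le> t \<Longrightarrow> t \<le> T \<Longrightarrow> norm (z t) + N \<le> Q * (norm (z 0) + N)" .
  fix s t assume st: "0 \<le> s" "s \<le> t" "t \<le> T" "t - s \<le> \<tau>"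
  have "norm (z t - z s) \<le> 2 * A * (norm (z s) + N) * (t - s) powr \<kappa>" by (rule loc[OF st])
  also have "\<dots> \<le> 2 * A * (Q * (norm (z 0) + N)) * (t - s) powr \<kappa>"
    using sup[of s] st A by (intro mult_right_mono mult_left_mono) auto
  finally show "norm (z t - z s) \<le> 2 * A * Q * (norm (z 0) + N) * (t - s) powr \<kappa>" by (simp add: mult.assoc)
qed

text \<open>Increments over more than \<tau> are at most \<open>2 * V\<close>, and for them
  \<open>1 \<le> \<tau> powr (- \<kappa>) * (t - s) powr \<kappa>\<close>.\<close>

lemma holder_bound_of_local:
  fixes z :: "real \<Rightarrow> 'a::real_normed_vector"
  assumes \<kappa>: "0 < \<kappa>" and \<tau>: "0 < \<tau>" and "0 \<le> W" "0 \<le> V"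
    and sup: "\<And>t. 0 \<le> t \<Longrightarrow> t \<le> T \<Longrightarrow> norm (z t) \<le> V"
    and loc: "\<And>s t. 0 \<le> s \<Longrightarrow> s \<le> t \<Longrightarrow> t \<le> T \<Longrightarrow> t - s \<le> \<tau> \<Longrightarrow> norm (z t - z s) \<le> W * (t - s) powr \<kappa>"
  shows "holder_bound \<kappa> (W + 2 * V * \<tau> powr (- \<kappa>)) 0 T z"
  unfolding holder_bound_def
proof (intro conjI allI impI)
  show "0 \<le> W + 2 * V * \<tau> powr (- \<kappa>)" using assms by simp
  fix s t assume st: "0 \<le> s" "s \<le> t" "t \<le> T"
  show "norm (z t - z s) \<le> (W + 2 * V * \<tau> powr (- \<kappa>)) * (t - s) powr \<kappa>"
  proof (cases "t - s \<le> \<tau>")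
    case True
    have "norm (z t - z s) \<le> W * (t - s) powr \<kappa>" by (rule loc[OF st True])
    also have "\<dots> \<le> (W + 2 * V * \<tau> powr (- \<kappa>)) * (t - s) powr \<kappa>"
      using assms(4) by (intro mult_right_mono) auto
    finally show ?thesis .
  next
    case False
    have "norm (z t - z s) \<le> norm (z t) + norm (z s)" by (rule norm_triangle_ineq4)
    also have "\<dots> \<le> 2 * V * (\<tau> powr (- \<kappa>) * \<tau> powr \<kappa>)"
      using sup[of t] sup[of s] st \<tau> by (simp add: powr_add[symmetric])
    also have "\<dots> \<le> 2 * V * (\<tau> powr (- \<kappa>) * (t - s) powr \<kappa>)"
      using False \<tau> \<kappa> assms(4) by (intro mult_left_mono powr_mono2) auto
    also have "\<dots> \<le> (W + 2 * V * \<tau> powr (- \<kappa>)) * (t - s) powr \<kappa>"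
      using assms(3) by (simp add: algebra_simps)
    finally show ?thesis .
  qed
qed

section \<open>Increments of the coefficient matrix\<close>

text \<open>The conditions concern partial derivatives, while the mean value inequality needs the
  total one; linearity along the coordinate axes links them.\<close>

lemma frechet_derivative_partial_deriv:
  fixes F :: "real^'n \<Rightarrow> 'a::real_normed_vector"
  assumes "F differentiable (at x)"
  shows "frechet_derivative F (at x) d = (\<Sum>i\<in>UNIV. (d $ i) *\<^sub>R partial_deriv i F x)"
proof -
  let ?D = "frechet_derivative F (at x)"
  have D: "(F has_derivative ?D) (at x)" using assms frechet_derivative_works by blast
  then interpret D: bounded_linear ?D by (rule has_derivative_bounded_linear)
  have p: "partial_deriv i F x = ?D (axis i 1)" for i
    unfolding partial_deriv_def
  proof (rule vector_derivative_at)
    have "((\<lambda>r. F (x + r *\<^sub>R axis i 1)) has_derivative (\<lambda>r. ?D (r *\<^sub>R axis i 1))) (at 0)"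
      by (rule has_derivative_compose[of "\<lambda>r. x + r *\<^sub>R axis i 1" _ 0 UNIV F ?D])
         (use D in \<open>auto intro!: derivative_eq_intros\<close>)
    then show "((\<lambda>r. F (x + r *\<^sub>R axis i 1)) has_vector_derivative ?D (axis i 1)) (at 0)"
      by (simp add: has_vector_derivative_def D.scaleR)
  qed
  have "d = (\<Sum>i\<in>UNIV. (d $ i) *\<^sub>R axis i 1)"
    by (simp add: vec_eq_iff axis_def if_distrib cong: if_cong)
  then have "?D d = ?D (\<Sum>i\<in>UNIV. (d $ i) *\<^sub>R axis i 1)" by simp
  also have "\<dots> = (\<Sum>i\<in>UNIV. (d $ i) *\<^sub>R ?D (axis i 1))" by (simp add: D.sum D.scaleR)
  finally show ?thesis by (simp add: p)
qed

text \<open>The mean value inequality for \<open>l \<mapsto> F(x + l d) - G(y + l d)\<close> on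
  \<open>[0,1]\<close>. Equal directions make the derivative a combination of differences of partial
  derivatives, with the components of \<open>d\<close> as coefficients; \<open>CARD('n)\<close>
  counts them, each being at most \<open>norm d\<close>.\<close>

lemma norm_diff_le_of_partial_deriv:
  fixes F G :: "real^'n \<Rightarrow> 'a::real_normed_vector"
  assumes F: "\<And>y. F differentiable (at y)" and G: "\<And>y. G differentiable (at y)"
    and B: "\<And>l i. 0 \<le> l \<Longrightarrow> l \<le> 1 \<Longrightarrow> norm (partial_deriv i F (x + l *\<^sub>R d) - partial_deriv i G (y + l *\<^sub>R d)) \<le> B"
  shows "norm ((F (x + d) - G (y + d)) - (F x - G y)) \<le> real CARD('n) * norm d * B"
proof -
  define \<Theta> where "\<Theta> l = F (x + l *\<^sub>R d) - G (y + l *\<^sub>R d)" for l :: real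
  define D where "D l = frechet_derivative F (at (x + l *\<^sub>R d)) d - frechet_derivative G (at (y + l *\<^sub>R d)) d" for l
  have der: "(\<Theta> has_vector_derivative D l) (at l)" for l
  proof -
    have *: "((\<lambda>l. H (p + l *\<^sub>R d)) has_vector_derivative frechet_derivative H (at (p + l *\<^sub>R d)) d) (at l)"
      if "\<And>y. H differentiable (at y)" for H :: "real^'n \<Rightarrow> 'a" and p
    proof -
      have DH: "(H has_derivative frechet_derivative H (at (p + l *\<^sub>R d))) (at (p + l *\<^sub>R d))"
        using that frechet_derivative_works by blast
      then interpret bounded_linear "frechet_derivative H (at (p + l *\<^sub>R d))" by (rule has_derivative_bounded_linear)
      have "((\<lambda>l. H (p + l *\<^sub>R d)) has_derivative (\<lambda>r. frechet_derivative H (at (p + l *\<^sub>R d)) (r *\<^sub>R d))) (at l)"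
        by (rule has_derivative_compose[of "\<lambda>l. p + l *\<^sub>R d" _ l UNIV H])
           (use DH in \<open>auto intro!: derivative_eq_intros\<close>)
      then show ?thesis by (simp add: has_vector_derivative_def scaleR)
    qed
    show ?thesis unfolding \<Theta>_def D_def by (intro derivative_intros * F G)
  qed
  have nD: "norm (D l) \<le> real CARD('n) * norm d * B" if "0 \<le> l" "l \<le> 1" for l
  proof -
    have "D l = (\<Sum>i\<in>UNIV. (d $ i) *\<^sub>R (partial_deriv i F (x + l *\<^sub>R d) - partial_deriv i G (y + l *\<^sub>R d)))"
      by (simp add: D_def frechet_derivative_partial_deriv F G sum_subtractf scaleR_diff_right)
    also have "norm \<dots> \<le> (\<Sum>i\<in>(UNIV :: 'n set). norm d * B)"
    proof (rule sum_norm_le)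
      fix i
      show "norm ((d $ i) *\<^sub>R (partial_deriv i F (x + l *\<^sub>R d) - partial_deriv i G (y + l *\<^sub>R d))) \<le> norm d * B"
        using B[OF that, of i] component_le_norm_cart[of d i] by (auto intro!: mult_mono)
    qed
    finally show ?thesis by simp
  qed
  have "norm (\<Theta> 1 - \<Theta> 0) \<le> (real CARD('n) * norm d * B) * norm (1 - 0 :: real)"
  proof (rule differentiable_bound[where S = "{0..1}" and f' = "\<lambda>l h. h *\<^sub>R D l"])
    fix l :: real assume l: "l \<in> {0..1}"
    show "(\<Theta> has_derivative (\<lambda>h. h *\<^sub>R D l)) (at l within {0..1})"
      using der[of l] by (simp add: has_vector_derivative_def has_derivative_at_withinI)
    show "onorm (\<lambda>h. h *\<^sub>R D l) \<le> real CARD('n) * norm d * B"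
    proof (rule onorm_le)
      fix h :: real
      show "norm (h *\<^sub>R D l) \<le> real CARD('n) * norm d * B * norm h"
        using mult_left_mono[OF nD[of l], of "\<bar>h\<bar>"] l by (simp add: mult.commute)
    qed
  qed auto
  then show ?thesis by (simp add: \<Theta>_def)
qed

text \<open>Comparing with the point \<open>x2 + (y1 - y2)\<close> leaves two increments in the same direction \<open>y1 - y2\<close>.\<close>

lemma sigma_four_point:
  fixes \<sigma> :: "real \<Rightarrow> real^'n \<Rightarrow> 'a::real_normed_vector"
  assumes diff: "\<And>t y. t \<in> {0..T} \<Longrightarrow> \<sigma> t differentiable (at y)"
    and lip: "\<And>t x y. t \<in> {0..T} \<Longrightarrow> norm (\<sigma> t x - \<sigma> t y) \<le> M * norm (x - y)"
    and time: "\<And>s t x i. s \<in> {0..T} \<Longrightarrow> t \<in> {0..T} \<Longrightarrow>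
      norm (partial_deriv i (\<sigma> t) x - partial_deriv i (\<sigma> s) x) \<le> M * \<bar>t - s\<bar>"
    and space: "\<And>t x y i. t \<in> {0..T} \<Longrightarrow> norm x \<le> 3 * R \<Longrightarrow> norm y \<le> 3 * R \<Longrightarrow>
      norm (partial_deriv i (\<sigma> t) x - partial_deriv i (\<sigma> t) y) \<le> M' * norm (x - y)"
    and ab: "a \<in> {0..T}" "b \<in> {0..T}"
    and R: "norm x2 \<le> R" "norm y1 \<le> R" "norm y2 \<le> R"
  shows "norm ((\<sigma> b x1 - \<sigma> b x2) - (\<sigma> a y1 - \<sigma> a y2))
    \<le> M * norm ((x1 - x2) - (y1 - y2)) + real CARD('n) * norm (y1 - y2) * (M * \<bar>b - a\<bar> + M' * norm (x2 - y2))"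
proof -
  define d where "d = y1 - y2"
  have nd: "norm d \<le> 2 * R" unfolding d_def using R norm_triangle_ineq4[of y1 y2] by linarith
  \<comment> \<open>Since \<open>norm d \<le> 2 * R\<close>, the segments stay within
    \<open>3 * R\<close>; this is the origin of the radius in the condition on the
    derivatives.\<close>
  have R3: "norm (p + l *\<^sub>R d) \<le> 3 * R" if "norm p \<le> R" "0 \<le> l" "l \<le> 1" for p and l :: real
  proof -
    have "norm (p + l *\<^sub>R d) \<le> norm p + l * norm d" using norm_triangle_ineq[of p "l *\<^sub>R d"] that by simp
    also have "l * norm d \<le> norm d" using that by (simp add: mult_left_le_one_le)
    finally show ?thesis using that nd by linarith
  qed
  have "norm ((\<sigma> b (x2 + d) - \<sigma> a (y2 + d)) - (\<sigma> b x2 - \<sigma> a y2))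
    \<le> real CARD('n) * norm d * (M * \<bar>b - a\<bar> + M' * norm (x2 - y2))"
  proof (rule norm_diff_le_of_partial_deriv)
    fix l :: real and i assume l: "0 \<le> l" "l \<le> 1"
    have "norm (partial_deriv i (\<sigma> b) (x2 + l *\<^sub>R d) - partial_deriv i (\<sigma> a) (y2 + l *\<^sub>R d))
      \<le> norm (partial_deriv i (\<sigma> b) (x2 + l *\<^sub>R d) - partial_deriv i (\<sigma> a) (x2 + l *\<^sub>R d))
        + norm (partial_deriv i (\<sigma> a) (x2 + l *\<^sub>R d) - partial_deriv i (\<sigma> a) (y2 + l *\<^sub>R d))" by norm
    also have "\<dots> \<le> M * \<bar>b - a\<bar> + M' * norm ((x2 + l *\<^sub>R d) - (y2 + l *\<^sub>R d))"
      by (intro add_mono time space ab R3 R l)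
    finally show "norm (partial_deriv i (\<sigma> b) (x2 + l *\<^sub>R d) - partial_deriv i (\<sigma> a) (y2 + l *\<^sub>R d))
      \<le> M * \<bar>b - a\<bar> + M' * norm (x2 - y2)" by simp
  qed (use diff ab in auto)
  moreover have "norm (\<sigma> b x1 - \<sigma> b (x2 + d)) \<le> M * norm ((x1 - x2) - (y1 - y2))"
    using lip[OF ab(2), of x1 "x2 + d"] by (simp add: d_def algebra_simps)
  moreover have "(\<sigma> b x1 - \<sigma> b x2) - (\<sigma> a y1 - \<sigma> a y2)
    = (\<sigma> b x1 - \<sigma> b (x2 + d)) + ((\<sigma> b (x2 + d) - \<sigma> a (y2 + d)) - (\<sigma> b x2 - \<sigma> a y2))"
    by (simp add: d_def)
  ultimately show ?thesis
    by (smt (verit) d_def norm_triangle_ineq)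
qed

subsection \<open>Integral equations\<close>

text \<open>Either \<open>x \<le> c\<close>, or \<open>x / c \<ge> 1\<close> and the power \<rho>
  enlarges it. Integrated with a suitable \<open>c\<close>, this replaces Hoelder's
  inequality.\<close>

lemma le_add_scaled_powr:
  fixes c x \<rho> :: real
  assumes "0 < c" "0 \<le> x" "1 \<le> \<rho>"
  shows "x \<le> c + c powr (1 - \<rho>) * x powr \<rho>"
proof (cases "x \<le> c")
  case True
  then show ?thesis by (simp add: add_increasing2)
next
  case False
  then have "1 \<le> x / c" using assms by simp
  then have "(x / c) powr 1 \<le> (x / c) powr \<rho>" using assms by (intro powr_mono) auto
  then have "c * (x / c) \<le> c * (x / c) powr \<rho>" using assms by (intro mult_left_mono) auto
  also have "\<dots> = c powr (1 - \<rho>) * x powr \<rho>" using assms by (simp add: powr_divide powr_diff)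
  finally show ?thesis using assms by simp
qed

text \<open>The level \<open>c = (t - s) powr (- \<beta>)\<close> gives
  \<open>(t - s) powr (1 - \<beta>)\<close> from small values of \<open>b0\<close>, and from large
  ones the same power times \<open>(t - s) powr (\<beta> * \<rho> - 1)\<close>. The last exponent is
  nonnegative by \<open>\<rho> \<ge> 1 / \<beta>\<close>, so a power of \<open>T\<close> bounds that
  factor.\<close>

lemma lp_fun_integral_bound:
  fixes b0 :: "real \<Rightarrow> real"
  assumes b0: "lp_fun (ennreal \<rho>) 0 T b0" and T: "0 < T" and \<rho>: "1 \<le> \<rho>" and \<beta>: "0 < \<beta>" "1 / \<beta> \<le> \<rho>"
  obtains C where "0 \<le> C"
    "\<And>s t L (F :: real \<Rightarrow> 'a::euclidean_space). 0 \<le> s \<Longrightarrow> s \<le> t \<Longrightarrow> t \<le> T \<Longrightarrow> F integrable_on {s..t} \<Longrightarrow>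
      (\<And>r. r \<in> {s..t} \<Longrightarrow> norm (F r) \<le> L + b0 r) \<Longrightarrow>
      norm (integral {s..t} F) \<le> L * (t - s) + C * (t - s) powr (1 - \<beta>)"
proof -
  let ?p = "\<lambda>r. \<bar>b0 r\<bar> powr \<rho>"
  have "integrable (lebesgue_on {0<..<T}) ?p"
    using b0 \<rho> by (simp add: lp_fun_def)
  then have "?p integrable_on {0<..<T}" by (rule integrable_on_lebesgue_on) simp
  then have pi: "?p integrable_on {0..T}" by (simp add: integrable_on_Icc_iff_Ioo)
  define B where "B = integral {0..T} ?p"
  have B: "0 \<le> B" unfolding B_def by (intro Henstock_Kurzweil_Integration.integral_nonneg pi) simp
  show thesis
  proof (rule that[of "1 + T powr (\<beta> * \<rho> - 1) * B"])
    show "0 \<le> 1 + T powr (\<beta> * \<rho> - 1) * B" using B by simp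
    fix s t L and F :: "real \<Rightarrow> 'a"
    assume st: "0 \<le> s" "s \<le> t" "t \<le> T" and F: "F integrable_on {s..t}"
      and le: "\<And>r. r \<in> {s..t} \<Longrightarrow> norm (F r) \<le> L + b0 r"
    show "norm (integral {s..t} F) \<le> L * (t - s) + (1 + T powr (\<beta> * \<rho> - 1) * B) * (t - s) powr (1 - \<beta>)"
    proof (cases "s = t")
      case False
      define l where "l = t - s"
      have l: "0 < l" "l \<le> T" using False st by (auto simp: l_def)
      define c where "c = l powr (- \<beta>)"
      have c: "0 < c" using l by (simp add: c_def)
      have pst: "?p integrable_on {s..t}" using pi st by (auto intro: integrable_subinterval_real)
      have "norm (integral {s..t} F) \<le> integral {s..t} (\<lambda>r. (L + c) + c powr (1 - \<rho>) * ?p r)"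
      proof (rule Henstock_Kurzweil_Integration.integral_norm_bound_integral[OF F])
        show "(\<lambda>r. (L + c) + c powr (1 - \<rho>) * ?p r) integrable_on {s..t}"
          by (intro Henstock_Kurzweil_Integration.integrable_add integrable_on_mult_right integrable_const_ivl pst)
        fix r assume "r \<in> {s..t}"
        then show "norm (F r) \<le> (L + c) + c powr (1 - \<rho>) * ?p r"
          using le[of r] le_add_scaled_powr[OF c, of "\<bar>b0 r\<bar>" \<rho>] \<rho> by auto
      qed
      also have "\<dots> = (L + c) * l + c powr (1 - \<rho>) * integral {s..t} ?p"
        using st pst by (subst Henstock_Kurzweil_Integration.integral_add) (auto simp: l_def intro!: integrable_on_mult_right)
      also have "\<dots> \<le> (L + c) * l + c powr (1 - \<rho>) * B"
        unfolding B_def using st pst pi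
        by (intro add_left_mono mult_left_mono integral_subset_le) auto
      also have "c powr (1 - \<rho>) = l powr (1 - \<beta>) * l powr (\<beta> * \<rho> - 1)"
        unfolding c_def powr_powr powr_add[symmetric] by (simp add: algebra_simps)
      also have "(L + c) * l + l powr (1 - \<beta>) * l powr (\<beta> * \<rho> - 1) * B
        \<le> (L + c) * l + l powr (1 - \<beta>) * T powr (\<beta> * \<rho> - 1) * B"
        using l B \<beta> by (intro add_left_mono mult_right_mono mult_left_mono powr_mono2) (auto simp: field_simps)
      also have "c * l = l powr (1 - \<beta>)"
        using l by (simp add: c_def powr_mult_base mult.commute)
      then have "(L + c) * l = L * l + l powr (1 - \<beta>)" by (simp add: distrib_right)
      finally show ?thesis by (simp add: l_def algebra_simps)
    qed simp
  qed
qed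

lemma norm_row_sums_le:
  fixes J :: "'n::finite \<Rightarrow> 'm::finite \<Rightarrow> real"
  assumes "\<And>i j. \<bar>J i j\<bar> \<le> B"
  shows "norm (\<chi> i. \<Sum>j\<in>UNIV. J i j) \<le> real CARD('n) * real CARD('m) * B"
proof -
  have "norm (\<chi> i. \<Sum>j\<in>UNIV. J i j) \<le> (\<Sum>i\<in>(UNIV::'n set). \<bar>\<Sum>j\<in>(UNIV::'m set). J i j\<bar>)"
    using norm_le_l1_cart[of "\<chi> i. \<Sum>j\<in>(UNIV::'m set). J i j"] by simp
  also have "\<dots> \<le> (\<Sum>i\<in>(UNIV::'n set). \<Sum>j\<in>(UNIV::'m set). B)"
    by (intro sum_mono order_trans[OF sum_abs] assms)
  finally show ?thesis by simp
qed

lemma norm_nth_nth_le: "norm (A $ i $ j) \<le> norm (A :: real^'m^'n)"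
  by (meson Finite_Cartesian_Product.norm_nth_le order_trans)

lemma holder_bound_vec_nth:
  "holder_bound \<kappa> C a b f \<Longrightarrow> holder_bound \<kappa> C a b (\<lambda>t. f t $ i)"
  unfolding holder_bound_def
  by (metis (no_types, lifting) Finite_Cartesian_Product.norm_nth_le order_trans vector_minus_component)

lemma matrix_young_diff:
  fixes h1 h2 :: "real \<Rightarrow> real^'m^'n" and g1 g2 :: "real \<Rightarrow> real^'m"
  assumes \<kappa>: "1/2 < \<kappa>" "\<kappa> \<le> 1" and ab: "a \<le> b"
    and J1: "\<And>i j. has_fwd_integral (\<lambda>r. h1 r $ i $ j) (\<lambda>r. g1 r $ j) a b (J1 i j)"
    and J2: "\<And>i j. has_fwd_integral (\<lambda>r. h2 r $ i $ j) (\<lambda>r. g2 r $ j) a b (J2 i j)"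
    and h: "holder_bound \<kappa> Dh a b (\<lambda>t. h1 t - h2 t)" and h2: "holder_bound \<kappa> Hh a b h2"
    and g: "holder_bound \<kappa> Dg a b (\<lambda>t. g1 t - g2 t)" and g1: "holder_bound \<kappa> Hg a b g1"
  shows "norm ((\<chi> i. \<Sum>j\<in>UNIV. J1 i j) - (\<chi> i. \<Sum>j\<in>UNIV. J2 i j))
    \<le> real CARD('n) * real CARD('m) *
      (norm (h1 a - h2 a) * Hg * (b - a) powr \<kappa> + young_const \<kappa> * Dh * Hg * (b - a) powr (2 * \<kappa>)
       + (norm (h2 a) * Dg * (b - a) powr \<kappa> + young_const \<kappa> * Hh * Dg * (b - a) powr (2 * \<kappa>)))" (is "_ \<le> _ * ?bound")
proof -
  have "(\<chi> i. \<Sum>j\<in>UNIV. J1 i j) - (\<chi> i. \<Sum>j\<in>UNIV. J2 i j) = (\<chi> i. \<Sum>j\<in>UNIV. J1 i j - J2 i j)"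
    by (simp add: vec_eq_iff sum_subtractf)
  also have "norm \<dots> \<le> real CARD('n) * real CARD('m) * ?bound"
  proof (rule norm_row_sums_le)
    fix i j
    have "\<bar>J1 i j - J2 i j\<bar> \<le> \<bar>h1 a $ i $ j - h2 a $ i $ j\<bar> * Hg * (b - a) powr \<kappa> + young_const \<kappa> * Dh * Hg * (b - a) powr (2 * \<kappa>)
     + (\<bar>h2 a $ i $ j\<bar> * Dg * (b - a) powr \<kappa> + young_const \<kappa> * Hh * Dg * (b - a) powr (2 * \<kappa>))"
      using holder_bound_vec_nth[OF holder_bound_vec_nth[OF h, of i], of j] holder_bound_vec_nth[OF holder_bound_vec_nth[OF h2, of i], of j]
        holder_bound_vec_nth[OF g, of j] holder_bound_vec_nth[OF g1, of j]
      by (intro has_fwd_integral_diff_bound[OF \<kappa> ab J1 J2]) auto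
    also have "\<dots> \<le> ?bound"
      using norm_nth_nth_le[of "h1 a - h2 a" i j] norm_nth_nth_le[of "h2 a" i j]
        holder_bound_nonneg[OF g1] holder_bound_nonneg[OF g]
      by (intro add_mono mult_right_mono order_refl) auto
    finally show "\<bar>J1 i j - J2 i j\<bar> \<le> ?bound" .
  qed
  finally show ?thesis .
qed

text \<open>Comparison with the zero integrand and the zero integrator: the terms carrying the
  second integrand vanish.\<close>

lemma matrix_young:
  fixes h :: "real \<Rightarrow> real^'m^'n" and g :: "real \<Rightarrow> real^'m"
  assumes \<kappa>: "1/2 < \<kappa>" "\<kappa> \<le> 1" and ab: "a \<le> b"
    and J: "\<And>i j. has_fwd_integral (\<lambda>r. h r $ i $ j) (\<lambda>r. g r $ j) a b (J i j)"
    and h: "holder_bound \<kappa> Hh a b h" and g: "holder_bound \<kappa> Hg a b g"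
  shows "norm (\<chi> i. \<Sum>j\<in>UNIV. J i j)
    \<le> real CARD('n) * real CARD('m) *
      (norm (h a) * Hg * (b - a) powr \<kappa> + young_const \<kappa> * Hh * Hg * (b - a) powr (2 * \<kappa>))"
proof -
  have "has_fwd_integral (\<lambda>_. 0) (\<lambda>_. 0) a b 0"
    by (simp add: has_fwd_integral_def fwd_approx_def[abs_def])
  then show ?thesis
    using matrix_young_diff[OF \<kappa> ab J, of "\<lambda>_. 0" "\<lambda>_. 0" "\<lambda>_ _. 0" Hh 0 Hg Hg] h g
    by (simp add: holder_bound_def zero_vec_def[symmetric])
qed

text \<open>The equation involves integrals from 0 only. Integrals over \<open>[s,t]\<close>, needed
  for estimates on short intervals, are obtained as differences by additivity of the forward
  integral.\<close>

lemma is_solution_increment: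
  fixes u :: "real \<Rightarrow> real^'n" and g :: "real \<Rightarrow> real^'m"
  assumes \<kappa>: "0 < \<kappa>" and st: "0 \<le> s" "s \<le> t" "t \<le> T"
    and sol: "is_solution T \<beta> f \<sigma> g x u"
    and \<sigma>: "continuous_on {0..T} (\<lambda>r. \<sigma> r (u r))" and g: "holder_bound \<kappa> C 0 T g"
  obtains J where "\<And>i j. has_fwd_integral (\<lambda>r. \<sigma> r (u r) $ i $ j) (\<lambda>r. g r $ j) s t (J i j)"
    "(\<lambda>r. f r (u r)) integrable_on {s..t}"
    "u t - u s = integral {s..t} (\<lambda>r. f r (u r)) + (\<chi> i. \<Sum>j\<in>UNIV. J i j)"
proof -
  let ?h = "\<lambda>i j r. \<sigma> r (u r) $ i $ j" and ?g = "\<lambda>j r. g r $ j"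
  have hc: "continuous_on {0..y} (?h i j)" if "y \<le> T" for i j y
    using that by (intro continuous_intros continuous_on_subset[OF \<sigma>]) auto
  have gb: "holder_bound \<kappa> C 0 y (?g j)" if "y \<le> T" for j y
    using holder_bound_vec_nth[OF g] that by (auto intro: holder_bound_subinterval)
  have eqs: "(\<lambda>r. f r (u r)) absolutely_integrable_on {0..y}"
    "gls_integrable (?h i j) (?g j) 0 y"
    "u y - x = integral {0..y} (\<lambda>r. f r (u r)) + gls_matrix_integral (\<lambda>s. \<sigma> s (u s)) g 0 y"
    if "0 \<le> y" "y \<le> T" for y i j
    using sol that set_lebesgue_integral_eq_integral(2)[of "{0..y}" "\<lambda>r. f r (u r)"]
    by (auto simp: is_solution_def gls_matrix_integrable_def)
  have fw: "has_fwd_integral (?h i j) (?g j) 0 y (gls_integral (?h i j) (?g j) 0 y)" if "0 \<le> y" "y \<le> T" for i j y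
    by (rule gls_integral_forward[OF \<kappa> that(1) hc[OF that(2)] gb[OF that(2)] eqs(2)[OF that]])
  define J where "J i j = gls_integral (?h i j) (?g j) 0 t - gls_integral (?h i j) (?g j) 0 s" for i j
  show thesis
  proof (rule that[of J])
    fix i j
    show "has_fwd_integral (?h i j) (?g j) s t (J i j)"
      unfolding J_def
      by (rule has_fwd_integral_subinterval[OF \<kappa> st(1,2) hc[OF st(3)] gb[OF st(3)]])
         (use fw st in auto)
  next
    have i: "(\<lambda>r. f r (u r)) integrable_on {0..t}"
      using eqs(1)[of t] st by (auto simp: absolutely_integrable_on_def)
    then show "(\<lambda>r. f r (u r)) integrable_on {s..t}"
      using st by (auto intro: integrable_subinterval_real)
    have "integral {0..s} (\<lambda>r. f r (u r)) + integral {s..t} (\<lambda>r. f r (u r)) = integral {0..t} (\<lambda>r. f r (u r))"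
      by (rule hk_combine[OF st(1,2) i])
    moreover have "gls_matrix_integral (\<lambda>s. \<sigma> s (u s)) g 0 t - gls_matrix_integral (\<lambda>s. \<sigma> s (u s)) g 0 s
      = (\<chi> i. \<Sum>j\<in>UNIV. J i j)"
      by (simp add: gls_matrix_integral_def J_def vec_eq_iff sum_subtractf)
    ultimately show "u t - u s = integral {s..t} (\<lambda>r. f r (u r)) + (\<chi> i. \<Sum>j\<in>UNIV. J i j)"
      using eqs(3)[of t] eqs(3)[of s] st by (simp add: algebra_simps)
  qed
qed

text \<open>Over the degenerate interval 0 is the only admissible value of the generalised
  integral.\<close>

lemma is_solution_initial:
  fixes u :: "real \<Rightarrow> real^'n" and g :: "real \<Rightarrow> real^'m"
  assumes "is_solution T \<beta> f \<sigma> g x u" "0 \<le> T"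
  shows "u 0 = x"
proof -
  have "gls_integral h g 0 0 = 0" for h g
    unfolding gls_integral_def by (rule the_equality) (auto simp: has_gls_integral_def)
  then have "gls_matrix_integral A g 0 0 = 0" for A :: "real \<Rightarrow> real^'m^'n" and g
    by (simp add: gls_matrix_integral_def vec_eq_iff)
  moreover have "u 0 - x = (LINT s:{0..0}|lebesgue. f s (u s)) + gls_matrix_integral (\<lambda>s. \<sigma> s (u s)) g 0 0"
    using assms by (auto simp: is_solution_def)
  moreover have "(LINT s:{0..0}|lebesgue. f s (u s)) = 0"
    using assms set_lebesgue_integral_eq_integral(2)[of "{0..0}" "\<lambda>r. f r (u r)"]
    by (force simp: is_solution_def)
  ultimately show ?thesis by simp
qed

text \<open>\<open>E\<close> collects the coefficients of a Hoelder constant that is to be absorbed;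
  the summand 1 keeps the base in \<open>(0,1)\<close> also for \<open>E = 0\<close>.\<close>

lemma exists_small_powr:
  fixes \<kappa> E :: real
  assumes "0 < \<kappa>" "0 \<le> E"
  obtains \<tau> where "0 < \<tau>" "\<tau> \<le> 1" "\<tau> powr \<kappa> \<le> 1" "\<tau> powr \<kappa> * E \<le> 1 / 2"
proof -
  define \<tau> where "\<tau> = (1 / (2 * (E + 1))) powr (1 / \<kappa>)"
  have eq: "\<tau> powr \<kappa> = 1 / (2 * (E + 1))" using assms by (simp add: \<tau>_def powr_powr)
  have "\<tau> powr \<kappa> \<le> 1" "\<tau> powr \<kappa> * E \<le> 1 / 2"
    unfolding eq using assms by (auto simp: divide_simps)
  moreover have "0 < \<tau>" using assms by (simp add: \<tau>_def)
  moreover have "\<tau> \<le> 1" unfolding \<tau>_def using assms by (intro powr_le1) auto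
  ultimately show thesis using assms by (intro that[of \<tau>]) auto
qed

lemma le_powr_of_le:
  fixes x L \<kappa> :: real
  assumes "0 \<le> x" "x \<le> L" "\<kappa> \<le> 1"
  shows "x \<le> L powr (1 - \<kappa>) * x powr \<kappa>"
proof (cases "x = 0")
  case False
  then have "x = x powr (1 - \<kappa>) * x powr \<kappa>" using assms by (simp add: powr_add[symmetric])
  also have "\<dots> \<le> L powr (1 - \<kappa>) * x powr \<kappa>"
    using assms by (intro mult_right_mono powr_mono2) auto
  finally show ?thesis .
qed simp

text \<open>On an interval of length at most \<open>L\<close> a Lipschitz bound in time is a Hoelder
  bound, at the price of \<open>L powr (1 - \<kappa>)\<close>.\<close>

lemma holder_bound_coefficient:
  assumes lipx: "\<And>t x y. t \<in> {0..T} \<Longrightarrow> norm (\<sigma> t x - \<sigma> t y) \<le> M * norm (x - y)"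
    and lipt: "\<And>s t x. s \<in> {0..T} \<Longrightarrow> t \<in> {0..T} \<Longrightarrow> norm (\<sigma> t x - \<sigma> s x) \<le> M * \<bar>t - s\<bar>"
    and M: "0 \<le> M" and \<kappa>: "\<kappa> \<le> 1" and ab: "0 \<le> a" "b \<le> T" "b - a \<le> L"
    and u: "holder_bound \<kappa> w a b u"
  shows "holder_bound \<kappa> (M * (L powr (1 - \<kappa>) + w)) a b (\<lambda>r. \<sigma> r (u r))"
  unfolding holder_bound_def
proof (intro conjI allI impI)
  show "0 \<le> M * (L powr (1 - \<kappa>) + w)" using M holder_bound_nonneg[OF u] by simp
  fix x y assume xy: "a \<le> x" "x \<le> y" "y \<le> b"
  have t: "x \<in> {0..T}" "y \<in> {0..T}" using xy ab by auto
  have "norm (\<sigma> y (u y) - \<sigma> x (u x)) \<le> norm (\<sigma> y (u y) - \<sigma> x (u y)) + norm (\<sigma> x (u y) - \<sigma> x (u x))" by norm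
  also have "\<dots> \<le> M * \<bar>y - x\<bar> + M * norm (u y - u x)" by (intro add_mono lipx lipt t)
  also have "\<dots> \<le> M * (L powr (1 - \<kappa>) * (y - x) powr \<kappa>) + M * (w * (y - x) powr \<kappa>)"
    using M xy ab \<kappa> le_powr_of_le[of "y - x" L \<kappa>] holder_boundD[OF u xy]
    by (intro add_mono mult_left_mono) auto
  finally show "norm (\<sigma> y (u y) - \<sigma> x (u x)) \<le> M * (L powr (1 - \<kappa>) + w) * (y - x) powr \<kappa>"
    by (simp add: algebra_simps)
qed

lemma holder_on_imp_holder_bound:
  "holder_on \<alpha> {0..T} g \<Longrightarrow> \<exists>C. holder_bound \<alpha> C 0 T g"
proof -
  assume "holder_on \<alpha> {0..T} g"
  then obtain C where C: "0 \<le> C" "\<And>s t. s \<in> {0..T} \<Longrightarrow> t \<in> {0..T} \<Longrightarrow> norm (g t - g s) \<le> C * \<bar>t - s\<bar> powr \<alpha>"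
    unfolding holder_on_def by auto
  then have "holder_bound \<alpha> C 0 T g"
    unfolding holder_bound_def using C(1) by (auto intro!: order_trans[OF C(2)])
  then show ?thesis by blast
qed

lemma holder_bound_norm_le:
  assumes w: "holder_bound \<kappa> w s e z" and "e - s \<le> \<tau>" "0 \<le> \<kappa>" "r \<in> {s..e}"
  shows "norm (z r) \<le> norm (z s) + w * \<tau> powr \<kappa>"
proof -
  have "norm (z r) \<le> norm (z s) + norm (z r - z s)" by norm
  also have "norm (z r - z s) \<le> w * (r - s) powr \<kappa>" using holder_boundD[OF w, of s r] assms(4) by auto
  also have "w * (r - s) powr \<kappa> \<le> w * \<tau> powr \<kappa>"
    using assms holder_bound_nonneg[OF w] by (intro mult_left_mono powr_mono2) auto
  finally show ?thesis by simp
qed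

lemma powr_double_le:
  fixes x \<tau> \<kappa> :: real
  assumes "0 \<le> x" "x \<le> \<tau>" "0 \<le> \<kappa>"
  shows "x powr (2 * \<kappa>) \<le> \<tau> powr \<kappa> * x powr \<kappa>"
proof -
  have "x powr (2 * \<kappa>) = x powr \<kappa> * x powr \<kappa>" by (simp only: mult_2 powr_add)
  also have "\<dots> \<le> \<tau> powr \<kappa> * x powr \<kappa>" using assms by (intro mult_right_mono powr_mono2) auto
  finally show ?thesis .
qed

text \<open>Every occurrence of \<open>w\<close> carries the factor \<open>P\<close>, a power of the
  length of the short intervals, so the smallness condition leaves at most
  \<open>w / 2\<close>.\<close>

lemma young_increment_bound:
  fixes e1 e2 e3 c n w P :: real
  assumes "0 \<le> e1" "0 \<le> e2" "0 \<le> e3" "0 \<le> c" "0 \<le> n" "0 \<le> w" "0 \<le> P" "P \<le> 1" "P * (e1 + e2 + e3) \<le> 1 / 2"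
  shows "e1 * (n + w * P) + c + e2 * (1 + (n + w * P)) + e3 * (1 + w) * P \<le> (e1 + e2 + e3 + c) * (n + 1) + w / 2"
proof -
  have "w * (P * (e1 + e2 + e3)) \<le> w / 2" using mult_left_mono[OF assms(9,6)] by simp
  moreover have "e3 * P \<le> e3" using assms by (simp add: mult_left_le)
  moreover have "0 \<le> e3 * n" "0 \<le> c * n" using assms by auto
  ultimately show ?thesis using assms(1) by (simp add: algebra_simps)
qed

section \<open>A priori bound and comparison of solutions\<close>

text \<open>\<open>R\<close> is fixed before \<open>g\<close> and \<open>u\<close>, so the driver
  enters through \<open>B\<close> alone. Linear growth of both coefficients makes the estimate on a
  short interval affine in the norm of the starting value, as \<open>holder_gronwall\<close>
  requires with \<open>N = 1\<close>.\<close>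

lemma solution_uniform_bound:
  fixes f :: "real \<Rightarrow> real^'n \<Rightarrow> real^'n" and \<sigma> :: "real \<Rightarrow> real^'n \<Rightarrow> real^'m^'n"
  assumes \<beta>: "0 < \<beta>" "\<beta> < 1/2" and T: "0 < T"
    and lipx: "\<And>t x y. t \<in> {0..T} \<Longrightarrow> norm (\<sigma> t x - \<sigma> t y) \<le> M * norm (x - y)"
    and lipt: "\<And>s t x. s \<in> {0..T} \<Longrightarrow> t \<in> {0..T} \<Longrightarrow> norm (\<sigma> t x - \<sigma> s x) \<le> M * \<bar>t - s\<bar>"
    and gr: "\<And>t x. t \<in> {0..T} \<Longrightarrow> norm (\<sigma> t x) \<le> K1 * (1 + norm x)"
    and fb: "\<And>s t V v. 0 \<le> s \<Longrightarrow> s \<le> t \<Longrightarrow> t \<le> T \<Longrightarrow> (\<lambda>r. f r (v r)) integrable_on {s..t} \<Longrightarrow>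
      (\<And>r. r \<in> {s..t} \<Longrightarrow> norm (v r) \<le> V) \<Longrightarrow>
      norm (integral {s..t} (\<lambda>r. f r (v r))) \<le> L0 * V * (t - s) + Cb * (t - s) powr (1 - \<beta>)"
    and c: "0 \<le> M" "0 \<le> K1" "0 \<le> L0" "0 \<le> Cb" "0 \<le> B"
  shows "\<exists>R. \<forall>g u. holder_bound (1 - \<beta>) B 0 T g \<longrightarrow> is_solution T \<beta> f \<sigma> g x u \<longrightarrow>
    (\<forall>t\<in>{0..T}. norm (u t) \<le> R)"
proof -
  define \<kappa> where "\<kappa> = 1 - \<beta>"
  have \<kappa>: "1/2 < \<kappa>" "\<kappa> \<le> 1" "0 < \<kappa>" using \<beta> by (auto simp: \<kappa>_def)
  define D where "D = real CARD('n) * real CARD('m)"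
  have D: "0 \<le> D" by (simp add: D_def)
  define Y where "Y = young_const \<kappa>"
  have Y: "0 \<le> Y" unfolding Y_def by (rule young_const_nonneg[OF \<kappa>(1)])
  \<comment> \<open>\<open>e2\<close> belongs to the starting value of \<sigma> in Young's estimate,
    \<open>e3\<close> to its Hoelder constant and \<open>L0\<close> to the drift: the terms in which
    \<open>w\<close> appears. \<open>Cb\<close> enters \<open>A\<close> but not the choice of
    \<tau>.\<close>
  define e2 where "e2 = D * K1 * B"
  define e3 where "e3 = D * Y * M * B"
  have e: "0 \<le> e2" "0 \<le> e3" using D Y c by (auto simp: e2_def e3_def)
  obtain \<tau> where \<tau>: "0 < \<tau>" "\<tau> \<le> 1" "\<tau> powr \<kappa> \<le> 1" "\<tau> powr \<kappa> * (L0 + e2 + e3) \<le> 1 / 2"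
    using exists_small_powr[of \<kappa> "L0 + e2 + e3"] \<kappa> c e by auto
  define A where "A = L0 + e2 + e3 + Cb"
  have A: "0 \<le> A" using c e by (simp add: A_def)
  define Q where "Q = (1 + 2 * A * \<tau> powr \<kappa>) ^ nat \<lceil>T / \<tau>\<rceil>"
  have "norm (u t) \<le> Q * (norm x + 1)"
    if g: "holder_bound (1 - \<beta>) B 0 T g" and sol: "is_solution T \<beta> f \<sigma> g x u" and t: "t \<in> {0..T}" for g u t
  proof -
    have g': "holder_bound \<kappa> B 0 T g" using g by (simp add: \<kappa>_def)
    obtain C where C: "holder_bound \<kappa> C 0 T u"
      using sol holder_on_imp_holder_bound[of "1 - \<beta>" T u] by (auto simp: is_solution_def \<kappa>_def)
    have \<sigma>c: "continuous_on {0..T} (\<lambda>r. \<sigma> r (u r))"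
      by (rule holder_bound_continuous[OF holder_bound_coefficient[OF lipx lipt c(1) \<kappa>(2) _ _ order_refl C] \<kappa>(3)]) auto
    have "norm (u t) + 1 \<le> Q * (norm (u 0) + 1)"
      unfolding Q_def
    proof (rule holder_gronwall_sup[OF \<kappa>(3) \<tau>(1) A _ C])
      fix s e w
      assume se: "0 \<le> s" "s \<le> e" "e \<le> T" "e - s \<le> \<tau>" and w: "holder_bound \<kappa> w s e u"
      have w0: "0 \<le> w" by (rule holder_bound_nonneg[OF w])
      define P where "P = \<tau> powr \<kappa>"
      define V where "V = norm (u s) + w * P"
      have V: "norm (u r) \<le> V" if "r \<in> {s..e}" for r
        unfolding V_def P_def using holder_bound_norm_le[OF w se(4) _ that] \<kappa> by simp
      show "holder_bound \<kappa> (A * (norm (u s) + 1) + w / 2) s e u"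
        unfolding holder_bound_def
      proof (intro conjI allI impI)
        show "0 \<le> A * (norm (u s) + 1) + w / 2" using A w0 by simp
        fix a b assume ab: "s \<le> a" "a \<le> b" "b \<le> e"
        have ab0: "0 \<le> a" "b \<le> T" using ab se by auto
        define p where "p = (b - a) powr \<kappa>"
        have p0: "0 \<le> p" by (simp add: p_def)
        have bap: "b - a \<le> p" unfolding p_def
          using le_powr_of_le[of "b - a" 1 \<kappa>] ab se \<tau> \<kappa> by simp
        have p2: "(b - a) powr (2 * \<kappa>) \<le> P * p"
          unfolding P_def p_def using ab se \<kappa> by (intro powr_double_le) auto
        have V0: "0 \<le> V" using w0 by (simp add: V_def P_def)
        obtain J where J: "\<And>i j. has_fwd_integral (\<lambda>r. \<sigma> r (u r) $ i $ j) (\<lambda>r. g r $ j) a b (J i j)"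
          and fi: "(\<lambda>r. f r (u r)) integrable_on {a..b}"
          and inc: "u b - u a = integral {a..b} (\<lambda>r. f r (u r)) + (\<chi> i. \<Sum>j\<in>UNIV. J i j)"
          by (rule is_solution_increment[OF \<kappa>(3) ab0(1) ab(2) ab0(2) sol \<sigma>c g']) (rule that)
        have hh: "holder_bound \<kappa> (M * (1 + w)) a b (\<lambda>r. \<sigma> r (u r))"
          using holder_bound_coefficient[OF lipx lipt c(1) \<kappa>(2) ab0, of 1 w u]
            holder_bound_subinterval[OF w ab(1,3)] ab se \<tau> by simp
        have "norm (\<chi> i. \<Sum>j\<in>UNIV. J i j)
          \<le> D * (norm (\<sigma> a (u a)) * B * p + Y * (M * (1 + w)) * B * (b - a) powr (2 * \<kappa>))"
          unfolding D_def Y_def p_def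
          by (rule matrix_young[OF \<kappa>(1,2) ab(2) J hh holder_bound_subinterval[OF g' ab0]])
        also have "\<dots> \<le> D * (K1 * (1 + V) * B * p + Y * (M * (1 + w)) * B * (P * p))"
        proof (intro mult_left_mono add_mono mult_right_mono p2)
          have "norm (\<sigma> a (u a)) \<le> K1 * (1 + norm (u a))" using ab0 ab by (intro gr) auto
          also have "\<dots> \<le> K1 * (1 + V)" using V[of a] ab c by (intro mult_left_mono) auto
          finally show "norm (\<sigma> a (u a)) \<le> K1 * (1 + V)" .
        qed (use D Y c w0 p0 in auto)
        finally have J1: "norm (\<chi> i. \<Sum>j\<in>UNIV. J i j)
          \<le> (e2 * (1 + V) + e3 * (1 + w) * P) * p" by (simp add: e2_def e3_def algebra_simps)
        have "norm (integral {a..b} (\<lambda>r. f r (u r))) \<le> L0 * V * (b - a) + Cb * (b - a) powr (1 - \<beta>)"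
          by (rule fb[OF ab0(1) ab(2) ab0(2) fi V]) (use ab in auto)
        also have "\<dots> \<le> L0 * V * p + Cb * p"
          using bap c V0 by (intro add_mono mult_left_mono) (auto simp: p_def \<kappa>_def)
        finally have "norm (u b - u a) \<le> (L0 * V + Cb + e2 * (1 + V) + e3 * (1 + w) * P) * p"
          using J1 norm_triangle_ineq[of "integral {a..b} (\<lambda>r. f r (u r))" "\<chi> i. \<Sum>j\<in>UNIV. J i j"]
          unfolding inc by (simp add: algebra_simps)
        also have "\<dots> \<le> ((L0 + e2 + e3 + Cb) * (norm (u s) + 1) + w / 2) * p"
          unfolding V_def
          by (intro mult_right_mono young_increment_bound) (use c e w0 \<tau> p0 in \<open>auto simp: P_def\<close>)
        finally show "norm (u b - u a) \<le> (A * (norm (u s) + 1) + w / 2) * (b - a) powr \<kappa>"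
          by (simp add: A_def p_def)
      qed
    qed (use t in auto)
    then show ?thesis using is_solution_initial[OF sol] T by simp
  qed
  then show ?thesis by blast
qed

text \<open>The analogue of \<open>young_increment_bound\<close> with the inhomogeneity
  \<open>N\<close> in place of 1.\<close>

lemma young_difference_bound:
  fixes e1 e3 e4 n w N P :: real
  assumes "0 \<le> e1" "0 \<le> e3" "0 \<le> e4" "0 \<le> n" "0 \<le> N" "0 \<le> w" "P * (e1 + e3) \<le> 1 / 2"
  shows "e1 * (n + w * P) + e3 * w * P + e4 * N \<le> (e1 + e4) * (n + N) + w / 2"
proof -
  have "w * (P * (e1 + e3)) \<le> w / 2" using mult_left_mono[OF assms(7,6)] by simp
  moreover have "0 \<le> e1 * N" "0 \<le> e4 * n" using assms by auto
  ultimately show ?thesis by (simp add: algebra_simps)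
qed

text \<open>\<open>K\<close> is fixed before \<open>g1\<close>, \<open>u1\<close> and
  \<open>N\<close>, and sees the first two only through \<open>B\<close> and \<open>R\<close>; the
  Hoelder constant \<open>W\<close> is that of the fixed solution \<open>u2\<close>. As both
  solutions start at \<open>x\<close>, the Gronwall bound is linear in \<open>N\<close>.\<close>

lemma solution_difference_bound:
  fixes f :: "real \<Rightarrow> real^'n \<Rightarrow> real^'n" and \<sigma> :: "real \<Rightarrow> real^'n \<Rightarrow> real^'m^'n"
    and u2 :: "real \<Rightarrow> real^'n" and g2 :: "real \<Rightarrow> real^'m"
  assumes \<beta>: "0 < \<beta>" "\<beta> < 1/2" and T: "0 < T"
    and diff: "\<And>t y. t \<in> {0..T} \<Longrightarrow> \<sigma> t differentiable (at y)"
    and lipx: "\<And>t x y. t \<in> {0..T} \<Longrightarrow> norm (\<sigma> t x - \<sigma> t y) \<le> M * norm (x - y)"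
    and lipt: "\<And>s t x. s \<in> {0..T} \<Longrightarrow> t \<in> {0..T} \<Longrightarrow> norm (\<sigma> t x - \<sigma> s x) \<le> M * \<bar>t - s\<bar>"
    and time: "\<And>s t x i. s \<in> {0..T} \<Longrightarrow> t \<in> {0..T} \<Longrightarrow>
      norm (partial_deriv i (\<sigma> t) x - partial_deriv i (\<sigma> s) x) \<le> M * \<bar>t - s\<bar>"
    and space: "\<And>t x y i. t \<in> {0..T} \<Longrightarrow> norm x \<le> 3 * R \<Longrightarrow> norm y \<le> 3 * R \<Longrightarrow>
      norm (partial_deriv i (\<sigma> t) x - partial_deriv i (\<sigma> t) y) \<le> M' * norm (x - y)"
    and gr: "\<And>t x. t \<in> {0..T} \<Longrightarrow> norm (\<sigma> t x) \<le> K1 * (1 + norm x)"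
    and fl: "\<And>t x y. t \<in> {0..T} \<Longrightarrow> norm x \<le> R \<Longrightarrow> norm y \<le> R \<Longrightarrow> norm (f t x - f t y) \<le> L * norm (x - y)"
    and c: "0 \<le> M" "0 \<le> M'" "0 \<le> K1" "0 \<le> L" "0 \<le> B"
    and sol2: "is_solution T \<beta> f \<sigma> g2 x u2" and g2: "holder_bound (1 - \<beta>) B2 0 T g2"
    and R2: "\<And>t. t \<in> {0..T} \<Longrightarrow> norm (u2 t) \<le> R"
  shows "\<exists>K\<ge>0. \<forall>g1 u1 N. holder_bound (1 - \<beta>) B 0 T g1 \<longrightarrow> is_solution T \<beta> f \<sigma> g1 x u1 \<longrightarrow>
    (\<forall>t\<in>{0..T}. norm (u1 t) \<le> R) \<longrightarrow> holder_bound (1 - \<beta>) N 0 T (\<lambda>t. g1 t - g2 t) \<longrightarrow>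
    (\<forall>t\<in>{0..T}. norm (u1 t - u2 t) \<le> K * N) \<and> holder_bound (1 - \<beta>) (K * N) 0 T (\<lambda>t. u1 t - u2 t)"
proof -
  define \<kappa> where "\<kappa> = 1 - \<beta>"
  have \<kappa>: "1/2 < \<kappa>" "\<kappa> \<le> 1" "0 < \<kappa>" using \<beta> by (auto simp: \<kappa>_def)
  define d where "d = real CARD('n)"
  define D where "D = real CARD('n) * real CARD('m)"
  have D: "0 \<le> D" "0 \<le> d" by (auto simp: D_def d_def)
  define Y where "Y = young_const \<kappa>"
  have Y: "0 \<le> Y" unfolding Y_def by (rule young_const_nonneg[OF \<kappa>(1)])
  have R: "0 \<le> R" using order_trans[OF norm_ge_zero R2[of 0]] T by simp
  obtain W where W: "holder_bound \<kappa> W 0 T u2"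
    using sol2 holder_on_imp_holder_bound[of "1 - \<beta>" T u2] by (auto simp: is_solution_def \<kappa>_def)
  have W0: "0 \<le> W" by (rule holder_bound_nonneg[OF W])
  have g2': "holder_bound \<kappa> B2 0 T g2" using g2 by (simp add: \<kappa>_def)
  have \<sigma>c2: "continuous_on {0..T} (\<lambda>r. \<sigma> r (u2 r))"
    by (rule holder_bound_continuous[OF holder_bound_coefficient[OF lipx lipt c(1) \<kappa>(2) _ _ order_refl W] \<kappa>(3)]) auto
  \<comment> \<open>\<open>e1\<close> collects the factors of the supremum of the difference
    \<open>z\<close> (drift, starting value of the coefficient difference, part of its Hoelder
    constant), \<open>e3\<close> that of the Hoelder constant \<open>w\<close> of \<open>z\<close>,
    and \<open>e4\<close> those of \<open>g1 - g2\<close>.\<close>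
  define e1 where "e1 = L + D * M * B + D * Y * d * (M + M' * W) * B"
  define e3 where "e3 = D * Y * M * B"
  define e4 where "e4 = D * (K1 * (1 + R) + Y * M * (1 + W))"
  have e: "0 \<le> e1" "0 \<le> e3" "0 \<le> e4" using D Y c R W0 by (auto simp: e1_def e3_def e4_def)
  obtain \<tau> where \<tau>: "0 < \<tau>" "\<tau> \<le> 1" "\<tau> powr \<kappa> \<le> 1" "\<tau> powr \<kappa> * (e1 + e3) \<le> 1 / 2"
    using exists_small_powr[of \<kappa> "e1 + e3"] \<kappa> e by auto
  define A where "A = e1 + e4"
  have A: "0 \<le> A" using e by (simp add: A_def)
  define Q where "Q = (1 + 2 * A * \<tau> powr \<kappa>) ^ nat \<lceil>T / \<tau>\<rceil>"
  have Q: "0 \<le> Q" using A by (simp add: Q_def)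
  \<comment> \<open>The three summands serve the supremum, increments over at most \<tau>, and
    longer ones.\<close>
  define K where "K = Q + 2 * A * Q + 2 * Q * \<tau> powr (- \<kappa>)"
  have "(\<forall>t\<in>{0..T}. norm (u1 t - u2 t) \<le> K * N) \<and> holder_bound \<kappa> (K * N) 0 T (\<lambda>t. u1 t - u2 t)"
    if g1: "holder_bound \<kappa> B 0 T g1" and sol1: "is_solution T \<beta> f \<sigma> g1 x u1"
      and R1: "\<forall>t\<in>{0..T}. norm (u1 t) \<le> R" and N: "holder_bound \<kappa> N 0 T (\<lambda>t. g1 t - g2 t)" for g1 u1 N
  proof -
    have N0: "0 \<le> N" by (rule holder_bound_nonneg[OF N])
    obtain C where C: "holder_bound \<kappa> C 0 T u1"
      using sol1 holder_on_imp_holder_bound[of "1 - \<beta>" T u1] by (auto simp: is_solution_def \<kappa>_def)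
    have \<sigma>c1: "continuous_on {0..T} (\<lambda>r. \<sigma> r (u1 r))"
      by (rule holder_bound_continuous[OF holder_bound_coefficient[OF lipx lipt c(1) \<kappa>(2) _ _ order_refl C] \<kappa>(3)]) auto
    define z where "z t = u1 t - u2 t" for t
    have zC: "holder_bound \<kappa> (C + W) 0 T z"
      unfolding z_def by (rule holder_bound_diff[OF C W])
    have z0: "z 0 = 0"
      using is_solution_initial[OF sol1] is_solution_initial[OF sol2] T by (simp add: z_def)
    have step: "holder_bound \<kappa> (A * (norm (z s) + N) + w / 2) s e z"
      if se: "0 \<le> s" "s \<le> e" "e \<le> T" "e - s \<le> \<tau>" and w: "holder_bound \<kappa> w s e z" for s e w
    proof -
      have w0: "0 \<le> w" by (rule holder_bound_nonneg[OF w])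
      define P where "P = \<tau> powr \<kappa>"
      have P: "0 \<le> P" "P \<le> 1" using \<tau> by (auto simp: P_def)
      define V where "V = norm (z s) + w * P"
      have V: "norm (z r) \<le> V" if "r \<in> {s..e}" for r
        unfolding V_def P_def using holder_bound_norm_le[OF w se(4) _ that] \<kappa> by simp
      have V0: "0 \<le> V" using P w0 by (simp add: V_def)
      show ?thesis
        unfolding holder_bound_def
      proof (intro conjI allI impI)
        show "0 \<le> A * (norm (z s) + N) + w / 2" using A w0 N0 by simp
        fix a b assume ab: "s \<le> a" "a \<le> b" "b \<le> e"
        have ab0: "0 \<le> a" "b \<le> T" using ab se by auto
        define p where "p = (b - a) powr \<kappa>"
        have p0: "0 \<le> p" by (simp add: p_def)
        have small: "y - x \<le> (y - x) powr \<kappa>" if "a \<le> x" "x \<le> y" "y \<le> b" for x y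
          using le_powr_of_le[of "y - x" 1 \<kappa>] that ab se \<tau> \<kappa> by simp
        have p2: "(b - a) powr (2 * \<kappa>) \<le> P * p"
          unfolding P_def p_def using ab se \<kappa> by (intro powr_double_le) auto
        obtain J1 where J1: "\<And>i j. has_fwd_integral (\<lambda>r. \<sigma> r (u1 r) $ i $ j) (\<lambda>r. g1 r $ j) a b (J1 i j)"
          and fi1: "(\<lambda>r. f r (u1 r)) integrable_on {a..b}"
          and inc1: "u1 b - u1 a = integral {a..b} (\<lambda>r. f r (u1 r)) + (\<chi> i. \<Sum>j\<in>UNIV. J1 i j)"
          by (rule is_solution_increment[OF \<kappa>(3) ab0(1) ab(2) ab0(2) sol1 \<sigma>c1 g1]) (rule that)
        obtain J2 where J2: "\<And>i j. has_fwd_integral (\<lambda>r. \<sigma> r (u2 r) $ i $ j) (\<lambda>r. g2 r $ j) a b (J2 i j)"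
          and fi2: "(\<lambda>r. f r (u2 r)) integrable_on {a..b}"
          and inc2: "u2 b - u2 a = integral {a..b} (\<lambda>r. f r (u2 r)) + (\<chi> i. \<Sum>j\<in>UNIV. J2 i j)"
          by (rule is_solution_increment[OF \<kappa>(3) ab0(1) ab(2) ab0(2) sol2 \<sigma>c2 g2']) (rule that)
        let ?J1 = "\<chi> i. \<Sum>j\<in>UNIV. J1 i j" and ?J2 = "\<chi> i. \<Sum>j\<in>UNIV. J2 i j"
        let ?F1 = "integral {a..b} (\<lambda>r. f r (u1 r))" and ?F2 = "integral {a..b} (\<lambda>r. f r (u2 r))"
        \<comment> \<open>From \<open>sigma_four_point\<close>: \<open>M * w\<close> comes from the
          increment of \<open>z\<close>, the rest from the size of \<open>z\<close> itself.\<close>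
        define Dh where "Dh = M * w + d * V * (M + M' * W)"
        have Dh0: "0 \<le> Dh" using c w0 D V0 W0 by (simp add: Dh_def)
        have dh: "holder_bound \<kappa> Dh a b (\<lambda>r. \<sigma> r (u1 r) - \<sigma> r (u2 r))"
          unfolding holder_bound_def
        proof (intro conjI allI impI Dh0)
          fix x y assume xy: "a \<le> x" "x \<le> y" "y \<le> b"
          have t: "x \<in> {0..T}" "y \<in> {0..T}" using xy ab0 by auto
          have "norm ((\<sigma> y (u1 y) - \<sigma> y (u2 y)) - (\<sigma> x (u1 x) - \<sigma> x (u2 x)))
            \<le> M * norm ((u1 y - u2 y) - (u1 x - u2 x)) + real CARD('n) * norm (u1 x - u2 x) * (M * \<bar>y - x\<bar> + M' * norm (u2 y - u2 x))"
            by (rule sigma_four_point[OF diff lipx time space t]) (use R1 R2 t in auto)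
          also have "\<dots> \<le> M * (w * (y - x) powr \<kappa>) + d * V * (M * (y - x) powr \<kappa> + M' * (W * (y - x) powr \<kappa>))"
          proof (intro add_mono mult_mono mult_left_mono)
            show "norm ((u1 y - u2 y) - (u1 x - u2 x)) \<le> w * (y - x) powr \<kappa>"
              using holder_boundD[OF w, of x y] xy ab by (simp add: z_def)
            show "norm (u1 x - u2 x) \<le> V" using V[of x] xy ab by (simp add: z_def)
            show "\<bar>y - x\<bar> \<le> (y - x) powr \<kappa>" using small[OF xy] xy by simp
            show "norm (u2 y - u2 x) \<le> W * (y - x) powr \<kappa>"
              using xy t by (intro holder_boundD[OF W]) auto
          qed (use c D V0 in \<open>auto simp: d_def\<close>)
          finally show "norm ((\<sigma> y (u1 y) - \<sigma> y (u2 y)) - (\<sigma> x (u1 x) - \<sigma> x (u2 x))) \<le> Dh * (y - x) powr \<kappa>"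
            by (simp add: Dh_def algebra_simps)
        qed
        have hh: "holder_bound \<kappa> (M * (1 + W)) a b (\<lambda>r. \<sigma> r (u2 r))"
          using holder_bound_coefficient[OF lipx lipt c(1) \<kappa>(2) ab0, of 1 W u2]
            holder_bound_subinterval[OF W ab0] ab se \<tau> by simp
        have at: "a \<in> {0..T}" using ab0 ab by auto
        have "norm (?J1 - ?J2)
          \<le> D * (norm (\<sigma> a (u1 a) - \<sigma> a (u2 a)) * B * p + Y * Dh * B * (b - a) powr (2 * \<kappa>)
             + (norm (\<sigma> a (u2 a)) * N * p + Y * (M * (1 + W)) * N * (b - a) powr (2 * \<kappa>)))"
          unfolding D_def Y_def p_def
          by (rule matrix_young_diff[OF \<kappa>(1,2) ab(2) J1 J2 dh hh
                holder_bound_subinterval[OF N ab0] holder_bound_subinterval[OF g1 ab0]])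
        \<comment> \<open>Terms with \<open>N\<close> go into the inhomogeneity, so
          \<open>P \<le> 1\<close> suffices there; in the term with \<open>Dh\<close> the factor
          \<open>P\<close> is kept to absorb \<open>w\<close>.\<close>
        also have "\<dots> \<le> D * ((M * V) * B * p + Y * Dh * B * (P * p)
             + ((K1 * (1 + R)) * N * p + Y * (M * (1 + W)) * N * (1 * p)))"
        proof (intro mult_left_mono add_mono mult_right_mono p2)
          have "norm (\<sigma> a (u1 a) - \<sigma> a (u2 a)) \<le> M * norm (u1 a - u2 a)" by (rule lipx[OF at])
          also have "\<dots> \<le> M * V" using V[of a] ab c by (intro mult_left_mono) (auto simp: z_def)
          finally show "norm (\<sigma> a (u1 a) - \<sigma> a (u2 a)) \<le> M * V" .
          have "norm (\<sigma> a (u2 a)) \<le> K1 * (1 + norm (u2 a))" by (rule gr[OF at])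
          also have "\<dots> \<le> K1 * (1 + R)" using R2[OF at] c by (intro mult_left_mono) auto
          finally show "norm (\<sigma> a (u2 a)) \<le> K1 * (1 + R)" .
          show "(b - a) powr (2 * \<kappa>) \<le> 1 * p" using p2 mult_right_mono[OF P(2) p0] by simp
        qed (use D Y c w0 p0 N0 W0 Dh0 in auto)
        also have "\<dots> = ((D * M * B + D * Y * d * (M + M' * W) * B * P) * V + e3 * w * P + e4 * N) * p"
          by (simp add: e3_def e4_def Dh_def algebra_simps)
        \<comment> \<open>Here \<open>P\<close> may be dropped, because
          \<open>V = norm (z s) + w * P\<close> already carries \<open>w\<close> with a factor
          \<open>P\<close>.\<close>
        also have "\<dots> \<le> ((D * M * B + D * Y * d * (M + M' * W) * B) * V + e3 * w * P + e4 * N) * p"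
          using D Y c W0 V0 p0 P w0 N0 by (intro mult_right_mono add_mono) (auto intro!: mult_left_le)
        finally have Jd: "norm (?J1 - ?J2)
          \<le> ((D * M * B + D * Y * d * (M + M' * W) * B) * V + e3 * w * P + e4 * N) * p" .
        have "norm (integral {a..b} (\<lambda>r. f r (u1 r) - f r (u2 r))) \<le> integral {a..b} (\<lambda>r. L * V)"
        proof (rule Henstock_Kurzweil_Integration.integral_norm_bound_integral)
          show "(\<lambda>r. f r (u1 r) - f r (u2 r)) integrable_on {a..b}"
            by (intro Henstock_Kurzweil_Integration.integrable_diff fi1 fi2)
          fix r assume r: "r \<in> {a..b}"
          then have rT: "r \<in> {0..T}" using ab0 by auto
          have "norm (f r (u1 r) - f r (u2 r)) \<le> L * norm (u1 r - u2 r)"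
            using R1 R2 rT by (intro fl) auto
          also have "\<dots> \<le> L * V" using V[of r] r ab c by (intro mult_left_mono) (auto simp: z_def)
          finally show "norm (f r (u1 r) - f r (u2 r)) \<le> L * V" .
        qed (rule integrable_const_ivl)
        also have "\<dots> = L * V * (b - a)" using ab by simp
        also have "\<dots> \<le> L * V * p" unfolding p_def
          using small[of a b] ab c V0 by (intro mult_left_mono) auto
        finally have fd: "norm (?F1 - ?F2) \<le> L * V * p"
          using hk_diff[OF fi1 fi2] by simp
        have "z b - z a = (?F1 - ?F2)
          + (?J1 - ?J2)"
        proof -
          have "z b - z a = (u1 b - u1 a) - (u2 b - u2 a)" by (simp add: z_def)
          then show ?thesis unfolding inc1 inc2 by simp
        qed
        then have "norm (z b - z a) \<le> L * V * p + ((D * M * B + D * Y * d * (M + M' * W) * B) * V + e3 * w * P + e4 * N) * p"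
          using norm_triangle_mono[OF fd Jd] by (simp only:)
        also have "\<dots> = (e1 * (norm (z s) + w * P) + e3 * w * P + e4 * N) * p"
          by (simp add: e1_def V_def algebra_simps)
        also have "\<dots> \<le> ((e1 + e4) * (norm (z s) + N) + w / 2) * p"
          by (intro mult_right_mono young_difference_bound) (use e w0 N0 \<tau> p0 in \<open>auto simp: P_def\<close>)
        finally show "norm (z b - z a) \<le> (A * (norm (z s) + N) + w / 2) * (b - a) powr \<kappa>"
          by (simp add: A_def p_def)
      qed
    qed
    have sup: "norm (z t) \<le> Q * N" if t: "0 \<le> t" "t \<le> T" for t
    proof -
      have "norm (z t) + N \<le> Q * (norm (z 0) + N)"
        unfolding Q_def by (rule holder_gronwall_sup[OF \<kappa>(3) \<tau>(1) A N0 zC]) (rule step t; assumption)+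
      then show ?thesis using N0 unfolding z0 by simp
    qed
    have loc: "norm (z t - z s) \<le> 2 * A * Q * N * (t - s) powr \<kappa>"
      if st: "0 \<le> s" "s \<le> t" "t \<le> T" "t - s \<le> \<tau>" for s t
    proof -
      have "norm (z t - z s) \<le> 2 * A * Q * (norm (z 0) + N) * (t - s) powr \<kappa>"
        unfolding Q_def by (rule holder_gronwall_local[OF \<kappa>(3) \<tau>(1) A N0 zC]) (rule step st; assumption)+
      then show ?thesis unfolding z0 by simp
    qed
    have hb: "holder_bound \<kappa> (2 * A * Q * N + 2 * (Q * N) * \<tau> powr (- \<kappa>)) 0 T z"
      by (rule holder_bound_of_local[OF \<kappa>(3) \<tau>(1) _ _ sup loc]) (use A Q N0 in auto)
    have "K * N = Q * N + (2 * A * Q * N + 2 * (Q * N) * \<tau> powr (- \<kappa>))"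
      by (simp add: K_def algebra_simps)
    moreover have "0 \<le> Q * N" "0 \<le> 2 * A * Q * N + 2 * (Q * N) * \<tau> powr (- \<kappa>)"
      using A Q N0 by auto
    ultimately have le: "2 * A * Q * N + 2 * (Q * N) * \<tau> powr (- \<kappa>) \<le> K * N" "Q * N \<le> K * N" "0 \<le> K * N"
      by linarith+
    have "holder_bound \<kappa> (K * N) 0 T z"
      unfolding holder_bound_def
    proof (intro conjI allI impI)
      show "0 \<le> K * N" by (rule le(3))
      fix x y :: real assume "0 \<le> x" "x \<le> y" "y \<le> T"
      then show "norm (z y - z x) \<le> K * N * (y - x) powr \<kappa>"
        using holder_boundD[OF hb, of x y] mult_right_mono[OF le(1), of "(y - x) powr \<kappa>"] by simp
    qed
    moreover have "norm (z t) \<le> K * N" if "t \<in> {0..T}" for t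
      using sup[of t] le(2) that by auto
    ultimately show ?thesis unfolding z_def by blast
  qed
  moreover have "0 \<le> K" using A Q by (simp add: K_def)
  ultimately show ?thesis unfolding \<kappa>_def by (intro exI[of _ K] conjI allI impI) simp_all
qed

section \<open>The two norms and Hoelder constants\<close>

text \<open>The supremum in \<open>norm_one\<close> runs over \<open>0 < s < t < T\<close>;
  continuity, drawn from the given Hoelder bound, extends the estimate to the closed
  interval.\<close>

lemma norm_one_le_imp_holder_bound:
  fixes g :: "real \<Rightarrow> 'a::euclidean_space"
  assumes g: "holder_bound \<alpha> C 0 T g" "0 < \<alpha>" and N: "norm_one T \<beta> g \<le> ennreal N" "0 \<le> N"
  shows "holder_bound (1 - \<beta>) N 0 T g"
  unfolding holder_bound_def
proof (intro conjI allI impI N(2))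
  have inner: "norm (g t - g s) \<le> N * (t - s) powr (1 - \<beta>)" if "0 < s" "s < t" "t < T" for s t
  proof -
    have "ennreal (norm (g t - g s) / (t - s) powr (1 - \<beta>)) \<le> norm_one T \<beta> g"
      unfolding norm_one_def using that by (intro SUP_upper2[of "(s, t)"]) auto
    also note N(1)
    finally have "norm (g t - g s) / (t - s) powr (1 - \<beta>) \<le> N"
      using N(2) by (simp add: ennreal_le_iff)
    then show ?thesis using that by (simp add: pos_divide_le_eq)
  qed
  have gc: "continuous_on {0..T} g" by (rule holder_bound_continuous[OF g])
  fix x y :: real assume xy: "0 \<le> x" "x \<le> y" "y \<le> T"
  show "norm (g y - g x) \<le> N * (y - x) powr (1 - \<beta>)"
  proof (cases "x = y")
    case False
    \<comment> \<open>With 3 in the denominator \<open>2 * d n < y - x\<close>, so the two points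
      move inwards without meeting.\<close>
    define d where "d n = (y - x) / (real n + 3)" for n
    have d: "0 < d n" "d n \<le> (y - x) / 3" for n
      using False xy frac_le[of "y - x" "y - x" 3 "real n + 3"] by (auto simp: d_def)
    have d0: "d \<longlonglongrightarrow> 0" unfolding d_def
      using LIMSEQ_ignore_initial_segment[OF lim_const_over_n[of "y - x"], of 3] by simp
    have lx: "(\<lambda>n. x + d n) \<longlonglongrightarrow> x" "(\<lambda>n. y - d n) \<longlonglongrightarrow> y"
      using tendsto_add[OF tendsto_const d0, of x] tendsto_diff[OF tendsto_const d0, of y] by auto
    have in1: "0 < x + d n" "x + d n < y - d n" "y - d n < T" for n
      using d[of n] xy False by auto
    have gx: "(\<lambda>n. g (x + d n)) \<longlonglongrightarrow> g x" "(\<lambda>n. g (y - d n)) \<longlonglongrightarrow> g y"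
    proof -
      have "x + d n \<in> {0..T}" "y - d n \<in> {0..T}" for n
        using in1[of n] by (auto simp: less_imp_le)
      then show "(\<lambda>n. g (x + d n)) \<longlonglongrightarrow> g x" "(\<lambda>n. g (y - d n)) \<longlonglongrightarrow> g y"
        using xy by (auto intro!: continuous_on_tendsto_compose[OF gc lx(1)] continuous_on_tendsto_compose[OF gc lx(2)])
    qed
    show ?thesis
    proof (rule LIMSEQ_le)
      show "(\<lambda>n. norm (g (y - d n) - g (x + d n))) \<longlonglongrightarrow> norm (g y - g x)"
        by (intro tendsto_intros gx)
      show "(\<lambda>n. N * ((y - d n) - (x + d n)) powr (1 - \<beta>)) \<longlonglongrightarrow> N * (y - x) powr (1 - \<beta>)"
        using False by (intro tendsto_intros lx) auto
      show "\<exists>n0. \<forall>n\<ge>n0. norm (g (y - d n) - g (x + d n)) \<le> N * ((y - d n) - (x + d n)) powr (1 - \<beta>)"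
        using inner[OF in1] by blast
    qed
  qed simp
qed

lemma holder_bound_lower_exponent:
  assumes "holder_bound \<alpha> C 0 T g" "\<kappa> \<le> \<alpha>"
  shows "holder_bound \<kappa> (C * T powr (\<alpha> - \<kappa>)) 0 T g"
  unfolding holder_bound_def
proof (intro conjI allI impI)
  have C: "0 \<le> C" by (rule holder_bound_nonneg[OF assms(1)])
  then show "0 \<le> C * T powr (\<alpha> - \<kappa>)" by simp
  fix x y :: real assume xy: "0 \<le> x" "x \<le> y" "y \<le> T"
  have "norm (g y - g x) \<le> C * (y - x) powr \<alpha>" by (rule holder_boundD[OF assms(1) xy])
  also have "(y - x) powr \<alpha> = (y - x) powr (\<alpha> - \<kappa>) * (y - x) powr \<kappa>" by (simp add: powr_add[symmetric])
  also have "C * \<dots> \<le> C * (T powr (\<alpha> - \<kappa>) * (y - x) powr \<kappa>)"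
    using xy C assms(2) by (intro mult_left_mono mult_right_mono powr_mono2) auto
  finally show "norm (g y - g x) \<le> C * T powr (\<alpha> - \<kappa>) * (y - x) powr \<kappa>" by (simp add: mult.assoc)
qed

text \<open>The reflection \<open>s = t - x\<close> moves the singularity to 0.\<close>

lemma nn_integral_powr_left:
  fixes a t :: real
  assumes "a > -1" "0 \<le> t" "0 \<le> W"
  shows "(\<integral>\<^sup>+s\<in>{0..t}. ennreal (W * (t - s) powr a) \<partial>lborel) = ennreal (W * (t powr (a + 1) / (a + 1)))"
proof -
  have "((\<lambda>x. W * x powr a) has_integral W * (t powr (a + 1) / (a + 1))) {0..t}"
    by (intro has_integral_mult_right has_integral_powr_from_0 assms)
  then have "(\<integral>\<^sup>+x\<in>{0..t}. ennreal (W * x powr a) \<partial>lborel) = ennreal (W * (t powr (a + 1) / (a + 1)))"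
    using assms by (intro nn_integral_has_integral_lebesgue') auto
  moreover have "(\<integral>\<^sup>+s\<in>{0..t}. ennreal (W * (t - s) powr a) \<partial>lborel)
      = (\<integral>\<^sup>+x. ennreal (W * (t - (t + (-1) * x)) powr a) * indicator {0..t} (t + (-1) * x) \<partial>lborel)"
    by (subst nn_integral_real_affine[of _ "-1" t]) auto
  moreover have "\<dots> = (\<integral>\<^sup>+x\<in>{0..t}. ennreal (W * x powr a) \<partial>lborel)"
    by (intro nn_integral_cong) (auto simp: indicator_def)
  ultimately show ?thesis by simp
qed

text \<open>The integrand is at most \<open>W\<close> times the distance to the power
  \<open>(1 - \<beta>) - (\<beta> + 1) = - 2 * \<beta>\<close>, which lies above -1.\<close>

lemma norm_beta_inf_le:
  fixes z :: "real \<Rightarrow> 'a::euclidean_space"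
  assumes \<beta>: "0 < \<beta>" "\<beta> < 1/2" and z: "holder_bound (1 - \<beta>) W 0 T z"
    and V: "\<And>t. t \<in> {0..T} \<Longrightarrow> norm (z t) \<le> V" "0 \<le> V"
  shows "norm_beta_inf T \<beta> z \<le> ennreal (V + W * (T powr (1 - 2 * \<beta>) / (1 - 2 * \<beta>)))"
  unfolding norm_beta_inf_def
proof (rule SUP_least)
  fix t assume t: "t \<in> {0..T}"
  let ?I = "\<integral>\<^sup>+ s \<in> {0..t}. ennreal (norm (z t - z s) / \<bar>t - s\<bar> powr (\<beta> + 1)) \<partial>lebesgue" and ?c = "T powr (1 - 2 * \<beta>) / (1 - 2 * \<beta>)"
  have W: "0 \<le> W" by (rule holder_bound_nonneg[OF z])
  have "?I
    \<le> (\<integral>\<^sup>+ s \<in> {0..t}. ennreal (W * (t - s) powr (- 2 * \<beta>)) \<partial>lebesgue)"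
  proof (rule nn_integral_mono)
    fix s
    show "ennreal (norm (z t - z s) / \<bar>t - s\<bar> powr (\<beta> + 1)) * indicator {0..t} s
      \<le> ennreal (W * (t - s) powr (- 2 * \<beta>)) * indicator {0..t} s"
    proof (cases "0 \<le> s \<and> s < t")
      case True
      have "norm (z t - z s) / \<bar>t - s\<bar> powr (\<beta> + 1) \<le> W * (t - s) powr (1 - \<beta>) / (t - s) powr (\<beta> + 1)"
        using holder_boundD[OF z, of s t] True t by (auto intro!: divide_right_mono)
      also have "\<dots> = W * ((t - s) powr (1 - \<beta>) / (t - s) powr (\<beta> + 1))" by simp
      also have "(t - s) powr (1 - \<beta>) / (t - s) powr (\<beta> + 1) = (t - s) powr (- 2 * \<beta>)"
        by (simp add: powr_diff[symmetric])
      finally show ?thesis using True by (simp add: ennreal_leI)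
    qed (auto simp: indicator_def)
  qed
  also have "\<dots> = (\<integral>\<^sup>+ s \<in> {0..t}. ennreal (W * (t - s) powr (- 2 * \<beta>)) \<partial>lborel)"
    by (rule nn_integral_completion)
  also have "\<dots> = ennreal (W * (t powr (1 - 2 * \<beta>) / (1 - 2 * \<beta>)))"
    using nn_integral_powr_left[of "- 2 * \<beta>" t W] t W \<beta> by (simp add: add.commute)
  also have "\<dots> \<le> ennreal (W * (?c))"
    using t W \<beta> by (intro ennreal_leI mult_left_mono divide_right_mono powr_mono2) auto
  finally have "ennreal (norm (z t)) + ?I
    \<le> ennreal V + ennreal (W * (?c))"
    using V(1)[OF t] by (intro add_mono ennreal_leI)
  also have "\<dots> = ennreal (V + W * (?c))"
    using V W \<beta> by (intro ennreal_plus[symmetric]) auto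
  finally show "ennreal (norm (z t)) + ?I
    \<le> ennreal (V + W * (?c))" .
qed

lemma sigma_linear_growth:
  assumes "sigma_growth T \<sigma>"
  obtains K1 where "0 \<le> K1" "\<And>t x. t \<in> {0..T} \<Longrightarrow> norm (\<sigma> t x) \<le> K1 * (1 + norm x)"
proof -
  obtain K0 \<zeta> where K0: "0 < K0" "\<zeta> \<in> {0..1}"
    "\<And>x t. t \<in> {0..T} \<Longrightarrow> norm (\<sigma> t x) \<le> K0 * (1 + norm x powr \<zeta>)"
    using assms unfolding sigma_growth_def by blast
  have p: "y powr \<zeta> \<le> 1 + y" if "0 \<le> y" for y :: real
  proof (cases "y \<le> 1")
    case True
    then have "y powr \<zeta> \<le> 1" using that K0(2) by (intro powr_le1) auto
    then show ?thesis using that by simp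
  next
    case False
    then have "y powr \<zeta> \<le> y powr 1" using K0(2) by (intro powr_mono) auto
    then show ?thesis using False by simp
  qed
  have "norm (\<sigma> t x) \<le> 2 * K0 * (1 + norm x)" if "t \<in> {0..T}" for t x
  proof -
    have "norm (\<sigma> t x) \<le> K0 * (1 + norm x powr \<zeta>)" by (rule K0(3)[OF that])
    also have "\<dots> \<le> K0 * (2 + 2 * norm x)"
      using p[of "norm x"] K0(1) by (intro mult_left_mono) (auto intro: order_trans)
    finally show ?thesis by (simp add: algebra_simps)
  qed
  then show thesis using that[of "2 * K0"] K0(1) by simp
qed

theorem theorem4p1:
  fixes T \<alpha> \<beta> \<rho> :: real
    and f :: "real \<Rightarrow> real^'n \<Rightarrow> real^'n"
    and \<sigma> :: "real \<Rightarrow> real^'n \<Rightarrow> real^'m^'n"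
    and \<omega> :: "real \<Rightarrow> real^'m"
    and x :: "real^'n"
    and D :: "'d set"
    and G :: "'d \<Rightarrow> real \<Rightarrow> real^'m"
    and u :: "real \<Rightarrow> real^'n"
    and u\<^sub>\<delta> :: "'d \<Rightarrow> real \<Rightarrow> real^'n"
  assumes "T > 0"
    and "\<alpha> > 1/2"
    and "holder_on \<alpha> {0..T} \<omega>"
    and "case_prod f \<in> borel_measurable (lebesgue_on ({0..T} \<times> UNIV))"
    and "case_prod \<sigma> \<in> borel_measurable (lebesgue_on ({0..T} \<times> UNIV))"
    and "\<And>t y. t \<in> {0..T} \<Longrightarrow> \<sigma> t differentiable (at y)"
    and "sigma_global_lipschitz T \<sigma>"
    and "sigma_deriv_local_lipschitz T \<sigma>"
    and "sigma_growth T \<sigma>"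
    and "f_local_lipschitz T f"
    and "\<rho> > 2"
    and "f_growth T \<rho> f"
    and "0 < \<beta>" and "1 - \<alpha> < \<beta>" and "\<beta> < 1/2"
    and "\<rho> \<ge> 1 / \<beta>"
    and "\<And>\<delta>. \<delta> \<in> D \<Longrightarrow> holder_on \<alpha> {0..T} (G \<delta>)"
    and "is_solution T \<beta> f \<sigma> \<omega> x u"
    and "\<And>\<delta>. \<delta> \<in> D \<Longrightarrow> is_solution T \<beta> f \<sigma> (G \<delta>) x (u\<^sub>\<delta> \<delta>)"
    and "(SUP \<delta>\<in>D. norm_one T \<beta> (G \<delta>)) < \<infinity>"
  shows "(\<exists>K::real. 0 \<le> K \<and>
            (\<forall>\<delta>\<in>D. norm_beta_inf T \<beta> (\<lambda>t. u\<^sub>\<delta> \<delta> t - u t)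
                     \<le> ennreal K * norm_one T \<beta> (\<lambda>t. G \<delta> t - \<omega> t)))
       \<and> (\<forall>F. F \<le> principal D \<longrightarrow>
            ((\<lambda>\<delta>. norm_one T \<beta> (\<lambda>t. G \<delta> t - \<omega> t)) \<longlongrightarrow> 0) F \<longrightarrow>
            ((\<lambda>\<delta>. norm_beta_inf T \<beta> (\<lambda>t. u\<^sub>\<delta> \<delta> t - u t)) \<longlongrightarrow> 0) F)"
proof -
  note asm = assms
  note T = asm(1) and \<beta> = asm(13) asm(15)
  have a0: "0 < \<alpha>" and \<kappa>\<alpha>: "1 - \<beta> \<le> \<alpha>" using asm(2,14) by auto
  obtain M where M: "0 < M"
    and Mall: "\<And>x y s t i. s \<in> {0..T} \<Longrightarrow> t \<in> {0..T} \<Longrightarrow> norm (\<sigma> t x - \<sigma> t y) \<le> M * norm (x - y) \<and>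
        norm (\<sigma> t x - \<sigma> s x) + norm (partial_deriv i (\<sigma> t) x - partial_deriv i (\<sigma> s) x) \<le> M * \<bar>t - s\<bar>"
    using asm(7) unfolding sigma_global_lipschitz_def by blast
  have lipx: "norm (\<sigma> t x - \<sigma> t y) \<le> M * norm (x - y)" if "t \<in> {0..T}" for t x y
    using Mall[OF that that] by blast
  have lipt: "norm (\<sigma> t x - \<sigma> s x) \<le> M * \<bar>t - s\<bar>" if "s \<in> {0..T}" "t \<in> {0..T}" for s t x
    using Mall[OF that, of x x undefined] norm_ge_zero[of "partial_deriv undefined (\<sigma> t) x - partial_deriv undefined (\<sigma> s) x"] by linarith
  have time: "norm (partial_deriv i (\<sigma> t) x - partial_deriv i (\<sigma> s) x) \<le> M * \<bar>t - s\<bar>"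
    if "s \<in> {0..T}" "t \<in> {0..T}" for s t x i
    using Mall[OF that, of x x i] norm_ge_zero[of "\<sigma> t x - \<sigma> s x"] by linarith
  obtain K1 where K1: "0 \<le> K1" and gr: "\<And>t x. t \<in> {0..T} \<Longrightarrow> norm (\<sigma> t x) \<le> K1 * (1 + norm x)"
    using sigma_linear_growth[OF asm(9)] by blast
  obtain L0 b0 where L0: "0 < L0" and b0: "lp_fun (ennreal \<rho>) 0 T b0"
    and fg: "\<And>x t. t \<in> {0..T} \<Longrightarrow> norm (f t x) \<le> L0 * norm x + b0 t"
    using asm(12) unfolding f_growth_def by blast
  obtain Cb where Cb: "0 \<le> Cb"
    and Cb': "\<And>s t L (F :: real \<Rightarrow> real^'n). 0 \<le> s \<Longrightarrow> s \<le> t \<Longrightarrow> t \<le> T \<Longrightarrow> F integrable_on {s..t} \<Longrightarrow>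
      (\<And>r. r \<in> {s..t} \<Longrightarrow> norm (F r) \<le> L + b0 r) \<Longrightarrow>
      norm (integral {s..t} F) \<le> L * (t - s) + Cb * (t - s) powr (1 - \<beta>)"
    using lp_fun_integral_bound[OF b0 T _ \<beta>(1) asm(16), where ?'a = "real^'n"] asm(11) by auto
  have fb: "norm (integral {s..t} (\<lambda>r. f r (v r))) \<le> L0 * V * (t - s) + Cb * (t - s) powr (1 - \<beta>)"
    if "0 \<le> s" "s \<le> t" "t \<le> T" "(\<lambda>r. f r (v r)) integrable_on {s..t}" and V: "\<And>r. r \<in> {s..t} \<Longrightarrow> norm (v r) \<le> V"
    for s t V v
  proof (rule Cb'[OF that(1-4)])
    fix r assume r: "r \<in> {s..t}"
    have "norm (f r (v r)) \<le> L0 * norm (v r) + b0 r" using r that by (intro fg) auto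
    also have "\<dots> \<le> L0 * V + b0 r" using V[OF r] L0 by simp
    finally show "norm (f r (v r)) \<le> L0 * V + b0 r" .
  qed
  define B where "B = enn2real (SUP \<delta>\<in>D. norm_one T \<beta> (G \<delta>))"
  have B: "0 \<le> B" by (simp add: B_def)
  have GB: "holder_bound (1 - \<beta>) B 0 T (G \<delta>)" if \<delta>: "\<delta> \<in> D" for \<delta>
  proof -
    obtain C where C: "holder_bound \<alpha> C 0 T (G \<delta>)" using holder_on_imp_holder_bound[OF asm(17)[OF \<delta>]] by blast
    have "norm_one T \<beta> (G \<delta>) \<le> (SUP \<delta>\<in>D. norm_one T \<beta> (G \<delta>))" using \<delta> by (rule SUP_upper)
    also have "\<dots> = ennreal B" unfolding B_def using asm(20) by simp
    finally show ?thesis by (rule norm_one_le_imp_holder_bound[OF C a0 _ B])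
  qed
  obtain C\<omega> where C\<omega>: "holder_bound \<alpha> C\<omega> 0 T \<omega>" using holder_on_imp_holder_bound[OF asm(3)] by blast
  have \<omega>B: "holder_bound (1 - \<beta>) (C\<omega> * T powr (\<alpha> - (1 - \<beta>))) 0 T \<omega>"
    by (rule holder_bound_lower_exponent[OF C\<omega> \<kappa>\<alpha>])
  have "\<exists>R. \<forall>g u. holder_bound (1 - \<beta>) B 0 T g \<longrightarrow> is_solution T \<beta> f \<sigma> g x u \<longrightarrow> (\<forall>t\<in>{0..T}. norm (u t) \<le> R)"
    by (rule solution_uniform_bound[OF \<beta> T lipx lipt gr fb]) (use M K1 L0 Cb B in auto)
  then obtain R1 where R1: "\<And>g u t. holder_bound (1 - \<beta>) B 0 T g \<Longrightarrow> is_solution T \<beta> f \<sigma> g x u \<Longrightarrow> t \<in> {0..T} \<Longrightarrow> norm (u t) \<le> R1"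
    by blast
  \<comment> \<open>The driver \<omega> need not satisfy the bound \<open>B\<close>, so
    \<open>R1\<close> does not cover \<open>u\<close>; being a single continuous function on a
    compact interval, it is bounded.\<close>
  obtain R2 where R2: "\<And>t. t \<in> {0..T} \<Longrightarrow> norm (u t) \<le> R2"
  proof -
    obtain C where "holder_bound (1 - \<beta>) C 0 T u"
      using asm(18) holder_on_imp_holder_bound unfolding is_solution_def by blast
    then have "continuous_on {0..T} u" by (rule holder_bound_continuous) (use \<beta> in auto)
    then have "bounded (u ` {0..T})" by (intro compact_imp_bounded compact_continuous_image) auto
    then show thesis using that unfolding bounded_iff by blast
  qed
  \<comment> \<open>The 1 ensures the positive radius that the local conditions ask for; they are
    applied at \<open>3 * R\<close> to the derivatives of \<sigma> and at \<open>R\<close> to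
    \<open>f\<close>.\<close>
  define R where "R = max 1 (max R1 R2)"
  have R: "0 < R" "R1 \<le> R" "R2 \<le> R" by (auto simp: R_def)
  obtain M' where M': "0 < M'" and space: "\<And>t x y i. t \<in> {0..T} \<Longrightarrow> norm x \<le> 3 * R \<Longrightarrow> norm y \<le> 3 * R \<Longrightarrow>
      norm (partial_deriv i (\<sigma> t) x - partial_deriv i (\<sigma> t) y) \<le> M' * norm (x - y)"
    using asm(8) R(1) unfolding sigma_deriv_local_lipschitz_def by (metis mult_pos_pos zero_less_numeral)
  obtain L where L: "0 < L" and fl: "\<And>t x y. t \<in> {0..T} \<Longrightarrow> norm x \<le> R \<Longrightarrow> norm y \<le> R \<Longrightarrow>
      norm (f t x - f t y) \<le> L * norm (x - y)"
    using asm(10) R(1) unfolding f_local_lipschitz_def by metis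
  have u2R: "norm (u t) \<le> R" if "t \<in> {0..T}" for t using R2[OF that] R(3) by linarith
  have "\<exists>K\<ge>0. \<forall>g1 u1 N. holder_bound (1 - \<beta>) B 0 T g1 \<longrightarrow> is_solution T \<beta> f \<sigma> g1 x u1 \<longrightarrow>
    (\<forall>t\<in>{0..T}. norm (u1 t) \<le> R) \<longrightarrow> holder_bound (1 - \<beta>) N 0 T (\<lambda>t. g1 t - \<omega> t) \<longrightarrow>
    (\<forall>t\<in>{0..T}. norm (u1 t - u t) \<le> K * N) \<and> holder_bound (1 - \<beta>) (K * N) 0 T (\<lambda>t. u1 t - u t)"
    by (rule solution_difference_bound[OF \<beta> T asm(6) lipx lipt time space gr fl _ _ _ _ _ asm(18) \<omega>B u2R])
       (use M M' K1 L B in auto)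
  then obtain K where K: "0 \<le> K" and Kall: "\<And>g1 u1 N. holder_bound (1 - \<beta>) B 0 T g1 \<Longrightarrow> is_solution T \<beta> f \<sigma> g1 x u1 \<Longrightarrow>
    (\<forall>t\<in>{0..T}. norm (u1 t) \<le> R) \<Longrightarrow> holder_bound (1 - \<beta>) N 0 T (\<lambda>t. g1 t - \<omega> t) \<Longrightarrow>
    (\<forall>t\<in>{0..T}. norm (u1 t - u t) \<le> K * N) \<and> holder_bound (1 - \<beta>) (K * N) 0 T (\<lambda>t. u1 t - u t)"
    by blast
  define c where "c = T powr (1 - 2 * \<beta>) / (1 - 2 * \<beta>)"
  have c: "0 \<le> c" using \<beta> by (simp add: c_def)
  \<comment> \<open>The summand 1 makes \<open>K'\<close> positive, so that the bound is trivial for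
    an infinite right-hand norm; in \<open>ennreal\<close> a factor 0 would give
    \<open>0 * \<infinity> = 0\<close>.\<close>
  define K' where "K' = K * (1 + c) + 1"
  have K': "0 < K'" using K c by (simp add: K'_def add_nonneg_pos)
  have main: "norm_beta_inf T \<beta> (\<lambda>t. u\<^sub>\<delta> \<delta> t - u t) \<le> ennreal K' * norm_one T \<beta> (\<lambda>t. G \<delta> t - \<omega> t)" if \<delta>: "\<delta> \<in> D" for \<delta>
  proof (cases "norm_one T \<beta> (\<lambda>t. G \<delta> t - \<omega> t) = \<infinity>")
    case True
    then show ?thesis using K' by (simp add: ennreal_mult_top)
  next
    case False
    define N where "N = enn2real (norm_one T \<beta> (\<lambda>t. G \<delta> t - \<omega> t))"
    have N: "0 \<le> N" "norm_one T \<beta> (\<lambda>t. G \<delta> t - \<omega> t) = ennreal N"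
      using False by (auto simp: N_def less_top)
    obtain C where C: "holder_bound \<alpha> C 0 T (G \<delta>)" using holder_on_imp_holder_bound[OF asm(17)[OF \<delta>]] by blast
    have "holder_bound (1 - \<beta>) N 0 T (\<lambda>t. G \<delta> t - \<omega> t)"
      by (rule norm_one_le_imp_holder_bound[OF holder_bound_diff[OF C C\<omega>] a0]) (use N in auto)
    moreover have "\<forall>t\<in>{0..T}. norm (u\<^sub>\<delta> \<delta> t) \<le> R"
      using R1[OF GB[OF \<delta>] asm(19)[OF \<delta>]] R(2) by force
    ultimately have kk: "\<forall>t\<in>{0..T}. norm (u\<^sub>\<delta> \<delta> t - u t) \<le> K * N" "holder_bound (1 - \<beta>) (K * N) 0 T (\<lambda>t. u\<^sub>\<delta> \<delta> t - u t)"
      using Kall[OF GB[OF \<delta>] asm(19)[OF \<delta>]] by blast+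
    have "norm_beta_inf T \<beta> (\<lambda>t. u\<^sub>\<delta> \<delta> t - u t) \<le> ennreal (K * N + K * N * c)"
      unfolding c_def by (rule norm_beta_inf_le[OF \<beta> kk(2)]) (use kk(1) K N in auto)
    also have "\<dots> \<le> ennreal (K' * N)"
      using N by (intro ennreal_leI) (simp add: K'_def algebra_simps)
    also have "\<dots> = ennreal K' * norm_one T \<beta> (\<lambda>t. G \<delta> t - \<omega> t)"
      using K' N by (simp add: ennreal_mult)
    finally show ?thesis .
  qed
  show ?thesis
  proof (intro conjI exI[of _ K'] ballI allI impI)
    show "0 \<le> K'" using K' by simp
    \<comment> \<open>\<open>D\<close> carries no order or topology, so convergence is meant along
      an arbitrary filter concentrated on \<open>D\<close>.\<close>
    fix F assume F: "F \<le> principal D" and lim: "((\<lambda>\<delta>. norm_one T \<beta> (\<lambda>t. G \<delta> t - \<omega> t)) \<longlongrightarrow> 0) F"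
    show "((\<lambda>\<delta>. norm_beta_inf T \<beta> (\<lambda>t. u\<^sub>\<delta> \<delta> t - u t)) \<longlongrightarrow> 0) F"
    proof (rule tendsto_sandwich[OF _ _ tendsto_const])
      show "\<forall>\<^sub>F \<delta> in F. norm_beta_inf T \<beta> (\<lambda>t. u\<^sub>\<delta> \<delta> t - u t) \<le> ennreal K' * norm_one T \<beta> (\<lambda>t. G \<delta> t - \<omega> t)"
        using F main unfolding le_principal by (auto elim: eventually_mono)
      show "((\<lambda>\<delta>. ennreal K' * norm_one T \<beta> (\<lambda>t. G \<delta> t - \<omega> t)) \<longlongrightarrow> 0) F"
        using ennreal_tendsto_cmult[OF _ lim, of "ennreal K'"] by simp
    qed simp
  qed (rule main)
qed

end
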